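(* For any positive integers $n$ and $r$ there are bijections (i) from $r$-colored partitions of $[n]$ to vacillating $r$-partite tableaux of length $2n$; (ii) from $r$-colored matchings of $[n]$ to semi-oscillating $r$-partite tableaux of length $n$; (iii) from $r$-colored complete matchings of $[2n]$ to oscillating $r$-partite tableaux of length $2n$; such that for each of these bijections, if $\Lambda\mapsto(\boldsymbol\lambda^0,\boldsymbol\lambda^1,\dots)$, then for all positive integers $j,k$ we have $\mathrm{cr}(\Lambda)<j$ and $\mathrm{ne}(\Lambda)<k$ if and only if each of the $r$ components of every $\boldsymbol\lambda^i$ has fewer than $j$ columns and fewer than $k$ rows.
   Context: For a partition $P$ of $[n]=\{1,\dots,n\}$, $\mathrm{Arc}(P)$ is the set of pairs $(i,j)$ with $i,j$ in the same block and $j$ the least element of that block greater than $i$. A $k$-crossing is a sequence of arcs with $i_1<\dots<i_k<j_1<\dots<j_k$, a $k$-nesting one with $i_1<\dots<i_k<j_k<\dots<j_1$. An $r$-colored partition is $\Lambda=(P,\varphi)$ with $\varphi:\mathrm{Arc}(P)\to[r]$; $\mathrm{cr}(\Lambda)$ ($\mathrm{ne}(\Lambda)$) is the largest $k$ such that $P$ has a $k$-crossing ($k$-nesting) whose arcs all have the same color. An $r$-colored matching is an $r$-colored partition all of whose blocks have size $1$ or $2$; it is complete if all blocks have size $2$. An integer partition $\lambda$ is identified with its Young diagram; its number of rows is its number of parts and its number of columns is its largest part. An $r$-partite partition is a sequence $\boldsymbol\lambda=(\lambda^1,\dots,\lambda^r)$ of integer partitions; adding (deleting) a box means adding (deleting)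 one box in one component so that the result is again an $r$-partite partition; $\boldsymbol\mu\subseteq\boldsymbol\lambda$ means componentwise inclusion of Young diagrams. A semi-oscillating $r$-partite tableau of length $m$ is a sequence $(\boldsymbol\lambda^0,\dots,\boldsymbol\lambda^m)$ with $\boldsymbol\lambda^0=\boldsymbol\lambda^m$ the empty $r$-partite partition and each $\boldsymbol\lambda^i$ obtained from $\boldsymbol\lambda^{i-1}$ by adding a box, deleting a box, or doing nothing. It is vacillating if moreover $\boldsymbol\lambda^{i-1}\subseteq\boldsymbol\lambda^i$ for even $i$ and $\boldsymbol\lambda^{i-1}\supseteq\boldsymbol\lambda^i$ for odd $i$, and oscillating if $\boldsymbol\lambda^{i-1}\neq\boldsymbol\lambda^i$ for all $i$. *)

theory Defs
  imports "HOL-Library.FuncSet" "HOL-Library.Disjoint_Sets"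
begin

definition Arc :: "nat set set \<Rightarrow> (nat \<times> nat) set" where
  "Arc P = {(i, j). \<exists>B\<in>P. i \<in> B \<and> j \<in> B \<and> i < j \<and> (\<forall>l\<in>B. i < l \<longrightarrow> j \<le> l)}"

text \<open>A sequence of arcs \<open>(i\<^sub>1, j\<^sub>1), \<dots>, (i\<^sub>k, j\<^sub>k)\<close> is a list of pairs; the two chains of
  inequalities say that \<open>i\<^sub>1, \<dots>, i\<^sub>k, j\<^sub>1, \<dots>, j\<^sub>k\<close>, respectively
  \<open>i\<^sub>1, \<dots>, i\<^sub>k, j\<^sub>k, \<dots>, j\<^sub>1\<close>, is strictly increasing.\<close>

definition crossing :: "nat set set \<Rightarrow> nat \<Rightarrow> (nat \<times> nat) list \<Rightarrow> bool" where
  "crossing P k as \<longleftrightarrow> length as = k \<and> set as \<subseteq> Arc P \<and>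
     sorted_wrt (<) (map fst as @ map snd as)"

definition nesting :: "nat set set \<Rightarrow> nat \<Rightarrow> (nat \<times> nat) list \<Rightarrow> bool" where
  "nesting P k as \<longleftrightarrow> length as = k \<and> set as \<subseteq> Arc P \<and>
     sorted_wrt (<) (map fst as @ rev (map snd as))"

type_synonym colored_partition = "nat set set \<times> (nat \<times> nat \<Rightarrow> nat)"

text \<open>The coloring is required to be extensional, so that two colored partitions are equal iff
  the partitions and the colors of all arcs agree.\<close>

definition colored_partitions :: "nat \<Rightarrow> nat \<Rightarrow> colored_partition set" where
  "colored_partitions r n =
     {(P, \<phi>). partition_on {1..n} P \<and> \<phi> \<in> Arc P \<rightarrow>\<^sub>E {1..r}}"

definition colored_matchings :: "nat \<Rightarrow> nat \<Rightarrow> colored_partition set" where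
  "colored_matchings r n =
     {(P, \<phi>) \<in> colored_partitions r n. \<forall>B\<in>P. card B = 1 \<or> card B = 2}"

definition colored_complete_matchings :: "nat \<Rightarrow> nat \<Rightarrow> colored_partition set" where
  "colored_complete_matchings r n =
     {(P, \<phi>) \<in> colored_matchings r n. \<forall>B\<in>P. card B = 2}"

definition monochromatic :: "(nat \<times> nat \<Rightarrow> nat) \<Rightarrow> (nat \<times> nat) list \<Rightarrow> bool" where
  "monochromatic \<phi> as \<longleftrightarrow> (\<forall>a\<in>set as. \<forall>b\<in>set as. \<phi> a = \<phi> b)"

text \<open>The empty list is a 0-crossing and a 0-nesting, so both maxima are over nonempty sets; they
  are finite for partitions of finite sets by the lemmas below.\<close>

definition cr :: "colored_partition \<Rightarrow> nat" where
  "cr \<Lambda> = Max {k. \<exists>as. crossing (fst \<Lambda>) k as \<and> monochromatic (snd \<Lambda>) as}"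

definition ne :: "colored_partition \<Rightarrow> nat" where
  "ne \<Lambda> = Max {k. \<exists>as. nesting (fst \<Lambda>) k as \<and> monochromatic (snd \<Lambda>) as}"

lemma finite_Arc:
  assumes "partition_on {1..n} P"
  shows "finite (Arc P)"
proof (rule finite_subset)
  show "Arc P \<subseteq> {1..n} \<times> {1..n}"
    using partition_onD1[OF assms] unfolding Arc_def by blast
qed simp

lemma arc_list_length_le:
  assumes "finite A" "set as \<subseteq> A" "sorted_wrt (<) (map fst as :: nat list)"
  shows "length as \<le> card A"
proof -
  have "distinct (map fst as)"
    using assms(3) by (simp add: strict_sorted_iff)
  then have "length as = card (set as)"
    by (simp add: distinct_map distinct_card)
  then show ?thesis
    using card_mono[OF assms(1,2)] by simp
qed

lemma finite_crossing_sizes: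
  assumes "partition_on {1..n} P"
  shows "finite {k. \<exists>as. crossing P k as \<and> monochromatic \<phi> as}"
  by (rule finite_subset[of _ "{..card (Arc P)}"])
    (auto simp: crossing_def sorted_wrt_append intro: arc_list_length_le[OF finite_Arc[OF assms]])

lemma finite_nesting_sizes:
  assumes "partition_on {1..n} P"
  shows "finite {k. \<exists>as. nesting P k as \<and> monochromatic \<phi> as}"
  by (rule finite_subset[of _ "{..card (Arc P)}"])
    (auto simp: nesting_def sorted_wrt_append intro: arc_list_length_le[OF finite_Arc[OF assms]])

text \<open>An integer partition is the weakly decreasing list of its (positive) parts.\<close>

definition int_partition :: "nat list \<Rightarrow> bool" where
  "int_partition p \<longleftrightarrow> sorted_wrt (\<ge>) p \<and> 0 \<notin> set p"

definition young :: "nat list \<Rightarrow> (nat \<times> nat) set" where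
  "young p = {(i, j). i < length p \<and> j < p ! i}"

definition rows :: "nat list \<Rightarrow> nat" where
  "rows p = length p"

definition columns :: "nat list \<Rightarrow> nat" where
  "columns p = (if p = [] then 0 else Max (set p))"

definition multipartite :: "nat \<Rightarrow> nat list list \<Rightarrow> bool" where
  "multipartite r L \<longleftrightarrow> length L = r \<and> (\<forall>p\<in>set L. int_partition p)"

definition empty_multipartite :: "nat \<Rightarrow> nat list list" where
  "empty_multipartite r = replicate r []"

definition adds_box :: "nat \<Rightarrow> nat list list \<Rightarrow> nat list list \<Rightarrow> bool" where
  "adds_box r L M \<longleftrightarrow> multipartite r L \<and> multipartite r M \<and>
     (\<exists>c<r. (\<exists>b. b \<notin> young (L ! c) \<and> young (M ! c) = insert b (young (L ! c))) \<and>
            (\<forall>d<r. d \<noteq> c \<longrightarrow> M ! d = L ! d))"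

definition deletes_box :: "nat \<Rightarrow> nat list list \<Rightarrow> nat list list \<Rightarrow> bool" where
  "deletes_box r L M \<longleftrightarrow> multipartite r L \<and> multipartite r M \<and>
     (\<exists>c<r. (\<exists>b. b \<in> young (L ! c) \<and> young (M ! c) = young (L ! c) - {b}) \<and>
            (\<forall>d<r. d \<noteq> c \<longrightarrow> M ! d = L ! d))"

definition multipartite_le :: "nat \<Rightarrow> nat list list \<Rightarrow> nat list list \<Rightarrow> bool" where
  "multipartite_le r L M \<longleftrightarrow> (\<forall>c<r. young (L ! c) \<subseteq> young (M ! c))"

definition semi_oscillating :: "nat \<Rightarrow> nat \<Rightarrow> nat list list list set" where
  "semi_oscillating r m =
     {T. length T = m + 1 \<and> (\<forall>L\<in>set T. multipartite r L) \<and>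
         T ! 0 = empty_multipartite r \<and> T ! m = empty_multipartite r \<and>
         (\<forall>i\<in>{1..m}. adds_box r (T ! (i - 1)) (T ! i) \<or>
                      deletes_box r (T ! (i - 1)) (T ! i) \<or> T ! i = T ! (i - 1))}"

definition vacillating :: "nat \<Rightarrow> nat \<Rightarrow> nat list list list set" where
  "vacillating r m =
     {T \<in> semi_oscillating r m. \<forall>i\<in>{1..m}.
        (even i \<longrightarrow> multipartite_le r (T ! (i - 1)) (T ! i)) \<and>
        (odd i \<longrightarrow> multipartite_le r (T ! i) (T ! (i - 1)))}"

definition oscillating :: "nat \<Rightarrow> nat \<Rightarrow> nat list list list set" where
  "oscillating r m =
     {T \<in> semi_oscillating r m. \<forall>i\<in>{1..m}. T ! (i - 1) \<noteq> T ! i}"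

definition fits :: "nat \<Rightarrow> nat \<Rightarrow> nat list list list \<Rightarrow> bool" where
  "fits j k T \<longleftrightarrow> (\<forall>L\<in>set T. \<forall>p\<in>set L. columns p < j \<and> rows p < k)"

end

theory Submission
  imports Defs "HOL-Library.Sublist"
begin

text \<open>
  At each gap between \<open>t\<close> and \<open>t + 1\<close>, list the openers of the arcs of one color passing over it by
  increasing closer, and insert this word from right to left by Schensted's algorithm. Passing a closer
  undoes the last insertion, and passing an opener adds a new largest entry, so the shape changes by at
  most one box. Conversely the shapes alone determine the tableaux and the arcs, by adding \<open>t + 1\<close> in
  the new box or by reverse insertion from the deleted one. Schensted's theorem identifies the numbers
  of rows and columns with the longest monotone subwords, which are the crossings and nestings over the
  gap; the shapes have to be conjugated for rows to count nestings. Different colors are active at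
  different positions. Partitions reduce to matchings by splitting \<open>i\<close> into a closer \<open>2 * i - 1\<close> and an
  opener \<open>2 * i\<close>.
\<close>

section \<open>Schensted insertion into tableaux given by their row sets\<close>

text \<open>Arcs with all openers before all closers pass over a common gap, for instance the one
  right after the last opener. Sorted by closer, they form a crossing iff their openers increase and
  a nesting iff their openers decrease. Hence only the first row and the first column of each
  tableau have to be interpreted.

  The entries of a tableau are distinct, so a row can be a set, and the column condition becomes an
  inequality between counting functions; a bump changes each of these by at most one on an interval,
  which keeps the case analysis short. The length of the first column is obtained by induction over
  the rows, through the word of the entries bumped out of the first row.

  The obstacle to surjectivity is a clash of directions: a sequence of shapes is decoded from left
  to right, whereas the word at a gap is defined by the closers to its right. So the tableaux are
  built forwards, the matching is read off from the ejected entries, and agreement with the tableaux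
  of that matching is checked backwards from the last gap, where both are empty.\<close>

definition bumps :: "nat \<Rightarrow> nat set \<Rightarrow> bool" where
  "bumps x R \<longleftrightarrow> (\<exists>y\<in>R. x < y)"

definition bumped :: "nat \<Rightarrow> nat set \<Rightarrow> nat" where
  "bumped x R = (LEAST y. y \<in> R \<and> x < y)"

definition row_ins :: "nat \<Rightarrow> nat set \<Rightarrow> nat set" where
  "row_ins x R = insert x (if bumps x R then R - {bumped x R} else R)"

fun ins :: "nat \<Rightarrow> nat set list \<Rightarrow> nat set list" where
  "ins x [] = [{x}]"
| "ins x (R # Q) = row_ins x R # (if bumps x R then ins (bumped x R) Q else Q)"

definition entries :: "nat set list \<Rightarrow> nat set" where
  "entries Q = \<Union>(set Q)"

definition top_row :: "nat set list \<Rightarrow> nat set" where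
  "top_row Q = (if Q = [] then {} else hd Q)"

definition count_less :: "nat set \<Rightarrow> nat \<Rightarrow> nat" where
  "count_less R z = card {a \<in> R. a < z}"

definition count_le :: "nat set \<Rightarrow> nat \<Rightarrow> nat" where
  "count_le R z = card {a \<in> R. a \<le> z}"

text \<open>Strict increase along the columns, expressed by counting: for every \<open>i\<close> the \<open>i\<close>-th smallest
  element of \<open>S\<close> exists only if the one of \<open>R\<close> does and is smaller.\<close>

definition row_above :: "nat set \<Rightarrow> nat set \<Rightarrow> bool" where
  "row_above R S \<longleftrightarrow> (\<forall>z. count_le S z \<le> count_less R z)"

fun tableau :: "nat set list \<Rightarrow> bool" where
  "tableau [] \<longleftrightarrow> True"
| "tableau (R # Q) \<longleftrightarrow> finite R \<and> R \<noteq> {} \<and> R \<inter> entries Q = {} \<and> row_above R (top_row Q) \<and> tableau Q"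

lemma bumped_props:
  assumes "bumps x R"
  shows "bumped x R \<in> R" "x < bumped x R" "\<And>z. z \<in> R \<Longrightarrow> x < z \<Longrightarrow> bumped x R \<le> z"
proof -
  from assms obtain y where "y \<in> R \<and> x < y" by (auto simp: bumps_def)
  then have "bumped x R \<in> R \<and> x < bumped x R" unfolding bumped_def by (rule LeastI)
  then show "bumped x R \<in> R" "x < bumped x R" by auto
  show "bumped x R \<le> z" if "z \<in> R" "x < z" for z
    unfolding bumped_def using that by (auto intro: Least_le)
qed

lemma bumped_eqI:
  assumes "y \<in> R" "x < y" "\<And>z. z \<in> R \<Longrightarrow> x < z \<Longrightarrow> y \<le> z"
  shows "bumps x R" "bumped x R = y"
proof -
  show b: "bumps x R" using assms by (auto simp: bumps_def)
  show "bumped x R = y"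
    using bumped_props[OF b] assms by (meson order_antisym)
qed

lemma entries_simps [simp]: "entries [] = {}" "entries (R # Q) = R \<union> entries Q"
  by (auto simp: entries_def)

lemma top_row_simps [simp]: "top_row [] = {}" "top_row (R # Q) = R"
  by (auto simp: top_row_def)

lemma top_row_subset_entries: "top_row Q \<subseteq> entries Q"
  by (cases Q) auto

lemma top_row_ins: "top_row (ins x Q) = row_ins x (top_row Q)"
  by (cases Q) (auto simp: row_ins_def bumps_def)

lemma entries_ins: "entries (ins x Q) = insert x (entries Q)"
proof (induction x Q rule: ins.induct)
  case (2 x R Q)
  then show ?case using bumped_props[of x R] by (auto simp: row_ins_def)
qed simp

lemma tableau_finite: "tableau Q \<Longrightarrow> finite (top_row Q)"
  by (cases Q) auto

lemma count_insert:
  assumes "finite S" "a \<notin> S"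
  shows "count_le (insert a S) z = count_le S z + (if a \<le> z then 1 else 0)"
    and "count_less (insert a S) z = count_less S z + (if a < z then 1 else 0)"
proof -
  have "{b \<in> insert a S. b \<le> z} = (if a \<le> z then insert a {b \<in> S. b \<le> z} else {b \<in> S. b \<le> z})"
    by auto
  then show "count_le (insert a S) z = count_le S z + (if a \<le> z then 1 else 0)"
    using assms by (simp add: count_le_def)
  have "{b \<in> insert a S. b < z} = (if a < z then insert a {b \<in> S. b < z} else {b \<in> S. b < z})"
    by auto
  then show "count_less (insert a S) z = count_less S z + (if a < z then 1 else 0)"
    using assms by (simp add: count_less_def)
qed

lemma count_remove:
  assumes "finite S" "a \<in> S"
  shows "count_le S z = count_le (S - {a}) z + (if a \<le> z then 1 else 0)"
    and "count_less S z = count_less (S - {a}) z + (if a < z then 1 else 0)"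
  using count_insert[of "S - {a}" a z] assms by (simp_all add: insert_absorb)

lemma count_cong:
  assumes "\<And>a. a \<in> S \<Longrightarrow> a \<le> z \<longleftrightarrow> a < z'"
  shows "count_le S z = count_less S z'"
  unfolding count_le_def count_less_def using assms by (metis (mono_tags, lifting) Collect_cong)

lemma count_less_cong:
  assumes "\<And>a. a \<in> S \<Longrightarrow> a < z \<longleftrightarrow> a < z'"
  shows "count_less S z = count_less S z'"
  unfolding count_less_def using assms by (metis (mono_tags, lifting) Collect_cong)

lemma count_mono:
  assumes "finite S" "z \<le> z'"
  shows "count_less S z \<le> count_less S z'" "count_le S z \<le> count_le S z'"
  unfolding count_less_def count_le_def using assms by (auto intro!: card_mono)

lemma count_subset:
  assumes "finite S" "S' \<subseteq> S"
  shows "count_less S' z \<le> count_less S z" "count_le S' z \<le> count_le S z"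
  unfolding count_less_def count_le_def using assms
  by (auto intro!: card_mono intro: finite_subset)

text \<open>Replacing \<open>bumped x R\<close> by the smaller \<open>x\<close> can only raise the
  right-hand count. The left-hand count rises only for \<open>z\<close> from
  \<open>y = bumped x R\<close> up to the entry that \<open>y\<close> bumps from \<open>S\<close>,
  if there is one. For such \<open>z\<close> the entries of \<open>S\<close> up to \<open>z\<close>
  all lie below \<open>y\<close>; they are at most as many as the entries of \<open>R\<close> below
  \<open>y\<close>, and the new upper row has \<open>x\<close> there as well.\<close>

lemma row_above_ins:
  assumes fin: "finite R" "finite S" and RS: "row_above R S"
    and b: "bumps x R" and x: "x \<notin> R" and y: "bumped x R \<notin> S"
  shows "row_above (row_ins x R) (row_ins (bumped x R) S)"
  unfolding row_above_def
proof
  fix z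
  define y where "y = bumped x R"
  note py = bumped_props[OF b, folded y_def]
  have Rz: "count_less (row_ins x R) z' + (if y < z' then 1 else 0)
      = count_less R z' + (if x < z' then 1 else 0)" for z'
    using count_insert(2)[of "R - {y}" x z'] count_remove(2)[of R y z'] fin x py b
    by (auto simp: row_ins_def y_def[symmetric])
  have RS': "count_le S z' \<le> count_less R z'" for z'
    using RS by (auto simp: row_above_def)
  show "count_le (row_ins (bumped x R) S) z \<le> count_less (row_ins x R) z"
  proof (cases "bumps y S")
    case False
    have S1: "count_le (row_ins y S) z = count_le S z + (if y \<le> z then 1 else 0)"
      using False count_insert(1)[of S y z] fin y by (auto simp: row_ins_def y_def)
    show ?thesis
    proof (cases "y \<le> z")
      case True
      have "count_le S z = count_less S y"
        using False y True
        by (intro count_cong) (auto simp: bumps_def y_def[symmetric], metis le_neq_implies_less not_less)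
      also have "\<dots> \<le> count_le S y"
        unfolding count_less_def count_le_def using fin by (auto intro!: card_mono)
      also have "\<dots> \<le> count_less R y" by (rule RS')
      finally have "count_le S z + 1 \<le> count_less (row_ins x R) y" using Rz[of y] py by auto
      also have "\<dots> \<le> count_less (row_ins x R) z"
        by (rule count_mono) (use True fin in \<open>auto simp: row_ins_def\<close>)
      finally show ?thesis using S1 True by (simp add: y_def)
    next
      case False
      then show ?thesis using S1 Rz[of z] RS'[of z] by (auto simp: y_def split: if_splits)
    qed
  next
    case True
    define w where "w = bumped y S"
    note pw = bumped_props[OF True, folded w_def]
    have S1: "count_le (row_ins y S) z + (if w \<le> z then 1 else 0)
        = count_le S z + (if y \<le> z then 1 else 0)"
      using True count_insert(1)[of "S - {w}" y z] count_remove(1)[of S w z] fin y pw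
      by (auto simp: row_ins_def w_def y_def)
    consider "z < y" | "y \<le> z" "z < w" | "w \<le> z" by linarith
    then show ?thesis
    proof cases
      case 1
      then show ?thesis using S1 Rz[of z] RS'[of z] pw by (auto simp: y_def split: if_splits)
    next
      case 2
      have "a < y" if "a \<in> S" "a \<le> z" for a
        using pw(3)[OF that(1)] that y 2 by (metis leD not_less_iff_gr_or_eq less_le_trans le_less_trans y_def)
      then have "count_le S z = count_less S y"
        using 2 by (intro count_cong) auto
      also have "\<dots> \<le> count_le S y"
        unfolding count_less_def count_le_def using fin by (auto intro!: card_mono)
      also have "\<dots> \<le> count_less R y" by (rule RS')
      finally have "count_le S z + 1 \<le> count_less (row_ins x R) y" using Rz[of y] py by auto
      also have "\<dots> \<le> count_less (row_ins x R) z"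
        by (rule count_mono) (use 2 fin in \<open>auto simp: row_ins_def\<close>)
      finally show ?thesis using S1 2 by (simp add: y_def)
    next
      case 3
      then show ?thesis using S1 Rz[of z] RS'[of z] pw py by (auto simp: y_def split: if_splits)
    qed
  qed
qed

lemma row_above_insert:
  assumes "finite R" "row_above R S"
  shows "row_above (insert x R) S"
  using assms count_subset(1)[of "insert x R" R]
  by (auto simp: row_above_def intro: order_trans)

lemma tableau_ins:
  assumes "tableau Q" "x \<notin> entries Q"
  shows "tableau (ins x Q)"
  using assms
proof (induction x Q rule: ins.induct)
  case (1 x)
  then show ?case by (auto simp: row_above_def count_le_def)
next
  case (2 x R Q)
  show ?case
  proof (cases "bumps x R")
    case True
    note y = bumped_props[OF True]
    have t: "tableau (ins (bumped x R) Q)" using 2 True y by auto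
    have "row_above (row_ins x R) (row_ins (bumped x R) (top_row Q))"
      using 2 True y top_row_subset_entries[of Q] by (intro row_above_ins tableau_finite) auto
    then show ?thesis using 2 True t y
      by (auto simp: top_row_ins entries_ins) (auto simp: row_ins_def)
  next
    case False
    then show ?thesis using 2 row_above_insert[of R _ x] by (auto simp: row_ins_def)
  qed
qed

text \<open>With the old shape known, the size of the new first row tells whether it bumped. If it
  did, the rows below determine the bumped entry \<open>y\<close> by induction. Were
  \<open>x\<close> and \<open>x'\<close> different, each would lie in the other original row; the
  smaller one would then have bumped an entry not above the larger one, which is itself below
  \<open>y\<close>.\<close>

lemma ins_inject:
  assumes "ins x Q = ins x' Q'" "map card Q = map card Q'" "tableau Q" "tableau Q'"
    and "x \<notin> entries Q" "x' \<notin> entries Q'"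
  shows "x = x' \<and> Q = Q'"
  using assms
proof (induction Q arbitrary: x x' Q')
  case Nil
  then show ?case by auto
next
  case (Cons R Q)
  then obtain R' W where Q': "Q' = R' # W" by (cases Q') auto
  note a = Cons.prems[unfolded Q', simplified]
  have cR: "card (row_ins x R) = (if bumps x R then card R else Suc (card R))" if "x \<notin> R" "finite R" for x R
    using that bumped_props(1)[of x R] card_Suc_Diff1[of R "bumped x R"]
    by (auto simp: row_ins_def)
  have same: "bumps x R \<longleftrightarrow> bumps x' R'" using cR[of x R] cR[of x' R'] a by (auto split: if_splits)
  show ?case
  proof (cases "bumps x R")
    case True
    then have True': "bumps x' R'" using same by simp
    note y = bumped_props[OF True] and y' = bumped_props[OF True']
    have "bumped x R \<notin> entries Q" "bumped x' R' \<notin> entries W"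
      using a y(1) y'(1) by (metis disjoint_iff)+
    then have eq: "bumped x R = bumped x' R' \<and> Q = W"
      using Cons.IH[of "bumped x R" "bumped x' R'" W] a True True' y y' by auto
    define y where "y = bumped x R"
    have N: "insert x (R - {y}) = insert x' (R' - {y})"
      using a True True' eq by (auto simp: row_ins_def y_def)
    have "x \<notin> R" "x' \<notin> R'" using a by auto
    have "x = x'"
    proof (rule ccontr)
      assume "x \<noteq> x'"
      then have "x \<in> R'" "x' \<in> R" using N by auto
      then show False using y(2,3) y'(2,3) eq \<open>x \<noteq> x'\<close>
        by (metis leD linorder_neqE_nat)
    qed
    then have "R - {y} = R' - {y}" using N \<open>x \<notin> R\<close> \<open>x' \<notin> R'\<close> by auto
    then have "R = R'" using y(1) y'(1) eq by (auto simp: y_def)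
    then show ?thesis using Q' eq \<open>x = x'\<close> by simp
  next
    case False
    then have False': "\<not> bumps x' R'" using same by simp
    have N: "insert x R = insert x' R'" using a False False' by (auto simp: row_ins_def)
    have "x \<notin> R" "x' \<notin> R'" using a by auto
    then have "x = x'" using N False False' unfolding bumps_def
      by (metis insertE insertI1 linorder_neqE_nat)
    then have "R = R'" using N \<open>x \<notin> R\<close> \<open>x' \<notin> R'\<close> by auto
    then show ?thesis using Q' a False False' \<open>x = x'\<close> by simp
  qed
qed

text \<open>An index beyond the end also appends a part \<open>1\<close>, so \<open>K\<close> is
  determined by the result only under the bound \<open>K \<le> length p\<close>, which accompanies
  \<open>inc\<close> below.\<close>

fun inc :: "nat \<Rightarrow> nat list \<Rightarrow> nat list" where
  "inc K [] = [1]"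
| "inc 0 (x # p) = Suc x # p"
| "inc (Suc K) (x # p) = x # inc K p"

lemma shape_ins:
  assumes "tableau Q" "x \<notin> entries Q"
  shows "\<exists>K\<le>length Q. map card (ins x Q) = inc K (map card Q)"
  using assms
proof (induction x Q rule: ins.induct)
  case (2 x R Q)
  show ?case
  proof (cases "bumps x R")
    case True
    note y = bumped_props[OF True]
    have "card (row_ins x R) = card R"
      using 2 True y card_Suc_Diff1[of R "bumped x R"] by (auto simp: row_ins_def)
    moreover obtain K where "K \<le> length Q" "map card (ins (bumped x R) Q) = inc K (map card Q)"
      using 2 True y by auto
    ultimately show ?thesis using True by (intro exI[of _ "Suc K"]) auto
  next
    case False
    then show ?thesis using 2 by (intro exI[of _ 0]) (auto simp: row_ins_def)
  qed
qed auto

text \<open>Reverse bumping: \<open>y\<close> comes back from the lower row and ejects the largest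
  entry \<open>x\<close> of \<open>R\<close> below it. Only for \<open>x < z \<le> y\<close> does
  the upper count drop. If \<open>z < y\<close>, the lower row still contains \<open>y\<close>,
  which is not counted at \<open>z\<close>, so one unit is to spare: the entries of \<open>R\<close>
  below \<open>y\<close> are the same as those below \<open>z\<close>.\<close>

lemma row_above_unins:
  assumes fin: "finite R" "finite S" and y: "y \<notin> R" "y \<notin> S" and RS: "row_above R (row_ins y S)"
    and x: "x \<in> R" "x < y" "\<And>z. z \<in> R \<Longrightarrow> z < y \<Longrightarrow> z \<le> x"
  shows "row_above (insert y (R - {x})) S"
  unfolding row_above_def
proof
  fix z
  define U where "U = row_ins y S"
  have R1: "count_less (insert y (R - {x})) z + (if x < z then 1 else 0)
      = count_less R z + (if y < z then 1 else 0)"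
    using count_insert(2)[of "R - {x}" y z] count_remove(2)[of R x z] fin x y by auto
  have finU: "finite U" using fin by (auto simp: U_def row_ins_def)
  have RS': "count_le U z' \<le> count_less R z'" for z'
    using RS by (auto simp: row_above_def U_def)
  \<comment> \<open>The second alternative occurs when the entry that \<open>y\<close> bumps is also
    at most \<open>z\<close>, so that the two changes cancel.\<close>
  have U1: "(count_le U z = count_le S z + (if y \<le> z then 1 else 0)) \<or> (y < z \<and> count_le U z = count_le S z)"
  proof (cases "bumps y S")
    case True
    note w = bumped_props[OF True]
    have "count_le U z + (if bumped y S \<le> z then 1 else 0) = count_le S z + (if y \<le> z then 1 else 0)"
      using True count_insert(1)[of "S - {bumped y S}" y z] count_remove(1)[of S "bumped y S" z] fin y w
      by (auto simp: row_ins_def U_def)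
    then show ?thesis using w(2) by (auto split: if_splits)
  next
    case False
    then show ?thesis using count_insert(1)[of S y z] fin y by (auto simp: row_ins_def U_def)
  qed
  consider "z \<le> x" | "x < z" "z < y" | "y \<le> z" by linarith
  then show "count_le S z \<le> count_less (insert y (R - {x})) z"
  proof cases
    case 1
    then show ?thesis using R1 U1 RS'[of z] x by (auto split: if_splits)
  next
    case 2
    have "count_le U z + 1 \<le> count_le U y"
    proof -
      have "insert y {a \<in> U. a \<le> z} \<subseteq> {a \<in> U. a \<le> y}"
        using 2 by (auto simp: U_def row_ins_def)
      then have "card (insert y {a \<in> U. a \<le> z}) \<le> card {a \<in> U. a \<le> y}"
        using finU by (intro card_mono) auto
      then show ?thesis using 2 finU by (simp add: count_le_def)
    qed
    also have "\<dots> \<le> count_less R y" by (rule RS')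
    also have "\<dots> = count_less R z"
      using 2 x by (intro count_less_cong) (metis le_less_trans less_trans)
    finally show ?thesis using U1 R1 2 by (auto split: if_splits)
  next
    case 3
    then show ?thesis using U1 R1 RS'[of z] x by (auto split: if_splits)
  qed
qed

text \<open>Reverse insertion starting from the box by which \<open>inc K p\<close> exceeds
  \<open>p\<close>. In the row of that box the largest entry is ejected; in every row above, the
  entry \<open>y\<close> coming from below ejects the largest smaller entry.\<close>

lemma ins_surj:
  assumes "tableau Q" "map card Q = inc K p" "K \<le> length p" "int_partition p"
  shows "\<exists>x Q'. tableau Q' \<and> map card Q' = p \<and> x \<notin> entries Q' \<and> Q = ins x Q'"
  using assms
proof (induction K p arbitrary: Q rule: inc.induct)
  case (1 K)
  then obtain R where R: "Q = [R]" "card R = 1" by (auto simp: map_eq_Cons_conv)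
  then obtain x where "R = {x}" by (auto simp: card_1_singleton_iff)
  then show ?case using R by (intro exI[of _ x] exI[of _ "[]"]) auto
next
  case (2 c p)
  then obtain R W where Q: "Q = R # W" "card R = Suc c" "map card W = p" by auto
  have fin: "finite R" "R \<noteq> {}" using 2 Q by auto
  define x where "x = Max R"
  have x: "x \<in> R" "\<And>z. z \<in> R \<Longrightarrow> z \<le> x" using fin by (auto simp: x_def)
  have cR: "card (R - {x}) = c" using Q x fin by simp
  have pos: "c > 0" using 2(4) by (auto simp: int_partition_def)
  have nb: "\<not> bumps x (R - {x})" using x by (auto simp: bumps_def not_less)
  have "row_above (R - {x}) (top_row W)"
    unfolding row_above_def
  proof
    fix z
    show "count_le (top_row W) z \<le> count_less (R - {x}) z"
    proof (cases "z \<le> x")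
      case True
      then show ?thesis using 2(1) Q(1) count_remove(2)[of R x z] x(1) fin(1) by (simp add: row_above_def) metis
    next
      case False
      \<comment> \<open>Beyond \<open>x\<close> the shortened row has lost one from its count, so
        the old column condition no longer suffices. Here the partition property of \<open>p\<close>
        helps: the next row has at most \<open>c\<close> entries.\<close>
      have "count_le (top_row W) z \<le> card (top_row W)"
        unfolding count_le_def using 2(1) Q tableau_finite by (intro card_mono) auto
      also have "\<dots> \<le> c" using 2(4) Q(3) by (cases W) (auto simp: int_partition_def)
      also have "c = count_less (R - {x}) z"
      proof -
        have "a < z" if "a \<in> R" for a
          using False x(2)[OF that] by simp
        then have "{a \<in> R - {x}. a < z} = R - {x}" by auto
        then show ?thesis using cR by (simp add: count_less_def)
      qed
      finally show ?thesis .
    qed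
  qed
  moreover have "R - {x} \<noteq> {}" using cR pos by (metis card.empty less_irrefl)
  ultimately have "tableau ((R - {x}) # W)" using 2(1) Q fin by auto
  moreover have "Q = ins x ((R - {x}) # W)" using Q nb x by (auto simp: row_ins_def)
  ultimately show ?case using Q cR 2(1) x
    by (intro exI[of _ x] exI[of _ "(R - {x}) # W"]) auto
next
  case (3 K c p)
  then obtain R W where Q: "Q = R # W" "card R = c" "map card W = inc K p" by auto
  have ip: "int_partition p" using 3 by (auto simp: int_partition_def)
  have tabs: "tableau W" "finite R" "R \<inter> entries W = {}" "row_above R (top_row W)" using 3 Q by auto
  from 3(1)[OF tabs(1) Q(3) _ ip] 3 obtain y W' where
    W': "tableau W'" "map card W' = p" "y \<notin> entries W'" "W = ins y W'" by auto
  have yS: "top_row W = row_ins y (top_row W')" using W' by (simp add: top_row_ins)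
  have yR: "y \<notin> R" using tabs(3) W'(4) by (auto simp: entries_ins)
  \<comment> \<open>The row below contains \<open>y\<close>, so strictness of the columns forces an
    entry smaller than \<open>y\<close> into \<open>R\<close>; this is the entry to eject.\<close>
  have "count_le (top_row W) y > 0"
    using yS tableau_finite[OF tabs(1)]
    by (auto simp: count_le_def card_gt_0_iff row_ins_def)
  then have "count_less R y > 0" using tabs(4) by (metis gr0I le_zero_eq row_above_def)
  then have ne: "{a \<in> R. a < y} \<noteq> {}" by (auto simp: count_less_def card_gt_0_iff)
  define x where "x = Max {a \<in> R. a < y}"
  have fin: "finite {a \<in> R. a < y}" using tabs by auto
  have x: "x \<in> R" "x < y" "\<And>z. z \<in> R \<Longrightarrow> z < y \<Longrightarrow> z \<le> x"
    using Max_in[OF fin ne] Max_ge[OF fin] by (auto simp: x_def)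
  define R' where "R' = insert y (R - {x})"
  have "row_above R' (top_row W')"
    unfolding R'_def using tabs W' yR yS x top_row_subset_entries[of W']
    by (intro row_above_unins tableau_finite) auto
  then have "tableau (R' # W')" using W' tabs by (auto simp: R'_def entries_ins)
  moreover have "bumps x R'" "bumped x R' = y"
    using x yR by (auto intro!: bumped_eqI[of y] simp: R'_def) (meson leD leI)+
  then have "Q = ins x (R' # W')"
    using Q W' x yR by (auto simp: row_ins_def R'_def)
  moreover have "card R' = c" using Q x yR tabs card_Suc_Diff1[of R x] by (auto simp: R'_def)
  moreover have "x \<notin> entries (R' # W')" using x tabs W' by (auto simp: R'_def entries_ins)
  ultimately show ?case using W' by (intro exI[of _ x] exI[of _ "R' # W'"]) auto
qed

section \<open>Removing and adding the largest entry\<close>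

text \<open>Emptied rows are dropped because \<open>tableau\<close> admits only nonempty rows. If
  \<open>t\<close> is the largest entry of a tableau, only its last row can be emptied.\<close>

definition del :: "nat \<Rightarrow> nat set list \<Rightarrow> nat set list" where
  "del t Q = filter (\<lambda>R. R \<noteq> {}) (map (\<lambda>R. R - {t}) Q)"

fun add_max :: "nat \<Rightarrow> nat \<Rightarrow> nat set list \<Rightarrow> nat set list" where
  "add_max K t [] = [{t}]"
| "add_max 0 t (R # Q) = insert t R # Q"
| "add_max (Suc K) t (R # Q) = R # add_max K t Q"

lemma del_simps [simp]: "del t [] = []"
  "del t (R # Q) = (if R - {t} = {} then del t Q else (R - {t}) # del t Q)"
  by (auto simp: del_def)

lemma del_absent:
  assumes "tableau Q" "t \<notin> entries Q"
  shows "del t Q = Q"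
  using assms by (induction Q) auto

text \<open>An entry below \<open>t\<close> in its column would have to exceed
  \<open>t\<close>.\<close>

lemma tableau_singleton_max:
  assumes "tableau ({t} # Q)" "\<And>a. a \<in> entries Q \<Longrightarrow> a \<le> t"
  shows "Q = []"
proof (rule ccontr)
  assume "Q \<noteq> []"
  then obtain S W where Q: "Q = S # W" by (cases Q) auto
  have "count_le S t \<le> count_less {t} t" using assms Q by (auto simp: row_above_def)
  also have "\<dots> = 0" by (auto simp: count_less_def)
  also have "{a \<in> S. a \<le> t} = S" using assms(2) Q by auto
  then have "count_le S t = card S" by (simp add: count_le_def)
  ultimately show False using assms Q by auto
qed

lemma ins_above_eq_add_max:
  assumes "\<And>a. a \<in> entries Q \<Longrightarrow> a < t"
  shows "ins t Q = add_max 0 t Q"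
proof (cases Q)
  case (Cons R W)
  then have "\<not> bumps t R" using assms by (auto simp: bumps_def not_less) (meson less_imp_le)
  then show ?thesis using Cons by (simp add: row_ins_def)
qed simp

lemma del_add_max:
  assumes "tableau Q" "t \<notin> entries Q"
  shows "del t (add_max K t Q) = Q"
  using assms
proof (induction K t Q rule: add_max.induct)
  case (2 t R Q)
  then show ?case by (auto simp: del_absent)
qed auto

lemma entries_add_max: "entries (add_max K t Q) = insert t (entries Q)"
  by (induction K t Q rule: add_max.induct) auto

lemma shape_add_max:
  assumes "tableau Q" "t \<notin> entries Q"
  shows "map card (add_max K t Q) = inc K (map card Q)"
  using assms by (induction K t Q rule: add_max.induct) auto

text \<open>The maximal entry never influences the path of smaller ones. If \<open>x\<close> bumps a
  smaller entry, that bump happens with or without \<open>t\<close>. If it bumps \<open>t\<close>,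
  then \<open>t\<close> settles at the end of the next row and is deleted there, while in the row
  without \<open>t\<close> the entry \<open>x\<close> is simply appended.\<close>

lemma del_ins:
  assumes "tableau Q" "x \<notin> entries Q" "x < t" "\<And>a. a \<in> entries Q \<Longrightarrow> a \<le> t"
  shows "del t (ins x Q) = ins x (del t Q)"
  using assms
proof (induction x Q rule: ins.induct)
  case (1 x)
  then show ?case by auto
next
  case (2 x R Q)
  have tab: "tableau Q" "R \<inter> entries Q = {}" "finite R" "R \<noteq> {}" using 2 by auto
  have ub: "\<And>a. a \<in> entries Q \<Longrightarrow> a \<le> t" "\<And>a. a \<in> R \<Longrightarrow> a \<le> t" using 2 by auto
  show ?case
  proof (cases "t \<in> R")
    case False
    show ?thesis
    proof (cases "bumps x R")
      case True
      note y = bumped_props[OF True]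
      have "bumped x R < t" using y False ub(2) by (metis le_neq_implies_less)
      then have "del t (ins (bumped x R) Q) = ins (bumped x R) (del t Q)"
        using y tab ub by (intro 2(1)[OF True]) auto
      moreover have "row_ins x R - {t} = row_ins x R" using False 2 by (auto simp: row_ins_def)
      ultimately show ?thesis using True False tab by (auto simp: row_ins_def)
    next
      case nb: False
      then show ?thesis using False tab 2 by (auto simp: row_ins_def)
    qed
  next
    case True
    have tQ: "t \<notin> entries Q" using True tab by auto
    have b: "bumps x R" using True 2 by (auto simp: bumps_def)
    note y = bumped_props[OF b]
    show ?thesis
    proof (cases "bumped x R = t")
      case eq: True
      have "ins t Q = add_max 0 t Q"
        using ub(1) tQ by (intro ins_above_eq_add_max) (metis le_neq_implies_less)
      then have d: "del t (ins t Q) = Q" using del_add_max tab tQ by simp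
      have nb: "\<not> bumps x (R - {t})"
        using y(3) eq ub(2) unfolding bumps_def by (metis DiffE leD insertI1 le_neq_implies_less)
      have r: "row_ins x R - {t} = insert x (R - {t})" using b eq 2 by (auto simp: row_ins_def)
      show ?thesis
      proof (cases "R = {t}")
        case True
        then have "Q = []" using tableau_singleton_max[of t Q] 2 by auto
        then show ?thesis using True b eq r d 2 by auto
      next
        case False
        then have "R - {t} \<noteq> {}" using True by auto
        then show ?thesis using b eq r d nb tQ tab by (auto simp: row_ins_def del_absent)
      qed
    next
      case ne: False
      define y' where "y' = bumped x R"
      have yt: "y' < t" using y ne ub(2) by (metis y'_def le_neq_implies_less)
      have b': "bumps x (R - {t})" "bumped x (R - {t}) = y'"
        using y ne bumped_eqI[of y' "R - {t}" x] by (auto simp: y'_def)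
      have "del t (ins y' Q) = ins y' (del t Q)"
        using y yt tab ub unfolding y'_def by (intro 2(1)[OF b]) auto
      moreover have "row_ins x R - {t} = row_ins x (R - {t})"
        using b b' 2 by (auto simp: row_ins_def y'_def)
      moreover have "row_ins x (R - {t}) \<noteq> {}" by (simp add: row_ins_def)
      moreover have "R - {t} \<noteq> {}" using y(1) ne by blast
      ultimately show ?thesis using b b' by (simp add: y'_def)
    qed
  qed
qed

lemma add_max_del:
  assumes "tableau Q" "t \<in> entries Q" "\<And>a. a \<in> entries Q \<Longrightarrow> a \<le> t"
  shows "\<exists>K\<le>length (del t Q). Q = add_max K t (del t Q)"
  using assms
proof (induction Q)
  case (Cons R Q)
  show ?case
  proof (cases "t \<in> R")
    case True
    have tQ: "t \<notin> entries Q" using True Cons by auto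
    show ?thesis
    proof (cases "R = {t}")
      case True
      then have "Q = []" using tableau_singleton_max[of t Q] Cons by auto
      then show ?thesis using True by auto
    next
      case False
      then have "R - {t} \<noteq> {}" using True by auto
      then show ?thesis using True tQ Cons
        by (intro exI[of _ 0]) (auto simp: del_absent insert_absorb)
    qed
  next
    case False
    then obtain K where "K \<le> length (del t Q)" "Q = add_max K t (del t Q)" using Cons by auto
    then show ?thesis using False Cons by (intro exI[of _ "Suc K"]) auto
  qed
qed simp

lemma int_partition_Cons:
  "int_partition (c # p) \<longleftrightarrow> 0 < c \<and> (p = [] \<or> hd p \<le> c) \<and> int_partition p"
  by (cases p) (auto simp: int_partition_def)

text \<open>Compare the two counts at a bound for \<open>S\<close>.\<close>

lemma row_above_card:
  assumes "row_above R S" "finite R" "finite S"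
  shows "card S \<le> card R"
proof -
  obtain N where N: "\<forall>a\<in>S. a \<le> N" using assms(3) finite_nat_set_iff_bounded_le by blast
  have "{a \<in> S. a \<le> N} = S" using N by auto
  then have "card S = count_le S N" by (simp add: count_le_def)
  also have "\<dots> \<le> count_less R N" using assms by (auto simp: row_above_def)
  also have "\<dots> \<le> card R" unfolding count_less_def using assms by (intro card_mono) auto
  finally show ?thesis .
qed

lemma int_partition_shape: "tableau Q \<Longrightarrow> int_partition (map card Q)"
proof (induction Q)
  case Nil
  then show ?case by (simp add: int_partition_def)
next
  case (Cons R Q)
  have "Q = [] \<or> card (hd Q) \<le> card R"
  proof (cases Q)
    case (Cons S W)
    then show ?thesis using row_above_card[of R S] Cons.prems by auto
  qed simp
  then show ?case using Cons
    by (auto simp: int_partition_Cons card_gt_0_iff hd_map)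
qed

text \<open>That the new shape is a partition supplies the strictness at the new entry: the row
  above the lengthened one has an entry over the new box, and all entries above are smaller than
  \<open>t\<close>. In terms of counts, for \<open>z \<ge> t\<close> the whole upper row is
  counted.\<close>

lemma tableau_add_max:
  assumes "tableau Q" "\<And>a. a \<in> entries Q \<Longrightarrow> a < t" "int_partition (inc K (map card Q))" "K \<le> length Q"
  shows "tableau (add_max K t Q)"
  using assms
proof (induction K t Q rule: add_max.induct)
  case (1 K t)
  then show ?case by (auto simp: row_above_def count_le_def)
next
  case (2 t R Q)
  then have "t \<notin> entries Q" by auto
  then show ?case using 2 row_above_insert[of R "top_row Q" t] by auto
next
  case (3 K t R Q)
  have tR: "t \<notin> R" and Rt: "\<And>a. a \<in> R \<Longrightarrow> a < t" using 3 by auto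
  have fin: "finite R" "finite (top_row Q)" using 3 tableau_finite by auto
  have IH: "tableau (add_max K t Q)" using 3 by (auto simp: int_partition_Cons)
  have "row_above R (top_row (add_max K t Q))"
  proof -
    consider "top_row (add_max K t Q) = top_row Q" | "top_row (add_max K t Q) = insert t (top_row Q)"
      by (cases K; cases Q) auto
    then show ?thesis
    proof cases
      case 1
      then show ?thesis using 3 by simp
    next
      case 2
      have tS: "t \<notin> top_row Q" using 3 top_row_subset_entries[of Q] by auto
      have "top_row (add_max K t Q) = hd (add_max K t Q)" "add_max K t Q \<noteq> []"
        by (cases K; cases Q; auto)+
      then have "card (top_row (add_max K t Q)) = hd (map card (add_max K t Q))" by (simp add: hd_map)
      also have "\<dots> = hd (inc K (map card Q))" using shape_add_max[of Q t K] 3(2,3) by fastforce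
      also have "\<dots> \<le> card R" using 3 by (cases Q; cases K) (auto simp: int_partition_Cons)
      finally have c: "card (top_row Q) + 1 \<le> card R" using 2 tS fin by simp
      show ?thesis unfolding 2 row_above_def
      proof
        fix z
        have le: "count_le (top_row Q) z \<le> count_less R z" using 3 by (auto simp: row_above_def)
        show "count_le (insert t (top_row Q)) z \<le> count_less R z"
        proof (cases "t \<le> z")
          case True
          have "count_le (top_row Q) z \<le> card (top_row Q)"
            unfolding count_le_def using fin by (intro card_mono) auto
          moreover have "{a \<in> R. a < z} = R" using Rt True by (auto intro: less_le_trans)
          then have "count_less R z = card R" by (simp add: count_less_def)
          ultimately show ?thesis using count_insert(1)[of "top_row Q" t z] fin tS c by auto
        next
          case False
          then show ?thesis using count_insert(1)[of "top_row Q" t z] fin tS le by auto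
        qed
      qed
    qed
  qed
  then show ?case using 3 IH tR by (auto simp: entries_add_max)
qed

section \<open>Schensted's theorem\<close>

text \<open>Words are inserted from right to left, so that the head of the list is inserted last.\<close>

fun ins_word :: "nat list \<Rightarrow> nat set list" where
  "ins_word [] = []"
| "ins_word (x # v) = ins x (ins_word v)"

fun row_word :: "nat list \<Rightarrow> nat set" where
  "row_word [] = {}"
| "row_word (x # v) = row_ins x (row_word v)"

text \<open>The latest bumped entry stands at the head, so this is again a word to be inserted from
  right to left, namely into the rows below the first one.\<close>

fun bumped_word :: "nat list \<Rightarrow> nat list" where
  "bumped_word [] = []"
| "bumped_word (x # v) =
    (if bumps x (row_word v) then bumped x (row_word v) # bumped_word v else bumped_word v)"

lemma ins_word_rec: "v \<noteq> [] \<Longrightarrow> ins_word v = row_word v # ins_word (bumped_word v)"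
proof (induction v)
  case (Cons x v)
  then show ?case by (cases "v = []") (auto simp: row_ins_def bumps_def)
qed simp

lemma entries_ins_word: "entries (ins_word v) = set v"
  by (induction v) (auto simp: entries_ins)

lemma tableau_ins_word: "distinct v \<Longrightarrow> tableau (ins_word v)"
  by (induction v) (auto simp: entries_ins_word intro: tableau_ins)

lemma del_ins_word:
  assumes "distinct v" "\<And>a. a \<in> set v \<Longrightarrow> a \<le> t"
  shows "del t (ins_word v) = ins_word (filter (\<lambda>a. a \<noteq> t) v)"
  using assms
proof (induction v)
  case (Cons x v)
  have tab: "tableau (ins_word v)" using Cons by (auto intro: tableau_ins_word)
  show ?case
  proof (cases "x = t")
    case True
    have tv: "t \<notin> set v" using Cons True by auto
    then have "\<And>a. a \<in> set v \<Longrightarrow> a < t" using Cons by (metis le_neq_implies_less list.set_intros(2))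
    then have "ins t (ins_word v) = add_max 0 t (ins_word v)"
      by (intro ins_above_eq_add_max) (auto simp: entries_ins_word)
    moreover have "filter (\<lambda>a. a \<noteq> t) v = v" using tv by (auto simp: filter_id_conv)
    ultimately show ?thesis using True tab tv by (simp add: del_add_max entries_ins_word)
  next
    case False
    then have "x < t" using Cons by (metis le_neq_implies_less list.set_intros(1))
    then show ?thesis using False Cons.IH Cons.prems tab
      by (subst ins_word.simps, subst del_ins) (auto simp: entries_ins_word)
  qed
qed simp

lemma row_word_subset: "row_word v \<subseteq> set v"
  by (induction v) (auto simp: row_ins_def)

lemma finite_row_word [simp]: "finite (row_word v)"
  using finite_subset[OF row_word_subset] by blast

lemma count_le_row_ins:
  assumes "finite R" "x \<notin> R"
  shows "count_le R z \<le> count_le (row_ins x R) z"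
proof (cases "bumps x R")
  case True
  note y = bumped_props[OF True]
  have "count_le (row_ins x R) z + (if bumped x R \<le> z then 1 else 0)
      = count_le R z + (if x \<le> z then 1 else 0)"
    using True count_insert(1)[of "R - {bumped x R}" x z] count_remove(1)[of R "bumped x R" z] assms y(1)
    by (auto simp: row_ins_def)
  then show ?thesis using y(2) by (auto split: if_splits)
next
  case False
  then show ?thesis using count_insert(1)[of R x z] assms by (auto simp: row_ins_def)
qed

section \<open>The first row and decreasing subsequences\<close>

lemma subseq_Cons_cases: "subseq ys (z # v) \<longleftrightarrow> subseq ys v \<or> (\<exists>ys'. ys = z # ys' \<and> subseq ys' v)"
  by (auto elim: list_emb.cases)

text \<open>In the order of insertion the subsequence increases and ends with \<open>x\<close>. When
  \<open>x\<close> enters, the row holds \<open>x\<close> and all the entries counted for its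
  predecessor; later insertions replace entries by smaller ones or append, so the count up to
  \<open>x\<close> never falls.\<close>

lemma decreasing_subseq_le_count:
  assumes "distinct v" "subseq (x # ys) v" "sorted_wrt (>) (x # ys)"
  shows "length (x # ys) \<le> count_le (row_word v) x"
  using assms
proof (induction v arbitrary: x ys)
  case (Cons z v)
  have z: "z \<notin> row_word v" using Cons.prems(1) row_word_subset by auto
  note mono = count_le_row_ins[OF finite_row_word z]
  from Cons.prems(2) consider "subseq (x # ys) v" | "x = z" "subseq ys v"
    by (auto simp: subseq_Cons_cases)
  then show ?case
  proof cases
    case 1
    then have "length (x # ys) \<le> count_le (row_word v) x" using Cons by auto
    also have "\<dots> \<le> count_le (row_word (z # v)) x" using mono by simp
    finally show ?thesis .
  next
    case 2
    have zin: "z \<in> row_word (z # v)" by (simp add: row_ins_def)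
    show ?thesis
    proof (cases ys)
      case Nil
      have "{a \<in> row_word (z # v). a \<le> z} \<noteq> {}" using zin by blast
      then show ?thesis using Nil 2 by (simp add: count_le_def Suc_le_eq card_gt_0_iff row_ins_def)
    next
      case (Cons x' ys')
      have "x' < z" using Cons.prems(3) 2 \<open>ys = x' # ys'\<close> by simp
      have "length (x' # ys') \<le> count_le (row_word v) x'"
        using Cons.IH[of x' ys'] Cons.prems 2 \<open>ys = x' # ys'\<close> by simp
      also have "\<dots> \<le> count_le (row_word (z # v)) x'" using mono by simp
      also have "\<dots> < count_le (row_word (z # v)) z"
        unfolding count_le_def
      proof (rule psubset_card_mono)
        have "z \<in> {a \<in> row_word (z # v). a \<le> z} - {a \<in> row_word (z # v). a \<le> x'}"
          using \<open>x' < z\<close> zin by (simp del: row_word.simps)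
        moreover have "{a \<in> row_word (z # v). a \<le> x'} \<subseteq> {a \<in> row_word (z # v). a \<le> z}"
          using \<open>x' < z\<close> by (auto simp del: row_word.simps)
        ultimately show "{a \<in> row_word (z # v). a \<le> x'} \<subset> {a \<in> row_word (z # v). a \<le> z}"
          by blast
      qed (simp del: row_word.simps)
      finally show ?thesis using 2 \<open>ys = x' # ys'\<close> by simp
    qed
  qed
qed simp

text \<open>A subsequence for \<open>y\<close> is obtained from one for the left neighbor of
  \<open>y\<close> in the row at the moment when \<open>y\<close> is inserted. Afterwards the number
  of entries up to \<open>y\<close> stays constant as long as \<open>y\<close> remains in the
  row.\<close>

lemma decreasing_subseq_exists:
  assumes "distinct v" "y \<in> row_word v"
  shows "\<exists>ys. subseq (y # ys) v \<and> sorted_wrt (>) (y # ys) \<and> length (y # ys) = count_le (row_word v) y"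
  using assms
proof (induction v arbitrary: y)
  case (Cons z v)
  define R where "R = row_word v"
  have z: "z \<notin> R" using Cons.prems(1) row_word_subset by (auto simp: R_def)
  have fin: "finite R" by (simp add: R_def)
  show ?case
  proof (cases "y = z")
    case True
    have "{a \<in> row_ins z R. a \<le> z} = insert z {a \<in> R. a < z}"
      using z bumped_props[of z R] by (auto simp: row_ins_def)
    then have c: "count_le (row_word (z # v)) z = Suc (card {a \<in> R. a < z})"
      using fin by (simp add: R_def[symmetric] count_le_def)
    show ?thesis
    proof (cases "{a \<in> R. a < z} = {}")
      case True
      then show ?thesis using c \<open>y = z\<close> by (intro exI[of _ "[]"]) (auto simp: subseq_Cons_cases)
    next
      case False
      define x where "x = Max {a \<in> R. a < z}"
      have x: "x \<in> R" "x < z" "\<And>a. a \<in> R \<Longrightarrow> a < z \<Longrightarrow> a \<le> x"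
        using Max_in[OF _ False] Max_ge[of "{a \<in> R. a < z}"] fin by (auto simp: x_def)
      then obtain ys where ys: "subseq (x # ys) v" "sorted_wrt (>) (x # ys)"
        "length (x # ys) = count_le R x"
        using Cons.IH[of x] Cons.prems(1) by (auto simp: R_def)
      have "{a \<in> R. a \<le> x} = {a \<in> R. a < z}" using x by auto
      then have "length (z # x # ys) = count_le (row_word (z # v)) z" using ys c by (simp add: count_le_def)
      then show ?thesis using ys x \<open>y = z\<close>
        by (intro exI[of _ "x # ys"]) (auto simp: subseq_Cons_cases)
    qed
  next
    case False
    then have y: "y \<in> R" using Cons.prems by (auto simp: R_def row_ins_def split: if_splits)
    obtain ys where ys: "subseq (y # ys) v" "sorted_wrt (>) (y # ys)" "length (y # ys) = count_le R y"
      using Cons y by (auto simp: R_def)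
    have "count_le (row_ins z R) y = count_le R y"
    proof (cases "bumps z R")
      case True
      note w = bumped_props[OF True]
      have "y \<noteq> bumped z R" using False Cons.prems True by (auto simp: row_ins_def R_def)
      then have "bumped z R \<le> y \<longleftrightarrow> z \<le> y" using w(2) w(3)[OF y] False by auto
      then show ?thesis
        using True count_insert(1)[of "R - {bumped z R}" z y] count_remove(1)[of R "bumped z R" y]
          fin w(1) z by (auto simp: row_ins_def)
    next
      case nb: False
      then have "y < z" using y False by (auto simp: bumps_def)
      then show ?thesis using nb count_insert(1)[of R z y] fin z by (auto simp: row_ins_def)
    qed
    then show ?thesis using ys by (auto simp: R_def subseq_Cons_cases)
  qed
qed simp

lemma subseq_take: "subseq (take k ys) ys"
  by (metis append_take_drop_id list_emb_append2 list_emb_prefix subseq_order.order_refl)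

lemma card_row_word:
  assumes "distinct v"
  shows "k \<le> card (row_word v) \<longleftrightarrow> (\<exists>ys. subseq ys v \<and> sorted_wrt (>) ys \<and> length ys = k)"
proof
  assume k: "k \<le> card (row_word v)"
  show "\<exists>ys. subseq ys v \<and> sorted_wrt (>) ys \<and> length ys = k"
  proof (cases "row_word v = {}")
    case True
    then show ?thesis using k by (intro exI[of _ "[]"]) auto
  next
    case False
    define y where "y = Max (row_word v)"
    have y: "y \<in> row_word v" "\<And>a. a \<in> row_word v \<Longrightarrow> a \<le> y" using False by (auto simp: y_def)
    have "{a \<in> row_word v. a \<le> y} = row_word v" using y by auto
    then obtain ys where ys: "subseq ys v" "sorted_wrt (>) ys" "length ys = card (row_word v)"
      using decreasing_subseq_exists[OF assms y(1)] by (auto simp: count_le_def)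
    have "subseq (take k ys) v" using subseq_take ys(1) by (rule subseq_order.trans)
    then show ?thesis using ys k by (intro exI[of _ "take k ys"]) (auto simp: sorted_wrt_take)
  qed
next
  assume "\<exists>ys. subseq ys v \<and> sorted_wrt (>) ys \<and> length ys = k"
  then obtain ys where ys: "subseq ys v" "sorted_wrt (>) ys" "length ys = k" by blast
  show "k \<le> card (row_word v)"
  proof (cases ys)
    case (Cons x zs)
    then have "k \<le> count_le (row_word v) x" using decreasing_subseq_le_count[OF assms] ys by auto
    also have "\<dots> \<le> card (row_word v)" unfolding count_le_def by (intro card_mono) auto
    finally show ?thesis .
  qed (use ys in simp)
qed

text \<open>Between the insertions of two elements \<open>x' > x\<close> an element of \<open>{x<..x'}\<close> is bumped, so an
  increasing subsequence of the word leaves a shorter one in the bumped word. The last clause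
  is the form of this fact that is stable under further insertions.\<close>

lemma increasing_subseq_bumped_word:
  assumes "distinct v" "subseq (x # xs) v" "sorted_wrt (<) (x # xs)"
  shows "\<exists>ys. subseq ys (bumped_word v) \<and> sorted_wrt (<) ys \<and> length ys = length xs \<and>
    (\<forall>y\<in>set ys. x < y) \<and>
    (\<forall>z<x. (\<exists>y\<in>row_word v. z < y \<and> y \<le> x) \<or>
           (\<exists>y. z < y \<and> y \<le> x \<and> subseq (y # ys) (bumped_word v)))"
  using assms
proof (induction v arbitrary: x xs)
  case (Cons u v)
  define R where "R = row_word v"
  have u: "u \<notin> R" using Cons.prems(1) row_word_subset by (auto simp: R_def)
  have w: "subseq ys (bumped_word (u # v))" if "subseq ys (bumped_word v)" for ys
    using that by (auto simp: subseq_Cons_cases)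
  from Cons.prems(2) consider "subseq (x # xs) v" | "x = u" "subseq xs v"
    by (auto simp: subseq_Cons_cases)
  then show ?case
  proof cases
    case 1
    obtain ys where ys: "subseq ys (bumped_word v)" "sorted_wrt (<) ys" "length ys = length xs"
      "\<forall>y\<in>set ys. x < y"
      and alt: "\<And>z. z < x \<Longrightarrow> (\<exists>y\<in>R. z < y \<and> y \<le> x) \<or>
           (\<exists>y. z < y \<and> y \<le> x \<and> subseq (y # ys) (bumped_word v))"
      using Cons.IH[OF _ 1] Cons.prems(1,3) unfolding R_def by auto
    have "(\<exists>y\<in>row_ins u R. z < y \<and> y \<le> x) \<or>
        (\<exists>y. z < y \<and> y \<le> x \<and> subseq (y # ys) (bumped_word (u # v)))" if "z < x" for z
    proof -
      from alt[OF that] show ?thesis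
      proof (elim disjE bexE exE conjE)
        fix y assume y: "y \<in> R" "z < y" "y \<le> x"
        show ?thesis
        proof (cases "bumps u R \<and> y = bumped u R")
          case True
          then have "subseq (y # ys) (bumped_word (u # v))"
            using ys(1) by (auto simp: R_def)
          then show ?thesis using y by blast
        next
          case False
          then have "y \<in> row_ins u R" using y by (auto simp: row_ins_def)
          then show ?thesis using y by blast
        qed
      next
        fix y assume "z < y" "y \<le> x" "subseq (y # ys) (bumped_word v)"
        then show ?thesis using w by blast
      qed
    qed
    then show ?thesis using ys w by (intro exI[of _ ys]) (simp add: R_def)
  next
    case 2
    have uin: "u \<in> row_word (u # v)" by (simp add: row_ins_def)
    show ?thesis
    proof (cases xs)
      case Nil
      then show ?thesis using uin 2 by (intro exI[of _ "[]"]) auto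
    next
      case (Cons x' xs')
      have ux: "u < x'" using Cons.prems(3) 2 \<open>xs = x' # xs'\<close> by simp
      obtain ys where ys: "subseq ys (bumped_word v)" "sorted_wrt (<) ys" "length ys = length xs'"
        "\<forall>y\<in>set ys. x' < y"
        and alt: "(\<exists>y\<in>R. u < y \<and> y \<le> x') \<or>
           (\<exists>y. u < y \<and> y \<le> x' \<and> subseq (y # ys) (bumped_word v))"
        using Cons.IH[of x' xs'] Cons.prems 2 \<open>xs = x' # xs'\<close> ux unfolding R_def by auto
      have "\<exists>y. u < y \<and> y \<le> x' \<and> subseq (y # ys) (bumped_word (u # v))"
        using alt
      proof (elim disjE bexE)
        fix y assume y: "y \<in> R" "u < y \<and> y \<le> x'"
        then have b: "bumps u R" by (auto simp: bumps_def)
        note p = bumped_props[OF b]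
        have "bumped u R \<le> x'" using p(3)[of y] y by auto
        moreover have "subseq (bumped u R # ys) (bumped_word (u # v))"
          using b ys(1) by (auto simp: R_def)
        ultimately show ?thesis using p(2) by blast
      next
        assume "\<exists>y. u < y \<and> y \<le> x' \<and> subseq (y # ys) (bumped_word v)"
        then show ?thesis using w by blast
      qed
      then obtain y where y: "u < y" "y \<le> x'" "subseq (y # ys) (bumped_word (u # v))" by blast
      have "sorted_wrt (<) (y # ys)" "\<forall>a\<in>set (y # ys). u < a" using y ys by auto
      then show ?thesis using y(3) ys(3) uin 2 \<open>xs = x' # xs'\<close>
        by (intro exI[of _ "y # ys"]) auto
    qed
  qed
qed simp

text \<open>Converse of the preceding lemma: an increasing subsequence of the bumped word lifts to a
  longer one of \<open>v\<close>, with a new head \<open>h\<close> below \<open>y\<close>. The lower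
  bound \<open>z\<close> makes the induction work, since it allows an earlier first-row entry to be
  kept below the lifted sequence; \<open>z = 0\<close> stands for no bound.\<close>

lemma bumped_word_increasing_subseq:
  assumes "distinct v" "subseq (y # ys) (bumped_word v)" "sorted_wrt (<) (y # ys)"
    and "z \<in> insert 0 (row_word v)" "z < y"
  shows "\<exists>h zs. subseq (h # zs) v \<and> sorted_wrt (<) (h # zs) \<and> length zs = length (y # ys) \<and>
    z \<le> h \<and> h < y \<and> (\<forall>a\<in>set zs. y \<le> a)"
  using assms
proof (induction v arbitrary: y ys z)
  case (Cons x v)
  define R where "R = row_word v"
  consider "subseq (y # ys) (bumped_word v)" |
    "bumps x R" "y = bumped x R" "subseq ys (bumped_word v)"
    using Cons.prems(2) by (auto simp: R_def subseq_Cons_cases split: if_splits)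
  then show ?case
  proof cases
    case 1
    show ?thesis
    proof (cases "z = x")
      case True
      obtain h zs where h: "subseq (h # zs) v" "sorted_wrt (<) (h # zs)"
        "length zs = length (y # ys)" "h < y" "\<forall>a\<in>set zs. y \<le> a"
        using Cons.IH[OF _ 1 Cons.prems(3), of 0] Cons.prems(1,5) by auto
      \<comment> \<open>The newly inserted \<open>x\<close> is the required lower bound and may
        itself serve as head: it is below \<open>y\<close>, and all of \<open>zs\<close> is at least
        \<open>y\<close>.\<close>
      have "subseq (x # zs) (x # v)" using h(1) by (simp add: subseq_Cons')
      moreover have "sorted_wrt (<) (x # zs)" using h(2,5) Cons.prems(5) True by fastforce
      ultimately show ?thesis using True h Cons.prems(5) by blast
    next
      case False
      then have "z \<in> insert 0 (row_word v)"
        using Cons.prems(4) by (auto simp: row_ins_def split: if_splits)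
      then show ?thesis using Cons.IH[OF _ 1 Cons.prems(3)] Cons.prems(1,5)
        by (metis distinct.simps(2) list_emb_Cons)
    qed
  next
    case 2
    note p = bumped_props[OF 2(1), folded 2(2)]
    have yv: "y \<in> set v" using p(1) row_word_subset by (auto simp: R_def)
    \<comment> \<open>No entry of the new row lies strictly between \<open>x\<close> and the entry
      \<open>y\<close> that it bumped.\<close>
    have zx: "z \<le> x"
    proof (rule ccontr)
      assume "\<not> z \<le> x"
      then have "z \<in> R" "z \<noteq> y" using Cons.prems(4,5) 2 by (auto simp: row_ins_def R_def split: if_splits)
      then show False using p(3)[of z] \<open>\<not> z \<le> x\<close> Cons.prems(5) by auto
    qed
    show ?thesis
    proof (cases ys)
      case Nil
      have "subseq [x, y] (x # v)" using yv by (simp add: subseq_singleton_left)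
      then show ?thesis using Nil zx p(2) by (intro exI[of _ x] exI[of _ "[y]"]) auto
    next
      case (Cons y2 ys2)
      have "y < y2" using Cons.prems(3) \<open>ys = y2 # ys2\<close> by simp
      \<comment> \<open>The bound for the rest is \<open>y\<close>, which was in the row before
        \<open>x\<close> bumped it; the lifted sequence then starts at or above \<open>y\<close>, so
        \<open>x\<close> can be put in front.\<close>
      then obtain h zs where h: "subseq (h # zs) v" "sorted_wrt (<) (h # zs)"
        "length zs = length ys" "y \<le> h" "h < y2" "\<forall>a\<in>set zs. y2 \<le> a"
        using Cons.IH[of y2 ys2 y] Cons.prems(1,3) 2(3) p(1) \<open>ys = y2 # ys2\<close> unfolding R_def by auto
      have "subseq (x # h # zs) (x # v)" using h(1) by simp
      moreover have "sorted_wrt (<) (x # h # zs)" using h p(2) \<open>y < y2\<close> by fastforce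
      moreover have "\<forall>a\<in>set (h # zs). y \<le> a" using h \<open>y < y2\<close> by auto
      ultimately show ?thesis using h(3) zx p(2) by (intro exI[of _ x] exI[of _ "h # zs"]) auto
    qed
  qed
qed simp

lemma distinct_bumped_word: "distinct v \<Longrightarrow> distinct (bumped_word v)"
  and bumped_word_disjoint: "distinct v \<Longrightarrow> row_word v \<inter> set (bumped_word v) = {}"
  and bumped_word_subset: "set (bumped_word v) \<subseteq> set v"
proof (induction v)
  case (Cons x v)
  note p = bumped_props[of x "row_word v"]
  { case 1 then show ?case using Cons p by auto }
  { case 2
    have "x \<notin> row_word v" using 2 row_word_subset by auto
    then show ?case using 2 Cons p by (auto simp: row_ins_def) }
  { case 3 then show ?case using Cons p(1) row_word_subset[of v] by auto }
qed auto

text \<open>Makes the trivial bound \<open>z = 0\<close> admissible when lifting a subsequence of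
  the bumped word.\<close>

lemma bumped_word_pos: "y \<in> set (bumped_word v) \<Longrightarrow> 0 < y"
proof (induction v)
  case (Cons x v)
  then show ?case using bumped_props(2)[of x "row_word v"] by (auto split: if_splits)
qed simp

lemma subseq_set_subset: "subseq xs ys \<Longrightarrow> set xs \<subseteq> set ys"
  by (induction rule: list_emb.induct) auto

text \<open>Passing from \<open>v\<close> to its bumped word removes one row of the tableau and
  shortens the longest increasing subsequence by exactly one.\<close>

lemma length_ins_word:
  assumes "distinct v"
  shows "k \<le> length (ins_word v) \<longleftrightarrow> (\<exists>ys. subseq ys v \<and> sorted_wrt (<) ys \<and> length ys = k)"
  using assms
proof (induction k arbitrary: v)
  case 0
  then show ?case by auto
next
  case (Suc k)
  note IH = Suc.IH[OF distinct_bumped_word[OF Suc.prems]]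
  show ?case
  proof
    assume l: "Suc k \<le> length (ins_word v)"
    then have "v \<noteq> []" by auto
    then have "k \<le> length (ins_word (bumped_word v))" using l ins_word_rec[of v] by simp
    then obtain ys where ys: "subseq ys (bumped_word v)" "sorted_wrt (<) ys" "length ys = k"
      using IH by blast
    show "\<exists>ys. subseq ys v \<and> sorted_wrt (<) ys \<and> length ys = Suc k"
    proof (cases ys)
      case Nil
      then show ?thesis using ys \<open>v \<noteq> []\<close>
        by (intro exI[of _ "[hd v]"]) (auto simp: subseq_singleton_left)
    next
      case (Cons y zs)
      have "0 < y" using bumped_word_pos[of y v] ys(1) Cons by (auto dest: subseq_set_subset)
      then obtain h zs' where "subseq (h # zs') v" "sorted_wrt (<) (h # zs')" "length zs' = length (y # zs)"
        using bumped_word_increasing_subseq[OF Suc.prems, of y zs 0] ys Cons by auto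
      then show ?thesis using ys Cons by (intro exI[of _ "h # zs'"]) auto
    qed
  next
    assume "\<exists>ys. subseq ys v \<and> sorted_wrt (<) ys \<and> length ys = Suc k"
    then obtain x xs where xs: "subseq (x # xs) v" "sorted_wrt (<) (x # xs)" "length xs = k"
      by (metis length_Suc_conv)
    then have "k \<le> length (ins_word (bumped_word v))"
      using increasing_subseq_bumped_word[OF Suc.prems xs(1,2)] IH by auto
    moreover have "v \<noteq> []" using xs(1) by auto
    ultimately show "Suc k \<le> length (ins_word v)" using ins_word_rec[of v] by simp
  qed
qed

lemma card_top_row_ins_word:
  assumes "distinct v"
  shows "k \<le> card (top_row (ins_word v)) \<longleftrightarrow> (\<exists>ys. subseq ys v \<and> sorted_wrt (>) ys \<and> length ys = k)"
proof -
  have "top_row (ins_word v) = row_word v" by (cases "v = []") (simp_all add: ins_word_rec)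
  then show ?thesis using card_row_word[OF assms] by simp
qed

section \<open>Integer partitions, boxes and conjugation\<close>

definition part :: "nat list \<Rightarrow> nat \<Rightarrow> nat" where
  "part p i = (if i < length p then p ! i else 0)"

definition add_box :: "nat list \<Rightarrow> nat list \<Rightarrow> bool" where
  "add_box p q \<longleftrightarrow> (\<exists>b. b \<notin> young p \<and> young q = insert b (young p))"

definition conjugate :: "nat list \<Rightarrow> nat list" where
  "conjugate p = map (\<lambda>j. length (filter (\<lambda>x. j < x) p)) [0..<part p 0]"

lemma int_partition_Nil [simp]: "int_partition []"
  by (simp add: int_partition_def)

lemma mem_young: "(i, j) \<in> young p \<longleftrightarrow> j < part p i"
  by (auto simp: young_def part_def)

lemma young_eq: "young p = {(i, j). j < part p i}"
  using mem_young by auto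

lemma young_Nil [simp]: "young [] = {}"
  by (auto simp: young_def)

lemma part_Cons [simp]: "part (x # p) 0 = x" "part (x # p) (Suc i) = part p i"
  by (auto simp: part_def)

lemma part_Nil [simp]: "part [] i = 0"
  by (auto simp: part_def)

lemma positive_list_eqI:
  assumes "0 \<notin> set p" "0 \<notin> set q" "\<And>i. part p i = part q i"
  shows "p = q"
proof -
  have pos: "0 < part p i \<longleftrightarrow> i < length p" if "0 \<notin> set p" for p i
    using that by (auto simp: part_def in_set_conv_nth)
  have "i < length p \<longleftrightarrow> i < length q" for i using pos assms by metis
  then have "length p = length q" by (metis linorder_neqE_nat less_irrefl)
  then show ?thesis using assms(3) by (intro nth_equalityI) (auto simp: part_def, metis)
qed

lemma young_inject:
  assumes "int_partition p" "int_partition q" "young p = young q"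
  shows "p = q"
proof (rule positive_list_eqI)
  show "part p i = part q i" for i
  proof -
    have "{..<part p i} = {..<part q i}" using assms(3) by (auto simp: young_eq set_eq_iff)
    then show ?thesis by simp
  qed
qed (use assms in \<open>auto simp: int_partition_def\<close>)

lemma part_antimono:
  assumes "int_partition p" "i \<le> i'"
  shows "part p i' \<le> part p i"
  using assms by (cases "i = i'") (auto simp: part_def int_partition_def sorted_wrt_iff_nth_less)

lemma part_inc: "K \<le> length p \<Longrightarrow> part (inc K p) i = (if i = K then Suc (part p i) else part p i)"
proof (induction K p arbitrary: i rule: inc.induct)
  case (1 K)
  then show ?case by (cases i) auto
next
  case (2 x p)
  then show ?case by (cases i) auto
next
  case (3 K x p)
  then show ?case by (cases i) auto
qed

lemma inc_inject:
  assumes "K \<le> length p" "K' \<le> length p" "inc K p = inc K' p"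
  shows "K = K'"
  using part_inc[OF assms(1), of K] part_inc[OF assms(2), of K] assms(3) by (auto split: if_splits)

lemma sum_list_inc: "sum_list (inc K p) = Suc (sum_list p)"
  by (induction K p rule: inc.induct) auto

lemma zero_inc: "0 \<notin> set p \<Longrightarrow> 0 \<notin> set (inc K p)"
  by (induction K p rule: inc.induct) auto

text \<open>Comparing the cardinalities of the rows of the two diagrams shows that just one part
  grows, by one. Its index is at most the number of parts, because otherwise \<open>q\<close> would
  have a zero row above a nonzero one.\<close>

lemma add_box_iff_inc:
  assumes "int_partition p" "int_partition q"
  shows "add_box p q \<longleftrightarrow> (\<exists>K\<le>length p. q = inc K p)"
proof
  assume "add_box p q"
  then obtain K j where b: "(K, j) \<notin> young p" "young q = insert (K, j) (young p)"
    by (auto simp: add_box_def)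
  have eq: "{j'. j' < part q i} = (if i = K then insert j {j'. j' < part p i} else {j'. j' < part p i})" for i
    using b(2) by (auto simp: young_eq set_eq_iff)
  have nj: "j \<notin> {j'. j' < part p K}" using b(1) by (auto simp: mem_young)
  have c: "card {j'. j' < part q i} = (if i = K then Suc (card {j'. j' < part p i}) else card {j'. j' < part p i})" for i
    using eq[of i] nj by simp
  have parts: "part q i = (if i = K then Suc (part p i) else part p i)" for i
    using c[of i] by simp
  have K: "K \<le> length p"
  proof (rule ccontr)
    assume "\<not> K \<le> length p"
    then have "part q K \<le> part p (length p)"
      using part_antimono[OF assms(2), of "length p" K] parts[of "length p"] by auto
    then show False using parts[of K] by (simp add: part_def)
  qed
  have "q = inc K p"
    using assms parts K by (intro positive_list_eqI zero_inc) (auto simp: part_inc int_partition_def)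
  then show "\<exists>K\<le>length p. q = inc K p" using K by blast
next
  assume "\<exists>K\<le>length p. q = inc K p"
  then obtain K where K: "K \<le> length p" "q = inc K p" by blast
  have "young q = insert (K, part p K) (young p)"
    using part_inc[OF K(1)] K(2) by (auto simp: young_eq split: if_splits)
  moreover have "(K, part p K) \<notin> young p" by (simp add: mem_young)
  ultimately show "add_box p q" by (auto simp: add_box_def)
qed

lemma add_box_sum_list:
  assumes "int_partition p" "int_partition q" "add_box p q"
  shows "sum_list q = Suc (sum_list p)"
  using assms by (auto simp: add_box_iff_inc sum_list_inc)

text \<open>In a weakly decreasing list the parts exceeding \<open>j\<close> form an initial
  segment, so their number is the length of column \<open>j\<close> of the diagram.\<close>

lemma less_length_filter:
  assumes "sorted_wrt (\<ge>) p"
  shows "i < length (filter (\<lambda>x. j < x) p) \<longleftrightarrow> j < part p i"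
  using assms
proof (induction p arbitrary: i)
  case (Cons x p)
  show ?case
  proof (cases "j < x")
    case True
    then show ?thesis using Cons by (cases i) auto
  next
    case False
    then have "filter (\<lambda>x. j < x) p = []" using Cons.prems by (auto simp: filter_empty_conv)
    moreover then have "\<not> j < part p i" for i using Cons by (metis list.size(3) not_less_zero sorted_wrt.simps(2))
    ultimately show ?thesis using False by (cases i) auto
  qed
qed simp

lemma length_conjugate: "length (conjugate p) = part p 0"
  by (simp add: conjugate_def)

lemma young_conjugate:
  assumes "int_partition p"
  shows "(j, i) \<in> young (conjugate p) \<longleftrightarrow> (i, j) \<in> young p"
proof -
  have "j < part p i \<Longrightarrow> j < part p 0" using part_antimono[OF assms, of 0 i] by simp
  moreover have "j < part p 0 \<Longrightarrow> conjugate p ! j = length (filter (\<lambda>x. j < x) p)"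
    by (simp add: conjugate_def)
  ultimately show ?thesis
    using less_length_filter[of p i j] assms
    by (auto simp: mem_young part_def[of "conjugate p"] length_conjugate int_partition_def)
qed

lemma int_partition_conjugate:
  assumes "int_partition p"
  shows "int_partition (conjugate p)"
proof -
  have "sorted_wrt (\<ge>) (conjugate p)"
  proof (unfold sorted_wrt_iff_nth_less, intro allI impI)
    fix j j' assume "j < j'" "j' < length (conjugate p)"
    moreover have "length (filter (\<lambda>x. j' < x) p) \<le> length (filter (\<lambda>x. j < x) p)"
      using \<open>j < j'\<close> by (induction p) auto
    ultimately show "conjugate p ! j' \<le> conjugate p ! j"
      by (simp add: conjugate_def)
  qed
  moreover have "0 \<notin> set (conjugate p)"
  proof
    assume "0 \<in> set (conjugate p)"
    then obtain j where j: "j < part p 0" "length (filter (\<lambda>x. j < x) p) = 0"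
      unfolding conjugate_def by (metis (no_types, lifting) atLeast_upt imageE lessThan_iff list.set_map)
    then show False using less_length_filter[of p 0 j] assms by (simp add: int_partition_def)
  qed
  ultimately show ?thesis by (simp add: int_partition_def)
qed

lemma conjugate_conjugate:
  assumes "int_partition p"
  shows "conjugate (conjugate p) = p"
  using assms
  by (intro young_inject int_partition_conjugate) (auto simp: young_conjugate int_partition_conjugate)

lemma young_conjugate_eq:
  assumes "int_partition p"
  shows "young (conjugate p) = prod.swap ` young p"
  using young_conjugate[OF assms] by (force simp: image_iff)

lemma add_box_conjugateI:
  assumes "int_partition p" "int_partition q" "add_box p q"
  shows "add_box (conjugate p) (conjugate q)"
proof -
  obtain b where b: "b \<notin> young p" "young q = insert b (young p)" using assms(3) by (auto simp: add_box_def)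
  have "prod.swap b \<notin> prod.swap ` young p" using b(1) by (metis image_iff swap_swap)
  then show ?thesis using b(2) unfolding add_box_def young_conjugate_eq[OF assms(1)] young_conjugate_eq[OF assms(2)]
    by (intro exI[of _ "prod.swap b"]) auto
qed

lemma conjugate_Nil [simp]: "conjugate [] = []"
  by (simp add: conjugate_def)

lemma columns_eq_part:
  assumes "int_partition p"
  shows "columns p = part p 0"
proof (cases p)
  case Nil
  then show ?thesis by (simp add: columns_def)
next
  case (Cons x q)
  then have "Max (set p) = x" using assms by (intro Max_eqI) (auto simp: int_partition_def)
  then show ?thesis using Cons by (simp add: columns_def)
qed

lemma rows_conjugate: "rows (conjugate p) = part p 0"
  by (simp add: rows_def length_conjugate)

lemma columns_conjugate:
  assumes "int_partition p"
  shows "columns (conjugate p) = length p"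
  using assms length_conjugate[of "conjugate p"]
  by (simp add: columns_eq_part int_partition_conjugate conjugate_conjugate)

section \<open>Matchings of one color\<close>

text \<open>A partial matching of \<open>{1..m}\<close> is given by the map sending each closer to its opener, and every
  other number to \<open>0\<close>.\<close>

definition matching :: "nat \<Rightarrow> (nat \<Rightarrow> nat) \<Rightarrow> bool" where
  "matching m g \<longleftrightarrow> (\<forall>b. g b \<noteq> 0 \<longrightarrow> b \<le> m \<and> g b < b \<and> g (g b) = 0) \<and> inj_on g {b. g b \<noteq> 0}"

text \<open>The openers of the arcs passing over the gap between \<open>t\<close> and \<open>t + 1\<close>, ordered by their closers.\<close>

definition arc_word :: "nat \<Rightarrow> (nat \<Rightarrow> nat) \<Rightarrow> nat \<Rightarrow> nat list" where
  "arc_word m g t = filter (\<lambda>a. 0 < a \<and> a \<le> t) (map g [Suc t..<Suc m])"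

definition arc_tableau :: "nat \<Rightarrow> (nat \<Rightarrow> nat) \<Rightarrow> nat \<Rightarrow> nat set list" where
  "arc_tableau m g t = ins_word (arc_word m g t)"

definition arc_shape :: "nat \<Rightarrow> (nat \<Rightarrow> nat) \<Rightarrow> nat \<Rightarrow> nat list" where
  "arc_shape m g t = map card (arc_tableau m g t)"

text \<open>Walks are total functions; fixing the value \<open>[]\<close> from \<open>m\<close> on
  makes equality of functions mean equality of the sequences of length \<open>m + 1\<close>.\<close>

definition box_walk :: "nat \<Rightarrow> (nat \<Rightarrow> nat list) \<Rightarrow> bool" where
  "box_walk m S \<longleftrightarrow> S 0 = [] \<and> (\<forall>t\<ge>m. S t = []) \<and> (\<forall>t. int_partition (S t)) \<and>
     (\<forall>t<m. S (Suc t) = S t \<or> add_box (S t) (S (Suc t)) \<or> add_box (S (Suc t)) (S t))"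

lemma arc_word_altdef: "arc_word m g t = map g (filter (\<lambda>b. 0 < g b \<and> g b \<le> t) [Suc t..<Suc m])"
  by (simp add: arc_word_def filter_map comp_def)

lemma distinct_arc_word:
  assumes "matching m g"
  shows "distinct (arc_word m g t)"
  unfolding arc_word_altdef distinct_map
  using assms by (auto simp: matching_def intro: inj_on_subset)

lemma set_arc_word: "a \<in> set (arc_word m g t) \<longleftrightarrow> 0 < a \<and> a \<le> t \<and> (\<exists>b. t < b \<and> b \<le> m \<and> g b = a)"
  by (auto simp: arc_word_def image_iff Suc_le_eq less_Suc_eq_le simp del: upt_Suc)

lemma tableau_arc_tableau: "matching m g \<Longrightarrow> tableau (arc_tableau m g t)"
  by (simp add: arc_tableau_def tableau_ins_word distinct_arc_word)

lemma entries_arc_tableau: "entries (arc_tableau m g t) = set (arc_word m g t)"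
  by (simp add: arc_tableau_def entries_ins_word)

text \<open>The arc closing at \<open>t + 1\<close> has the smallest closer among those over the
  gap, so its opener is the head of the word.\<close>

lemma arc_tableau_close:
  assumes g: "matching m g" and x: "g (Suc t) \<noteq> 0" and t: "t < m"
  shows "arc_tableau m g t = ins (g (Suc t)) (arc_tableau m g (Suc t))"
    and "g (Suc t) \<notin> entries (arc_tableau m g (Suc t))"
proof -
  have "[Suc t..<Suc m] = Suc t # [Suc (Suc t)..<Suc m]" using t by (simp add: upt_conv_Cons)
  moreover have "g (Suc t) \<le> t" using g x by (metis matching_def less_Suc_eq_le)
  moreover have "filter (\<lambda>a. 0 < a \<and> a \<le> t) (map g [Suc (Suc t)..<Suc m]) = arc_word m g (Suc t)"
    unfolding arc_word_def
  proof (rule filter_cong[OF refl])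
    fix a assume "a \<in> set (map g [Suc (Suc t)..<Suc m])"
    then obtain b where "a = g b" by auto
    \<comment> \<open>The position \<open>Suc t\<close> is a closer, hence not the opener of any
      arc.\<close>
    then have "a \<noteq> Suc t" using g x by (metis matching_def nat.distinct(1))
    then show "(0 < a \<and> a \<le> t) = (0 < a \<and> a \<le> Suc t)" by auto
  qed
  ultimately have w: "arc_word m g t = g (Suc t) # arc_word m g (Suc t)"
    using x by (simp add: arc_word_def del: upt_Suc)
  then show "arc_tableau m g t = ins (g (Suc t)) (arc_tableau m g (Suc t))"
    by (simp add: arc_tableau_def)
  show "g (Suc t) \<notin> entries (arc_tableau m g (Suc t))"
    using distinct_arc_word[OF g, of t] w by (simp add: entries_arc_tableau)
qed

text \<open>Openers and isolated points are treated together: the two words differ at most by the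
  letter \<open>t + 1\<close>, which is the largest possible one.\<close>

lemma arc_tableau_not_close:
  assumes g: "matching m g" and x: "g (Suc t) = 0" and t: "t < m"
  shows "arc_tableau m g t = del (Suc t) (arc_tableau m g (Suc t))"
proof -
  have "[Suc t..<Suc m] = Suc t # [Suc (Suc t)..<Suc m]" using t by (simp add: upt_conv_Cons)
  then have "arc_word m g t = filter (\<lambda>a. 0 < a \<and> a \<le> t) (map g [Suc (Suc t)..<Suc m])"
    using x by (simp add: arc_word_def del: upt_Suc)
  also have "\<dots> = filter (\<lambda>a. a \<noteq> Suc t) (arc_word m g (Suc t))"
    unfolding arc_word_def filter_filter by (rule filter_cong) auto
  finally show ?thesis
    unfolding arc_tableau_def using distinct_arc_word[OF g] set_arc_word
    by (subst del_ins_word) auto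
qed

lemma int_partition_arc_shape: "matching m g \<Longrightarrow> int_partition (arc_shape m g t)"
  by (simp add: arc_shape_def int_partition_shape tableau_arc_tableau)

lemma arc_shape_close:
  assumes g: "matching m g" and x: "g (Suc t) \<noteq> 0" and t: "t < m"
  shows "add_box (arc_shape m g (Suc t)) (arc_shape m g t)"
  using shape_ins[OF tableau_arc_tableau[OF g] arc_tableau_close(2)[OF assms]]
    arc_tableau_close(1)[OF assms] int_partition_arc_shape[OF g]
  by (auto simp: add_box_iff_inc) (auto simp: arc_shape_def)

lemma arc_tableau_open:
  assumes g: "matching m g" and x: "Suc t \<in> range g" and t: "t < m"
  shows "\<exists>K\<le>length (arc_tableau m g t). arc_tableau m g (Suc t) = add_max K (Suc t) (arc_tableau m g t)"
    and "Suc t \<notin> entries (arc_tableau m g t)"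
proof -
  obtain b where b: "g b = Suc t" using x by auto
  have g0: "g (Suc t) = 0" using g b by (metis matching_def nat.distinct(1))
  have "b \<le> m" "Suc t < b" using g b by (metis matching_def nat.distinct(1))+
  then have "Suc t \<in> entries (arc_tableau m g (Suc t))"
    using b by (auto simp: entries_arc_tableau set_arc_word)
  then show "\<exists>K\<le>length (arc_tableau m g t). arc_tableau m g (Suc t) = add_max K (Suc t) (arc_tableau m g t)"
    using add_max_del[OF tableau_arc_tableau[OF g], of "Suc t" "Suc t"]
    unfolding arc_tableau_not_close[OF g g0 t]
    by (auto simp: entries_arc_tableau set_arc_word)
  show "Suc t \<notin> entries (arc_tableau m g t)" by (simp add: entries_arc_tableau set_arc_word)
qed

lemma arc_shape_open:
  assumes g: "matching m g" and x: "Suc t \<in> range g" and t: "t < m"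
  shows "add_box (arc_shape m g t) (arc_shape m g (Suc t))"
proof -
  obtain K where K: "K \<le> length (arc_tableau m g t)"
    "arc_tableau m g (Suc t) = add_max K (Suc t) (arc_tableau m g t)"
    using arc_tableau_open(1)[OF assms] by blast
  then have "arc_shape m g (Suc t) = inc K (arc_shape m g t)"
    unfolding arc_shape_def
    using shape_add_max[OF tableau_arc_tableau[OF g] arc_tableau_open(2)[OF assms]] by simp
  moreover have "K \<le> length (arc_shape m g t)" using K(1) by (simp add: arc_shape_def)
  ultimately show ?thesis
    using add_box_iff_inc[OF int_partition_arc_shape[OF g] int_partition_arc_shape[OF g]] by blast
qed

lemma arc_tableau_same:
  assumes g: "matching m g" and x: "g (Suc t) = 0" "Suc t \<notin> range g" and t: "t < m"
  shows "arc_tableau m g (Suc t) = arc_tableau m g t"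
proof -
  have "Suc t \<notin> entries (arc_tableau m g (Suc t))"
    using x(2) unfolding entries_arc_tableau set_arc_word by (metis rangeI)
  then show ?thesis
    using arc_tableau_not_close[OF g x(1) t] del_absent[OF tableau_arc_tableau[OF g]] by metis
qed

lemma arc_tableau_ends: "arc_tableau m g 0 = []" "m \<le> t \<Longrightarrow> arc_tableau m g t = []"
proof -
  have "arc_word m g 0 = []" by (auto simp: arc_word_def filter_empty_conv)
  then show "arc_tableau m g 0 = []" by (simp add: arc_tableau_def)
qed (simp add: arc_tableau_def arc_word_def)

text \<open>The type of the position fixes the change in the number of boxes to be minus one, plus
  one or zero. These exclude each other, so each implication from the type of the position to the
  type of the step is an equivalence.\<close>

lemma arc_shape_step:
  assumes g: "matching m g" and t: "t < m"
  shows "add_box (arc_shape m g (Suc t)) (arc_shape m g t) \<longleftrightarrow> g (Suc t) \<noteq> 0"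
    and "add_box (arc_shape m g t) (arc_shape m g (Suc t)) \<longleftrightarrow> Suc t \<in> range g"
    and "arc_shape m g (Suc t) = arc_shape m g t \<longleftrightarrow> g (Suc t) = 0 \<and> Suc t \<notin> range g"
proof -
  note ip = int_partition_arc_shape[OF g]
  have "g (Suc t) = 0" if "Suc t \<in> range g" using that g by (metis matching_def nat.distinct(1) rangeE)
  then have "(g (Suc t) \<noteq> 0 \<and> Suc t \<notin> range g \<and> sum_list (arc_shape m g t) = Suc (sum_list (arc_shape m g (Suc t)))) \<or>
    (g (Suc t) = 0 \<and> Suc t \<in> range g \<and> sum_list (arc_shape m g (Suc t)) = Suc (sum_list (arc_shape m g t))) \<or>
    (g (Suc t) = 0 \<and> Suc t \<notin> range g \<and> sum_list (arc_shape m g (Suc t)) = sum_list (arc_shape m g t))"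
    using add_box_sum_list[OF ip ip arc_shape_close[OF g _ t]] add_box_sum_list[OF ip ip arc_shape_open[OF g _ t]]
      arc_tableau_same[OF g _ _ t] unfolding arc_shape_def by metis
  note c = this add_box_sum_list[OF ip ip]
  show "add_box (arc_shape m g (Suc t)) (arc_shape m g t) \<longleftrightarrow> g (Suc t) \<noteq> 0"
    using c(1) c(2)[of "Suc t" t] arc_shape_close[OF g _ t] by fastforce
  show "add_box (arc_shape m g t) (arc_shape m g (Suc t)) \<longleftrightarrow> Suc t \<in> range g"
    using c(1) c(2)[of t "Suc t"] arc_shape_open[OF g _ t] by fastforce
  show "arc_shape m g (Suc t) = arc_shape m g t \<longleftrightarrow> g (Suc t) = 0 \<and> Suc t \<notin> range g"
    using c(1) arc_tableau_same[OF g _ _ t] by (auto simp: arc_shape_def)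
qed

lemma box_walk_arc_shape:
  assumes g: "matching m g"
  shows "box_walk m (arc_shape m g)"
  unfolding box_walk_def
proof (intro conjI allI impI)
  show "arc_shape m g 0 = []" by (simp add: arc_shape_def arc_tableau_ends)
  show "arc_shape m g t = []" if "m \<le> t" for t using that by (simp add: arc_shape_def arc_tableau_ends)
  show "int_partition (arc_shape m g t)" for t by (rule int_partition_arc_shape[OF g])
  show "arc_shape m g (Suc t) = arc_shape m g t \<or> add_box (arc_shape m g t) (arc_shape m g (Suc t)) \<or>
      add_box (arc_shape m g (Suc t)) (arc_shape m g t)" if "t < m" for t
    using arc_shape_step[OF g that] by metis
qed

section \<open>Reconstructing a matching from its shapes\<close>

lemma inj_on_arc_shape: "inj_on (arc_shape m) {g. matching m g}"
proof (rule inj_onI, simp)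
  fix g h assume g: "matching m g" and h: "matching m h" and eq: "arc_shape m g = arc_shape m h"
  \<comment> \<open>The tableaux have to be carried along: the value of \<open>g\<close> at a closer
    is the entry that reverse insertion ejects from the current tableau.\<close>
  have "arc_tableau m g t = arc_tableau m h t \<and> (\<forall>b\<le>t. g b = h b)" if "t \<le> m" for t
    using that
  proof (induction t)
    case 0
    then show ?case using g h arc_tableau_ends(1) by (metis less_nat_zero_code matching_def le_zero_eq)
  next
    case (Suc t)
    then have t: "t < m" and IH: "arc_tableau m g t = arc_tableau m h t" "\<forall>b\<le>t. g b = h b" by auto
    note st = arc_shape_step[OF g t] arc_shape_step[OF h t, folded eq]
    show ?case
    proof (cases "g (Suc t) = 0")
      case False
      then have False': "h (Suc t) \<noteq> 0" using st by blast
      have "g (Suc t) = h (Suc t) \<and> arc_tableau m g (Suc t) = arc_tableau m h (Suc t)"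
        using IH(1) arc_tableau_close[OF g False t] arc_tableau_close[OF h False' t]
          fun_cong[OF eq, of "Suc t"] tableau_arc_tableau[OF g] tableau_arc_tableau[OF h]
        by (intro ins_inject) (auto simp: arc_shape_def)
      then show ?thesis using IH(2) by (auto simp: le_Suc_eq)
    next
      case True
      then have True': "h (Suc t) = 0" using st by blast
      have "arc_tableau m g (Suc t) = arc_tableau m h (Suc t)"
      proof (cases "Suc t \<in> range g")
        case r: True
        then have r': "Suc t \<in> range h" using st by blast
        obtain K where K: "K \<le> length (arc_tableau m g t)"
          "arc_tableau m g (Suc t) = add_max K (Suc t) (arc_tableau m g t)"
          using arc_tableau_open(1)[OF g r t] by blast
        obtain K' where K': "K' \<le> length (arc_tableau m h t)"
          "arc_tableau m h (Suc t) = add_max K' (Suc t) (arc_tableau m h t)"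
          using arc_tableau_open(1)[OF h r' t] by blast
        have "inc K (map card (arc_tableau m g t)) = inc K' (map card (arc_tableau m g t))"
          using shape_add_max[OF tableau_arc_tableau[OF g] arc_tableau_open(2)[OF g r t]]
            fun_cong[OF eq, of "Suc t"] K(2) K'(2) IH(1) by (metis arc_shape_def)
        then have "K = K'" using K(1) K'(1) IH(1) by (auto dest: inc_inject[rotated 2])
        then show ?thesis using K K' IH by simp
      next
        case r: False
        then have r': "Suc t \<notin> range h" using st by blast
        show ?thesis using arc_tableau_same[OF g True r t] arc_tableau_same[OF h True' r' t] IH by simp
      qed
      then show ?thesis using IH(2) True True' by (auto simp: le_Suc_eq)
    qed
  qed
  then have "g b = h b" if "b \<le> m" for b using that by blast
  moreover have "g b = h b" if "\<not> b \<le> m" for b using that g h by (metis matching_def)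
  ultimately show "g = h" by blast
qed

lemma box_walk_in_range_arc_shape:
  assumes S: "box_walk m S"
  shows "\<exists>g. matching m g \<and> arc_shape m g = S"
proof -
  have ip: "int_partition (S t)" for t using S by (auto simp: box_walk_def)
  \<comment> \<open>The transitions of tableaux that realize a step of \<open>S\<close>. Together
    with the shape invariant they are forced, but their existence suffices, so the sequence is
    obtained by choice.\<close>
  define step where "step t Q Q' \<longleftrightarrow>
     (S (Suc t) = S t \<and> Q' = Q) \<or>
     (add_box (S t) (S (Suc t)) \<and> (\<exists>K. Q' = add_max K (Suc t) Q)) \<or>
     (add_box (S (Suc t)) (S t) \<and> (\<exists>x. x \<notin> entries Q' \<and> Q = ins x Q'))" for t Q Q'
  define inv where "inv t Q \<longleftrightarrow> tableau Q \<and> map card Q = S t \<and> entries Q \<subseteq> {1..t}" for t Q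
  have "\<exists>Qs. \<forall>t. (inv t (Qs t)) \<and> step t (Qs t) (Qs (Suc t))"
  proof (rule dependent_nat_choice)
    show "\<exists>Q. inv 0 Q" using S by (intro exI[of _ "[]"]) (auto simp: inv_def box_walk_def)
    fix Q t assume inv: "inv t Q"
    then have tab: "tableau Q" and sh: "map card Q = S t" and en: "entries Q \<subseteq> {1..t}" by (auto simp: inv_def)
    have l: "length (S t) = length Q" using sh by (metis length_map)
    have nin: "Suc t \<notin> entries Q" using en by auto
    have "S (Suc t) = S t \<or> add_box (S t) (S (Suc t)) \<or> add_box (S (Suc t)) (S t)"
    proof (cases "t < m")
      case False
      then show ?thesis using S by (auto simp: box_walk_def)
    qed (use S in \<open>auto simp: box_walk_def\<close>)
    then show "\<exists>Q'. inv (Suc t) Q' \<and> step t Q Q'"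
    proof (elim disjE)
      assume "S (Suc t) = S t"
      then show ?thesis using inv by (intro exI[of _ Q]) (auto simp: inv_def step_def)
    next
      assume ab: "add_box (S t) (S (Suc t))"
      then obtain K where K: "K \<le> length (S t)" "S (Suc t) = inc K (S t)"
        using add_box_iff_inc[OF ip ip] by blast
      have "tableau (add_max K (Suc t) Q)"
        using tab en K ip[of "Suc t"] sh l by (intro tableau_add_max) (auto simp: subset_iff)
      moreover have "map card (add_max K (Suc t) Q) = S (Suc t)"
        using shape_add_max[OF tab nin] sh K by simp
      ultimately show ?thesis using ab en
        by (intro exI[of _ "add_max K (Suc t) Q"]) (auto simp: inv_def step_def entries_add_max)
    next
      assume ab: "add_box (S (Suc t)) (S t)"
      then obtain K where K: "K \<le> length (S (Suc t))" "S t = inc K (S (Suc t))"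
        using add_box_iff_inc[OF ip ip] by blast
      then obtain x Q' where "tableau Q'" "map card Q' = S (Suc t)" "x \<notin> entries Q'" "Q = ins x Q'"
        using ins_surj[OF tab _ K(1) ip] sh by auto
      then show ?thesis using ab en
        by (intro exI[of _ Q']) (auto simp: inv_def step_def entries_ins)
    qed
  qed
  then obtain Qs where Qinv: "\<And>t. inv t (Qs t)" and Qst: "\<And>t. step t (Qs t) (Qs (Suc t))" by blast
  have "\<exists>x. add_box (S (Suc t)) (S t) \<longrightarrow> x \<notin> entries (Qs (Suc t)) \<and> Qs t = ins x (Qs (Suc t))" for t
  proof -
    have "\<exists>x. x \<notin> entries (Qs (Suc t)) \<and> Qs t = ins x (Qs (Suc t))" if "add_box (S (Suc t)) (S t)"
      using Qst[of t] that add_box_sum_list[OF ip ip, of t "Suc t"] add_box_sum_list[OF ip ip, of "Suc t" t]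
      by (auto simp: step_def)
    then show ?thesis by blast
  qed
  then obtain xs where xs: "\<And>t. add_box (S (Suc t)) (S t) \<Longrightarrow>
      xs t \<notin> entries (Qs (Suc t)) \<and> Qs t = ins (xs t) (Qs (Suc t))" by metis
  \<comment> \<open>A closer is a position where a box disappears, and its opener is the entry
    ejected there.\<close>
  define g where "g b = (case b of 0 \<Rightarrow> 0 | Suc t \<Rightarrow> if add_box (S (Suc t)) (S t) then xs t else 0)" for b
  have g0: "g 0 = 0" by (simp add: g_def)
  have gS: "g (Suc t) = (if add_box (S (Suc t)) (S t) then xs t else 0)" for t by (simp add: g_def)
  have xin: "xs t \<in> entries (Qs t)" "1 \<le> xs t" "xs t \<le> t" if "add_box (S (Suc t)) (S t)" for t
    using xs[OF that] Qinv[of t] by (auto simp: inv_def entries_ins)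
  define opens where "opens a \<longleftrightarrow> (\<exists>t. a = Suc t \<and> add_box (S t) (S (Suc t)))" for a
  \<comment> \<open>The entries are the openers that are still open. Both remaining properties of a
    matching follow: an ejected entry is the position of an added box, hence no closer, and it has
    not been ejected before.\<close>
  have en: "entries (Qs t) = {a. opens a \<and> a \<le> t} - g ` {..t}" for t
  proof (induction t)
    case 0
    then show ?case using Qinv[of 0] by (auto simp: inv_def opens_def)
  next
    case (Suc t)
    have atm: "g ` {..Suc t} = insert (g (Suc t)) (g ` {..t})" by (simp add: atMost_Suc)
    have op: "{a. opens a \<and> a \<le> Suc t} = (if add_box (S t) (S (Suc t)) then insert (Suc t) {a. opens a \<and> a \<le> t} else {a. opens a \<and> a \<le> t})"
      by (auto simp: opens_def le_Suc_eq)
    have o0: "\<not> opens 0" by (simp add: opens_def)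
    have gle: "Suc t \<notin> g ` {..t}"
    proof
      assume "Suc t \<in> g ` {..t}"
      then obtain b where b: "b \<le> t" "g b = Suc t" by force
      then obtain s where "b = Suc s" using g0 by (cases b) auto
      then show False using b gS[of s] xin[of s] by (auto split: if_splits)
    qed
    from Qst[of t] consider
        "S (Suc t) = S t" "Qs (Suc t) = Qs t"
      | K where "add_box (S t) (S (Suc t))" "Qs (Suc t) = add_max K (Suc t) (Qs t)"
      | "add_box (S (Suc t)) (S t)"
      unfolding step_def by blast
    then show ?case
    proof cases
      case 1
      then have "\<not> add_box (S t) (S (Suc t))" "\<not> add_box (S (Suc t)) (S t)"
        by (auto simp: add_box_def)
      then show ?thesis using 1 Suc o0 unfolding atm op by (auto simp: gS)
    next
      case 2
      then have "\<not> add_box (S (Suc t)) (S t)"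
        using add_box_sum_list[OF ip ip, of t "Suc t"] add_box_sum_list[OF ip ip, of "Suc t" t] by auto
      then show ?thesis using 2 Suc o0 gle unfolding atm op by (auto simp: gS entries_add_max)
    next
      case 3
      then have "\<not> add_box (S t) (S (Suc t))"
        using add_box_sum_list[OF ip ip, of t "Suc t"] add_box_sum_list[OF ip ip, of "Suc t" t] by auto
      moreover have "entries (Qs (Suc t)) = entries (Qs t) - {xs t}"
        using xs[OF 3] by (auto simp: entries_ins)
      ultimately show ?thesis using 3 Suc unfolding atm op by (auto simp: gS)
    qed
  qed
  have gpos: "\<exists>t<m. b = Suc t \<and> add_box (S (Suc t)) (S t) \<and> g b = xs t" if gb: "g b \<noteq> 0" for b
  proof -
    obtain t where t: "b = Suc t" using gb g0 by (cases b) auto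
    then have ab: "add_box (S (Suc t)) (S t)" using gb gS[of t] by (auto split: if_splits)
    have "t < m"
    proof (rule ccontr)
      assume "\<not> t < m"
      then have "S t = []" "S (Suc t) = []" using S by (auto simp: box_walk_def)
      then show False using ab by (simp add: add_box_def)
    qed
    then show ?thesis using t ab gS by auto
  qed
  have match: "matching m g"
    unfolding matching_def
  proof (intro conjI allI impI)
    fix b assume "g b \<noteq> 0"
    then obtain t where t: "t < m" "b = Suc t" "add_box (S (Suc t)) (S t)" "g b = xs t" using gpos by blast
    show "b \<le> m" using t by simp
    show "g b < b" using t xin[of t] by simp
    have "opens (xs t)" using en[of t] xin(1)[OF t(3)] by auto
    then obtain s where "xs t = Suc s" "add_box (S s) (S (Suc s))" by (auto simp: opens_def)
    then show "g (g b) = 0"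
      using t gS[of s] add_box_sum_list[OF ip ip, of s "Suc s"] add_box_sum_list[OF ip ip, of "Suc s" s] by auto
  next
    have key: "g b \<noteq> g b'" if gb: "g b \<noteq> 0" "g b' \<noteq> 0" "b < b'" for b b'
    proof -
      obtain t where t: "t < m" "b' = Suc t" "add_box (S (Suc t)) (S t)" "g b' = xs t" using gpos gb by blast
      have "g b \<in> g ` {..t}" using gb(3) t(2) by auto
      then show ?thesis using en[of t] xin(1)[OF t(3)] t(4) by auto
    qed
    show "inj_on g {b. g b \<noteq> 0}"
    proof (rule inj_onI)
      fix b b' assume a: "b \<in> {b. g b \<noteq> 0}" "b' \<in> {b. g b \<noteq> 0}" "g b = g b'"
      show "b = b'" using key[of b b'] key[of b' b] a by (cases b b' rule: linorder_cases) auto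
    qed
  qed
  \<comment> \<open>Backward induction: at a closer the chosen entry is inserted again, and at all
    other positions the largest possible entry is deleted.\<close>
  have eqQ: "arc_tableau m g t = Qs t" if "t \<le> m" for t
    using that
  proof (induction t rule: inc_induct)
    case base
    have "map card (Qs m) = []" using Qinv[of m] S by (simp add: inv_def box_walk_def)
    then show ?case by (simp add: arc_tableau_ends)
  next
    case (step t)
    show ?case
    proof (cases "add_box (S (Suc t)) (S t)")
      case True
      then have "g (Suc t) = xs t" "g (Suc t) \<noteq> 0" using gS xin(2)[OF True] by auto
      then show ?thesis using arc_tableau_close(1)[OF match, of t] step xs[OF True] by simp
    next
      case False
      then have "g (Suc t) = 0" using gS by simp
      then have d: "arc_tableau m g t = del (Suc t) (Qs (Suc t))"
        using arc_tableau_not_close[OF match, of t] step by simp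
      have tab: "tableau (Qs t)" "Suc t \<notin> entries (Qs t)" using Qinv[of t] by (auto simp: inv_def)
      have "del (Suc t) (Qs (Suc t)) = Qs t"
        using Qst[of t] False tab by (auto simp: step_def del_absent del_add_max)
      then show ?thesis using d by simp
    qed
  qed
  have "arc_shape m g t = S t" for t
  proof (cases "t \<le> m")
    case True
    then show ?thesis using eqQ Qinv[of t] by (simp add: arc_shape_def inv_def)
  next
    case False
    then show ?thesis using S by (simp add: arc_shape_def arc_tableau_ends box_walk_def)
  qed
  then show ?thesis using match by blast
qed

section \<open>Transposed walks and the arcs over a gap\<close>

definition walk_of :: "nat \<Rightarrow> (nat \<Rightarrow> nat) \<Rightarrow> nat \<Rightarrow> nat list" where
  "walk_of m g t = conjugate (arc_shape m g t)"

lemma box_walk_conjugate: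
  assumes "box_walk m S"
  shows "box_walk m (\<lambda>t. conjugate (S t))"
  using assms unfolding box_walk_def
  by (metis add_box_conjugateI int_partition_conjugate conjugate_Nil)

lemma bij_betw_walk_of: "bij_betw (walk_of m) {g. matching m g} {S. box_walk m S}"
proof (rule bij_betw_imageI)
  show "inj_on (walk_of m) {g. matching m g}"
  proof (rule inj_onI)
    fix g h assume a: "g \<in> {g. matching m g}" "h \<in> {g. matching m g}" "walk_of m g = walk_of m h"
    have "arc_shape m g t = arc_shape m h t" for t
      using fun_cong[OF a(3), of t] a(1,2)
      by (metis walk_of_def conjugate_conjugate int_partition_arc_shape mem_Collect_eq)
    then show "g = h" using inj_onD[OF inj_on_arc_shape _ a(1,2)] by blast
  qed
  show "walk_of m ` {g. matching m g} = {S. box_walk m S}"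
  proof (intro equalityI subsetI)
    fix S assume "S \<in> walk_of m ` {g. matching m g}"
    then obtain g where "matching m g" "S = walk_of m g" by auto
    then show "S \<in> {S. box_walk m S}"
      using box_walk_conjugate[OF box_walk_arc_shape[of m g]] by (simp add: walk_of_def[abs_def])
  next
    fix S assume "S \<in> {S. box_walk m S}"
    then have S: "box_walk m S" by simp
    obtain g where g: "matching m g" "arc_shape m g = (\<lambda>t. conjugate (S t))"
      using box_walk_in_range_arc_shape[OF box_walk_conjugate[OF S]] by blast
    have "walk_of m g = S"
      using g(2) S by (auto simp: walk_of_def box_walk_def conjugate_conjugate)
    then show "S \<in> walk_of m ` {g. matching m g}" using g(1) by auto
  qed
qed

lemma walk_of_step:
  assumes g: "matching m g" and t: "t < m"
  shows "add_box (walk_of m g (Suc t)) (walk_of m g t) \<longleftrightarrow> g (Suc t) \<noteq> 0"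
    and "add_box (walk_of m g t) (walk_of m g (Suc t)) \<longleftrightarrow> Suc t \<in> range g"
    and "walk_of m g (Suc t) = walk_of m g t \<longleftrightarrow> g (Suc t) = 0 \<and> Suc t \<notin> range g"
proof -
  note ip = int_partition_arc_shape[OF g]
  have 1: "add_box (walk_of m g s) (walk_of m g s') \<longleftrightarrow> add_box (arc_shape m g s) (arc_shape m g s')" for s s'
    using add_box_conjugateI[OF ip ip, of s s']
      add_box_conjugateI[OF int_partition_conjugate[OF ip] int_partition_conjugate[OF ip], of s s']
    by (auto simp: walk_of_def conjugate_conjugate ip)
  have 2: "walk_of m g (Suc t) = walk_of m g t \<longleftrightarrow> arc_shape m g (Suc t) = arc_shape m g t"
    unfolding walk_of_def by (metis conjugate_conjugate ip)
  show "add_box (walk_of m g (Suc t)) (walk_of m g t) \<longleftrightarrow> g (Suc t) \<noteq> 0"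
    "add_box (walk_of m g t) (walk_of m g (Suc t)) \<longleftrightarrow> Suc t \<in> range g"
    "walk_of m g (Suc t) = walk_of m g t \<longleftrightarrow> g (Suc t) = 0 \<and> Suc t \<notin> range g"
    unfolding 1 2 by (rule arc_shape_step[OF g t])+
qed

text \<open>The letters are openers listed by closer, so a subsequence amounts to an increasing list
  \<open>bs\<close> of closers of arcs over the gap. The relation \<open>R\<close> is left open to
  serve rows and columns alike.\<close>

lemma subseq_arc_word:
  "(\<exists>ys. subseq ys (arc_word m g t) \<and> sorted_wrt R ys \<and> length ys = k) \<longleftrightarrow>
   (\<exists>bs. sorted_wrt (<) bs \<and> (\<forall>b\<in>set bs. t < b \<and> b \<le> m \<and> 0 < g b \<and> g b \<le> t) \<and>
      sorted_wrt R (map g bs) \<and> length bs = k)"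
proof
  assume "\<exists>ys. subseq ys (arc_word m g t) \<and> sorted_wrt R ys \<and> length ys = k"
  then obtain ys where ys: "subseq ys (arc_word m g t)" "sorted_wrt R ys" "length ys = k" by blast
  define L where "L = filter (\<lambda>b. 0 < g b \<and> g b \<le> t) [Suc t..<Suc m]"
  have sL: "sorted_wrt (<) L" unfolding L_def by (intro sorted_wrt_filter sorted_wrt_upt)
  from ys(1) obtain N where "ys = nths (map g L) N"
    unfolding arc_word_altdef L_def[symmetric] by (auto simp: subseq_conv_nths)
  then have ym: "ys = map g (nths L N)" by (simp add: nths_map)
  have "sorted_wrt (<) (nths L N)"
    using sL subseq_conv_nths by (metis strict_sorted_iff sorted_nths distinct_nthsI)
  moreover have "set (nths L N) \<subseteq> set L" by (rule set_nths_subset)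
  ultimately show "\<exists>bs. sorted_wrt (<) bs \<and> (\<forall>b\<in>set bs. t < b \<and> b \<le> m \<and> 0 < g b \<and> g b \<le> t) \<and>
      sorted_wrt R (map g bs) \<and> length bs = k"
    using ys(2,3) ym by (intro exI[of _ "nths L N"]) (auto simp: L_def)
next
  assume "\<exists>bs. sorted_wrt (<) bs \<and> (\<forall>b\<in>set bs. t < b \<and> b \<le> m \<and> 0 < g b \<and> g b \<le> t) \<and>
      sorted_wrt R (map g bs) \<and> length bs = k"
  then obtain bs where bs: "sorted_wrt (<) bs" "\<forall>b\<in>set bs. t < b \<and> b \<le> m \<and> 0 < g b \<and> g b \<le> t"
    "sorted_wrt R (map g bs)" "length bs = k" by blast
  define L where "L = filter (\<lambda>b. 0 < g b \<and> g b \<le> t) [Suc t..<Suc m]"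
  have sL: "sorted_wrt (<) L" unfolding L_def by (intro sorted_wrt_filter sorted_wrt_upt)
  have "set bs \<subseteq> set L" using bs(2) by (auto simp: L_def)
  then have "bs = filter (\<lambda>b. b \<in> set bs) L"
    using bs(1) sL by (intro sorted_distinct_set_unique) (auto simp: strict_sorted_iff sorted_wrt_filter)
  then have "subseq bs L" by (metis subseq_filter_left)
  then have "subseq (map g bs) (arc_word m g t)"
    unfolding arc_word_altdef L_def[symmetric] by (rule subseq_map)
  then show "\<exists>ys. subseq ys (arc_word m g t) \<and> sorted_wrt R ys \<and> length ys = k"
    using bs(3,4) by (intro exI[of _ "map g bs"]) auto
qed

lemma columns_walk_of:
  assumes "matching m g"
  shows "k \<le> columns (walk_of m g t) \<longleftrightarrow>
    (\<exists>bs. sorted_wrt (<) bs \<and> (\<forall>b\<in>set bs. t < b \<and> b \<le> m \<and> 0 < g b \<and> g b \<le> t) \<and>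
      sorted_wrt (<) (map g bs) \<and> length bs = k)"
proof -
  have "columns (walk_of m g t) = length (ins_word (arc_word m g t))"
    using int_partition_arc_shape[OF assms, of t]
    by (simp add: walk_of_def columns_conjugate arc_shape_def arc_tableau_def)
  then show ?thesis
    using length_ins_word[OF distinct_arc_word[OF assms]] subseq_arc_word[of m g t "(<)" k] by simp
qed

lemma rows_walk_of:
  assumes "matching m g"
  shows "k \<le> rows (walk_of m g t) \<longleftrightarrow>
    (\<exists>bs. sorted_wrt (<) bs \<and> (\<forall>b\<in>set bs. t < b \<and> b \<le> m \<and> 0 < g b \<and> g b \<le> t) \<and>
      sorted_wrt (>) (map g bs) \<and> length bs = k)"
proof -
  have "rows (walk_of m g t) = part (arc_shape m g t) 0"
    by (simp add: walk_of_def rows_conjugate)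
  also have "\<dots> = card (top_row (ins_word (arc_word m g t)))"
    by (cases "ins_word (arc_word m g t)") (simp_all add: arc_shape_def arc_tableau_def)
  finally show ?thesis
    using card_top_row_ins_word[OF distinct_arc_word[OF assms]] subseq_arc_word[of m g t "(>)" k] by simp
qed

section \<open>Colored matchings and multipartite tableaux\<close>

text \<open>The endpoints of the arcs. The position \<open>0\<close> must be excluded explicitly,
  because as the default value it always lies in the range of a matching.\<close>

definition active :: "(nat \<Rightarrow> nat) \<Rightarrow> nat \<Rightarrow> bool" where
  "active g s \<longleftrightarrow> s \<noteq> 0 \<and> (g s \<noteq> 0 \<or> s \<in> range g)"

text \<open>The last condition says that every position is an endpoint in at most one component, so
  at most one component of the tableau changes in each step. Components from \<open>r\<close> on are
  set to the empty matching to make families extensional.\<close>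

definition matching_families :: "nat \<Rightarrow> nat \<Rightarrow> (nat \<Rightarrow> nat \<Rightarrow> nat) set" where
  "matching_families r m = {G. (\<forall>c. matching m (G c)) \<and> (\<forall>c\<ge>r. G c = (\<lambda>_. 0)) \<and>
     (\<forall>c d s. active (G c) s \<longrightarrow> active (G d) s \<longrightarrow> c = d)}"

definition tableau_of :: "nat \<Rightarrow> nat \<Rightarrow> (nat \<Rightarrow> nat \<Rightarrow> nat) \<Rightarrow> nat list list list" where
  "tableau_of r m G = map (\<lambda>t. map (\<lambda>c. walk_of m (G c) t) [0..<r]) [0..<Suc m]"

lemma tableau_of_nth: "t \<le> m \<Longrightarrow> c < r \<Longrightarrow> tableau_of r m G ! t ! c = walk_of m (G c) t"
  by (simp add: tableau_of_def del: upt_Suc)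

lemma length_tableau_of: "length (tableau_of r m G) = Suc m" "t \<le> m \<Longrightarrow> length (tableau_of r m G ! t) = r"
  by (simp_all add: tableau_of_def del: upt_Suc)

lemma ball_predecessor: "(\<forall>i\<in>{1..m}. Q (i - 1) i) \<longleftrightarrow> (\<forall>t<m. Q t (Suc t))"
proof
  assume a: "\<forall>i\<in>{1..m}. Q (i - 1) i"
  show "\<forall>t<m. Q t (Suc t)"
  proof (intro allI impI)
    fix t assume "t < m"
    then show "Q t (Suc t)" using bspec[OF a, of "Suc t"] by simp
  qed
next
  assume a: "\<forall>t<m. Q t (Suc t)"
  show "\<forall>i\<in>{1..m}. Q (i - 1) i"
  proof
    fix i assume "i \<in> {1..m}"
    then show "Q (i - 1) i" using a by (cases i) auto
  qed
qed

lemma adds_box_iff: "adds_box r L M \<longleftrightarrow> multipartite r L \<and> multipartite r M \<and>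
    (\<exists>c<r. add_box (L ! c) (M ! c) \<and> (\<forall>d<r. d \<noteq> c \<longrightarrow> M ! d = L ! d))"
  by (simp add: adds_box_def add_box_def)

lemma deletes_box_iff: "deletes_box r L M \<longleftrightarrow> multipartite r L \<and> multipartite r M \<and>
    (\<exists>c<r. add_box (M ! c) (L ! c) \<and> (\<forall>d<r. d \<noteq> c \<longrightarrow> M ! d = L ! d))"
proof -
  have "(\<exists>b. b \<in> X \<and> Y = X - {b}) \<longleftrightarrow> (\<exists>b. b \<notin> Y \<and> X = insert b Y)" for X Y :: "(nat \<times> nat) set"
    by (metis Diff_insert_absorb insertI1 insert_Diff insert_absorb mk_disjoint_insert)
  then show ?thesis by (simp add: deletes_box_def add_box_def)
qed

lemma box_walk_walk_of: "matching m g \<Longrightarrow> box_walk m (walk_of m g)"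
  using bij_betw_walk_of[of m] by (auto simp: bij_betw_def)

lemma walk_of_step_active:
  assumes "matching m g" "t < m"
  shows "walk_of m g (Suc t) = walk_of m g t \<longleftrightarrow> \<not> active g (Suc t)"
  using walk_of_step(3)[OF assms] by (auto simp: active_def)

lemma active_bounds: "matching m g \<Longrightarrow> active g s \<Longrightarrow> 0 < s \<and> s \<le> m"
  unfolding active_def matching_def by (metis gr0I less_le_trans less_imp_le rangeE)

lemma multipartite_tableau_of:
  assumes "G \<in> matching_families r m" "t \<le> m"
  shows "multipartite r (tableau_of r m G ! t)"
proof -
  have "int_partition (walk_of m (G c) t)" for c
    using assms box_walk_walk_of[of m "G c"] by (auto simp: matching_families_def box_walk_def)
  then show ?thesis using assms(2) by (auto simp: multipartite_def tableau_of_def simp del: upt_Suc)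
qed

lemma tableau_of_eq_iff:
  assumes "s \<le> m" "t \<le> m"
  shows "tableau_of r m G ! s = tableau_of r m G ! t \<longleftrightarrow> (\<forall>c<r. walk_of m (G c) s = walk_of m (G c) t)"
  using assms by (auto simp: list_eq_iff_nth_eq length_tableau_of tableau_of_nth)

lemma tableau_of_semi_oscillating:
  assumes G: "G \<in> matching_families r m"
  shows "tableau_of r m G \<in> semi_oscillating r m"
proof -
  define T where "T = tableau_of r m G"
  have match: "matching m (G c)" for c using G by (simp add: matching_families_def)
  note bw = box_walk_walk_of[OF match]
  have "\<forall>L\<in>set T. multipartite r L"
    using multipartite_tableau_of[OF G] unfolding T_def
    by (metis in_set_conv_nth length_tableau_of(1) less_Suc_eq_le)
  moreover have "walk_of m (G c) 0 = []" "walk_of m (G c) m = []" for c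
    using bw[of c] by (auto simp: box_walk_def)
  then have "T ! 0 = empty_multipartite r" "T ! m = empty_multipartite r"
    by (auto simp: T_def length_tableau_of tableau_of_nth empty_multipartite_def intro!: nth_equalityI)
  moreover have "adds_box r (T ! t) (T ! Suc t) \<or> deletes_box r (T ! t) (T ! Suc t) \<or> T ! Suc t = T ! t"
    if t: "t < m" for t
  proof (cases "\<exists>c<r. active (G c) (Suc t)")
    case False
    then have "T ! Suc t = T ! t"
      unfolding T_def using t walk_of_step_active[OF match t] by (subst tableau_of_eq_iff) auto
    then show ?thesis by simp
  next
    case True
    then obtain c where c: "c < r" "active (G c) (Suc t)" by blast
    have oth: "T ! Suc t ! d = T ! t ! d" if "d < r" "d \<noteq> c" for d
    proof -
      have "\<not> active (G d) (Suc t)" using G c that unfolding matching_families_def by blast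
      then show ?thesis unfolding T_def using t that walk_of_step_active[OF match t] by (simp add: tableau_of_nth)
    qed
    have "walk_of m (G c) (Suc t) \<noteq> walk_of m (G c) t" using c walk_of_step_active[OF match t] by simp
    then have "add_box (T ! t ! c) (T ! Suc t ! c) \<or> add_box (T ! Suc t ! c) (T ! t ! c)"
      using bw[of c] t c by (auto simp: T_def tableau_of_nth box_walk_def)
    moreover have "multipartite r (T ! t)" "multipartite r (T ! Suc t)"
      using multipartite_tableau_of[OF G] t by (auto simp: T_def)
    ultimately show ?thesis unfolding adds_box_iff deletes_box_iff using c oth by blast
  qed
  then have "\<forall>i\<in>{1..m}. adds_box r (T ! (i - 1)) (T ! i) \<or> deletes_box r (T ! (i - 1)) (T ! i) \<or> T ! i = T ! (i - 1)"
    using ball_predecessor[of m "\<lambda>s t. adds_box r (T ! s) (T ! t) \<or> deletes_box r (T ! s) (T ! t) \<or> T ! t = T ! s"]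
    by blast
  ultimately show ?thesis unfolding semi_oscillating_def by (simp add: T_def length_tableau_of)
qed

lemma matching_zero: "matching m (\<lambda>_. 0)"
  by (simp add: matching_def)

lemma bij_betw_tableau_of: "bij_betw (tableau_of r m) (matching_families r m) (semi_oscillating r m)"
proof (rule bij_betw_imageI)
  show "inj_on (tableau_of r m) (matching_families r m)"
  proof (rule inj_onI)
    fix G H assume G: "G \<in> matching_families r m" and H: "H \<in> matching_families r m"
      and eq: "tableau_of r m G = tableau_of r m H"
    have match: "matching m (G c)" "matching m (H c)" for c using G H by (auto simp: matching_families_def)
    have "G c = H c" for c
    proof (cases "c < r")
      case True
      have "walk_of m (G c) t = walk_of m (H c) t" for t
      proof (cases "t \<le> m")
        case t: True
        then show ?thesis using eq True by (metis tableau_of_nth)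
      next
        case False
        then show ?thesis using box_walk_walk_of[OF match(1)] box_walk_walk_of[OF match(2)]
          by (auto simp: box_walk_def)
      qed
      then show ?thesis
        using bij_betw_imp_inj_on[OF bij_betw_walk_of] match by (metis ext inj_on_eq_iff mem_Collect_eq)
    next
      case False
      then show ?thesis using G H by (auto simp: matching_families_def)
    qed
    then show "G = H" by blast
  qed
  have "T \<in> tableau_of r m ` matching_families r m" if T: "T \<in> semi_oscillating r m" for T
  proof -
    define S where "S c t = (if t \<le> m then T ! t ! c else [])" for c t
    have len: "length T = Suc m" and mp: "\<And>t. t \<le> m \<Longrightarrow> multipartite r (T ! t)"
      and ends: "T ! 0 = empty_multipartite r" "T ! m = empty_multipartite r"
      using T by (auto simp: semi_oscillating_def)
    have lenT: "length (T ! t) = r" if "t \<le> m" for t using mp[OF that] by (simp add: multipartite_def)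
    have stepT: "adds_box r (T ! t) (T ! Suc t) \<or> deletes_box r (T ! t) (T ! Suc t) \<or> T ! Suc t = T ! t"
      if "t < m" for t
    proof -
      have "Suc t \<in> {1..m}" using that by auto
      then show ?thesis using T unfolding semi_oscillating_def by fastforce
    qed
    have bw: "box_walk m (S c)" if c: "c < r" for c
      unfolding box_walk_def
    proof (intro conjI allI impI)
      show "S c 0 = []" using ends c by (simp add: S_def empty_multipartite_def)
      show "S c t = []" if "m \<le> t" for t using ends c that by (simp add: S_def empty_multipartite_def)
      show "int_partition (S c t)" for t
        using mp[of t] lenT[of t] c by (auto simp: S_def multipartite_def)
      show "S c (Suc t) = S c t \<or> add_box (S c t) (S c (Suc t)) \<or> add_box (S c (Suc t)) (S c t)"
        if "t < m" for t
        using stepT[OF that] that c unfolding adds_box_iff deletes_box_iff S_def by (auto split: if_splits)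
    qed
    have "\<exists>g. c < r \<longrightarrow> matching m g \<and> walk_of m g = S c" for c
    proof -
      have "S c \<in> walk_of m ` {g. matching m g}" if "c < r"
        using bw[OF that] bij_betw_imp_surj_on[OF bij_betw_walk_of, of m] by simp
      then show ?thesis by (cases "c < r") auto
    qed
    then obtain H where H: "\<And>c. c < r \<Longrightarrow> matching m (H c) \<and> walk_of m (H c) = S c" by metis
    define G where "G c = (if c < r then H c else (\<lambda>_. 0))" for c
    have match: "matching m (G c)" for c using H by (simp add: G_def matching_zero)
    have "c = d" if ac: "active (G c) s" and ad: "active (G d) s" for c d s
    proof -
      have r: "c < r" "d < r" using ac ad by (auto simp: G_def active_def split: if_splits)
      obtain t where t: "s = Suc t" "t < m"
        using active_bounds[OF match ac] by (metis Suc_le_lessD gr0_implies_Suc)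
      have "walk_of m (G c) (Suc t) \<noteq> walk_of m (G c) t" "walk_of m (G d) (Suc t) \<noteq> walk_of m (G d) t"
        using walk_of_step_active[OF match t(2)] ac ad t(1) by simp_all
      then have "S c (Suc t) \<noteq> S c t" "S d (Suc t) \<noteq> S d t" using H r by (auto simp: G_def)
      then have "T ! Suc t ! c \<noteq> T ! t ! c" "T ! Suc t ! d \<noteq> T ! t ! d" using t(2) by (auto simp: S_def)
      \<comment> \<open>A single step alters one component only.\<close>
      then show "c = d" using stepT[OF t(2)] r unfolding adds_box_iff deletes_box_iff by metis
    qed
    then have G: "G \<in> matching_families r m" using match by (auto simp: matching_families_def G_def)
    have "tableau_of r m G = T"
    proof (rule nth_equalityI)
      show "length (tableau_of r m G) = length T" using len by (simp add: length_tableau_of)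
      fix t assume "t < length (tableau_of r m G)"
      then have t: "t \<le> m" by (simp add: length_tableau_of)
      show "tableau_of r m G ! t = T ! t"
        using lenT[OF t] t H by (intro nth_equalityI) (auto simp: length_tableau_of tableau_of_nth G_def S_def)
    qed
    then show ?thesis using G by blast
  qed
  then show "tableau_of r m ` matching_families r m = semi_oscillating r m"
    using tableau_of_semi_oscillating by blast
qed

section \<open>Translating the vacillating and oscillating conditions\<close>

lemma young_walk_of_mono:
  assumes g: "matching m g" and t: "t < m"
  shows "young (walk_of m g t) \<subseteq> young (walk_of m g (Suc t)) \<longleftrightarrow> g (Suc t) = 0"
    and "young (walk_of m g (Suc t)) \<subseteq> young (walk_of m g t) \<longleftrightarrow> Suc t \<notin> range g"
proof -
  note st = walk_of_step[OF g t]
  have strict: "young p \<subseteq> young q \<and> \<not> young q \<subseteq> young p" if "add_box p q" for p q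
    using that by (auto simp: add_box_def)
  have ex: "\<not> (g (Suc t) \<noteq> 0 \<and> Suc t \<in> range g)" using g by (metis matching_def nat.distinct(1) rangeE)
  show "young (walk_of m g t) \<subseteq> young (walk_of m g (Suc t)) \<longleftrightarrow> g (Suc t) = 0"
    using st strict by (metis order_refl)
  show "young (walk_of m g (Suc t)) \<subseteq> young (walk_of m g t) \<longleftrightarrow> Suc t \<notin> range g"
    using st strict ex by (metis order_refl)
qed

text \<open>Growth at even steps forbids closers at even positions, and shrinkage at odd steps
  forbids openers at odd positions.\<close>

lemma tableau_of_vacillating_iff:
  assumes G: "G \<in> matching_families r m"
  shows "tableau_of r m G \<in> vacillating r m \<longleftrightarrow> (\<forall>c b. G c b \<noteq> 0 \<longrightarrow> odd b \<and> even (G c b))"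
proof -
  define T where "T = tableau_of r m G"
  have match: "matching m (G c)" for c using G by (simp add: matching_families_def)
  have zero: "G c = (\<lambda>_. 0)" if "\<not> c < r" for c using G that by (simp add: matching_families_def)
  have le: "multipartite_le r (T ! t) (T ! Suc t) \<longleftrightarrow> (\<forall>c<r. G c (Suc t) = 0)"
    "multipartite_le r (T ! Suc t) (T ! t) \<longleftrightarrow> (\<forall>c<r. Suc t \<notin> range (G c))" if "t < m" for t
    using young_walk_of_mono[OF match that] that
    by (auto simp: multipartite_le_def T_def tableau_of_nth)
  have "T \<in> vacillating r m \<longleftrightarrow> (\<forall>i\<in>{1..m}.
        (even i \<longrightarrow> multipartite_le r (T ! (i - 1)) (T ! i)) \<and>
        (odd i \<longrightarrow> multipartite_le r (T ! i) (T ! (i - 1))))"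
    using tableau_of_semi_oscillating[OF G] by (simp add: vacillating_def T_def)
  also have "\<dots> \<longleftrightarrow> (\<forall>t<m. (even (Suc t) \<longrightarrow> multipartite_le r (T ! t) (T ! Suc t)) \<and>
        (odd (Suc t) \<longrightarrow> multipartite_le r (T ! Suc t) (T ! t)))"
    by (rule ball_predecessor)
  also have "\<dots> \<longleftrightarrow> (\<forall>t<m. (even (Suc t) \<longrightarrow> (\<forall>c<r. G c (Suc t) = 0)) \<and>
        (odd (Suc t) \<longrightarrow> (\<forall>c<r. Suc t \<notin> range (G c))))"
    by (intro all_cong) (simp only: le)
  also have "\<dots> \<longleftrightarrow> (\<forall>c b. G c b \<noteq> 0 \<longrightarrow> odd b \<and> even (G c b))"
  proof (intro iffI allI impI)
    fix c b
    assume a: "\<forall>t<m. (even (Suc t) \<longrightarrow> (\<forall>c<r. G c (Suc t) = 0)) \<and> (odd (Suc t) \<longrightarrow> (\<forall>c<r. Suc t \<notin> range (G c)))"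
      and b: "G c b \<noteq> 0"
    have c: "c < r" using b zero by fastforce
    have bm: "b \<le> m" "G c b < b" using match[of c] b by (auto simp: matching_def)
    obtain t where t: "b = Suc t" using bm by (cases b) auto
    obtain s where s: "G c b = Suc s" using b by (cases "G c b") auto
    have "odd b" using a b c t bm(1) by (metis Suc_le_lessD)
    moreover have "even (G c b)"
    proof (rule ccontr)
      assume "odd (G c b)"
      moreover have "s < m" using s bm by simp
      ultimately have "Suc s \<notin> range (G c)" using a s c by auto
      then show False using s by (metis rangeI)
    qed
    ultimately show "odd b \<and> even (G c b)" by simp
  next
    fix t assume "\<forall>c b. G c b \<noteq> 0 \<longrightarrow> odd b \<and> even (G c b)" "t < m"
    then show "(even (Suc t) \<longrightarrow> (\<forall>c<r. G c (Suc t) = 0)) \<and> (odd (Suc t) \<longrightarrow> (\<forall>c<r. Suc t \<notin> range (G c)))"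
      by (metis nat.distinct(1) rangeE)
  qed
  finally show ?thesis by (simp add: T_def)
qed

lemma tableau_of_oscillating_iff:
  assumes G: "G \<in> matching_families r m"
  shows "tableau_of r m G \<in> oscillating r m \<longleftrightarrow> (\<forall>s\<in>{1..m}. \<exists>c. active (G c) s)"
proof -
  define T where "T = tableau_of r m G"
  have match: "matching m (G c)" for c using G by (simp add: matching_families_def)
  have na: "\<not> active (G c) s" if "\<not> c < r" for c s
  proof -
    have "G c = (\<lambda>_. 0)" using G that by (simp add: matching_families_def)
    then show ?thesis by (auto simp: active_def)
  qed
  have "T ! (i - 1) \<noteq> T ! i \<longleftrightarrow> (\<exists>c. active (G c) i)" if i: "i \<in> {1..m}" for i
  proof -
    obtain t where t: "i = Suc t" "t < m" using i by (cases i) auto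
    have "T ! t = T ! Suc t \<longleftrightarrow> (\<forall>c<r. walk_of m (G c) t = walk_of m (G c) (Suc t))"
      unfolding T_def using t(2) by (intro tableau_of_eq_iff) auto
    also have "\<dots> \<longleftrightarrow> (\<forall>c. \<not> active (G c) (Suc t))"
      using walk_of_step_active[OF match t(2)] na by metis
    finally show ?thesis using t(1) by simp
  qed
  then show ?thesis using tableau_of_semi_oscillating[OF G] by (auto simp: oscillating_def T_def)
qed

lemma fits_tableau_of:
  "fits j k (tableau_of r m G) \<longleftrightarrow>
    (\<forall>c<r. \<forall>t\<le>m. columns (walk_of m (G c) t) < j \<and> rows (walk_of m (G c) t) < k)"
  unfolding fits_def tableau_of_def by (auto simp: less_Suc_eq_le simp del: upt_Suc)

section \<open>Set partitions and their arcs\<close>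

text \<open>These turn out to be exactly the sets \<open>Arc P\<close>: every number starts at most
  one arc and ends at most one, so the arcs form disjoint increasing paths.\<close>

definition arc_sets :: "nat \<Rightarrow> (nat \<times> nat) set set" where
  "arc_sets n = {E. E \<subseteq> {(i, j). 1 \<le> i \<and> i < j \<and> j \<le> n} \<and> single_valued E \<and> single_valued (E\<inverse>)}"

definition blocks :: "nat \<Rightarrow> (nat \<times> nat) set \<Rightarrow> nat set set" where
  "blocks n E = (\<lambda>i. {j \<in> {1..n}. (i, j) \<in> E\<^sup>* \<or> (j, i) \<in> E\<^sup>*}) ` {1..n}"

lemma partition_block_eq:
  assumes "partition_on A P" "B \<in> P" "C \<in> P" "x \<in> B" "x \<in> C"
  shows "B = C"
  using assms by (auto simp: partition_on_def disjoint_def)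

lemma ArcE:
  assumes "partition_on A P" "(i, j) \<in> Arc P" "B \<in> P" "i \<in> B \<or> j \<in> B"
  shows "i \<in> B \<and> j \<in> B \<and> i < j \<and> (\<forall>l\<in>B. i < l \<longrightarrow> j \<le> l)"
proof -
  obtain C where C: "C \<in> P" "i \<in> C" "j \<in> C" "i < j" "\<forall>l\<in>C. i < l \<longrightarrow> j \<le> l"
    using assms(2) by (auto simp: Arc_def)
  then have "B = C" using assms(4) partition_block_eq[OF assms(1,3) C(1)] by blast
  then show ?thesis using C by simp
qed

lemma Arc_in_arc_sets:
  assumes P: "partition_on {1..n} P"
  shows "Arc P \<in> arc_sets n"
proof -
  have "Arc P \<subseteq> {(i, j). 1 \<le> i \<and> i < j \<and> j \<le> n}"
  proof
    fix x assume "x \<in> Arc P"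
    then obtain i j B where x: "x = (i, j)" "B \<in> P" "i \<in> B" "j \<in> B" "i < j" by (auto simp: Arc_def)
    then have "i \<in> {1..n}" "j \<in> {1..n}" using partition_onD1[OF P] by blast+
    then show "x \<in> {(i, j). 1 \<le> i \<and> i < j \<and> j \<le> n}" using x by auto
  qed
  moreover have "single_valued (Arc P)"
  proof (rule single_valuedI)
    fix i j k assume a: "(i, j) \<in> Arc P" "(i, k) \<in> Arc P"
    then obtain B where B: "B \<in> P" "i \<in> B" by (auto simp: Arc_def)
    show "j = k" using ArcE[OF P a(1) B(1)] ArcE[OF P a(2) B(1)] B by (meson order_antisym)
  qed
  moreover have "single_valued ((Arc P)\<inverse>)"
  proof (rule single_valuedI)
    fix j i k assume a: "(j, i) \<in> (Arc P)\<inverse>" "(j, k) \<in> (Arc P)\<inverse>"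
    then obtain B where B: "B \<in> P" "j \<in> B" by (auto simp: Arc_def)
    show "i = k" using ArcE[OF P _ B(1), of i j] ArcE[OF P _ B(1), of k j] B a
      by (meson converseD leD linorder_neqE_nat)
  qed
  ultimately show ?thesis by (simp add: arc_sets_def)
qed

lemma Arc_reachable:
  assumes "B \<in> P" "i \<in> B" "j \<in> B" "i \<le> j"
  shows "(i, j) \<in> (Arc P)\<^sup>*"
  using assms
proof (induction "j - i" arbitrary: i rule: less_induct)
  case less
  show ?case
  proof (cases "i = j")
    case False
    then have ij: "i < j" using less by simp
    define l where "l = (LEAST l. l \<in> B \<and> i < l)"
    have l: "l \<in> B" "i < l"
      using LeastI[of "\<lambda>l. l \<in> B \<and> i < l" j] ij less by (auto simp: l_def)
    have min: "l \<le> k" if "k \<in> B" "i < k" for k using that by (auto simp: l_def intro: Least_le)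
    have "(i, l) \<in> Arc P" using l min less by (auto simp: Arc_def)
    moreover have "(l, j) \<in> (Arc P)\<^sup>*"
      using less(1)[of l] l min[of j] ij less by (simp add: diff_less_mono2)
    ultimately show ?thesis by (rule converse_rtrancl_into_rtrancl)
  qed simp
qed

lemma reachable_in_block:
  assumes "partition_on A P" "B \<in> P" "(i, j) \<in> (Arc P)\<^sup>*"
  shows "i \<in> B \<longleftrightarrow> j \<in> B"
  using assms(3) by (induction rule: rtrancl_induct) (use ArcE[OF assms(1) _ assms(2)] in blast)+

lemma blocks_Arc:
  assumes P: "partition_on {1..n} P"
  shows "blocks n (Arc P) = P"
proof -
  have *: "{j \<in> {1..n}. (i, j) \<in> (Arc P)\<^sup>* \<or> (j, i) \<in> (Arc P)\<^sup>*} = B" if B: "B \<in> P" "i \<in> B" for i B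
  proof -
    have "B \<subseteq> {1..n}" using partition_onD1[OF P] B by blast
    moreover have "(i, j) \<in> (Arc P)\<^sup>* \<or> (j, i) \<in> (Arc P)\<^sup>* \<longleftrightarrow> j \<in> B" for j
      using Arc_reachable[OF B(1), of i j] Arc_reachable[OF B(1), of j i] linear[of i j] B(2)
        reachable_in_block[OF P B(1), of i j] reachable_in_block[OF P B(1), of j i] by blast
    ultimately show ?thesis by blast
  qed
  show ?thesis
  proof (intro equalityI subsetI)
    fix X assume "X \<in> blocks n (Arc P)"
    then obtain i where i: "i \<in> {1..n}" "X = {j \<in> {1..n}. (i, j) \<in> (Arc P)\<^sup>* \<or> (j, i) \<in> (Arc P)\<^sup>*}"
      by (auto simp: blocks_def)
    then obtain B where "B \<in> P" "i \<in> B" using partition_onD1[OF P] by blast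
    then show "X \<in> P" using * i by simp
  next
    fix B assume B: "B \<in> P"
    then obtain i where i: "i \<in> B" using partition_onD3[OF P] by (metis ex_in_conv)
    then have "i \<in> {1..n}" using partition_onD1[OF P] B by blast
    then show "B \<in> blocks n (Arc P)" using *[OF B i] unfolding blocks_def by blast
  qed
qed

lemma rtrancl_arc_le:
  assumes "E \<in> arc_sets n" "(i, j) \<in> E\<^sup>*"
  shows "i \<le> j"
  using assms(2) by (induction rule: rtrancl_induct) (use assms(1) in \<open>auto simp: arc_sets_def\<close>)

text \<open>Two paths that leave the same point, or arrive at the same point, run along each other
  because \<open>E\<close> and its converse are single-valued; so one endpoint is reachable from the
  other.\<close>

lemma comparable_trans:
  assumes E: "E \<in> arc_sets n" and "(i, j) \<in> E\<^sup>* \<or> (j, i) \<in> E\<^sup>*" "(j, k) \<in> E\<^sup>* \<or> (k, j) \<in> E\<^sup>*"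
  shows "(i, k) \<in> E\<^sup>* \<or> (k, i) \<in> E\<^sup>*"
proof -
  have sv: "single_valued E" "single_valued (E\<inverse>)" using E by (auto simp: arc_sets_def)
  consider "(i, j) \<in> E\<^sup>*" "(j, k) \<in> E\<^sup>*" | "(j, i) \<in> E\<^sup>*" "(k, j) \<in> E\<^sup>*"
    | "(j, i) \<in> E\<^sup>*" "(j, k) \<in> E\<^sup>*" | "(i, j) \<in> E\<^sup>*" "(k, j) \<in> E\<^sup>*" using assms by blast
  then show ?thesis
  proof cases
    case 3
    then show ?thesis using single_valued_confluent[OF sv(1)] by blast
  next
    case 4
    then have "(j, i) \<in> (E\<inverse>)\<^sup>*" "(j, k) \<in> (E\<inverse>)\<^sup>*" by (simp_all add: rtrancl_converse)
    then have "(i, k) \<in> (E\<inverse>)\<^sup>* \<or> (k, i) \<in> (E\<inverse>)\<^sup>*" using single_valued_confluent[OF sv(2)] by blast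
    then show ?thesis by (auto simp: rtrancl_converse)
  qed (auto intro: rtrancl_trans)
qed

lemma partition_on_blocks:
  assumes E: "E \<in> arc_sets n"
  shows "partition_on {1..n} (blocks n E)"
proof (rule partition_onI)
  show "\<Union>(blocks n E) = {1..n}" by (auto simp: blocks_def)
  show "{} \<notin> blocks n E"
  proof
    assume "{} \<in> blocks n E"
    then obtain i where "i \<in> {1..n}" "{} = {j \<in> {1..n}. (i, j) \<in> E\<^sup>* \<or> (j, i) \<in> E\<^sup>*}"
      by (auto simp: blocks_def)
    then have "i \<in> {}" by blast
    then show False by simp
  qed
next
  fix X Y assume X: "X \<in> blocks n E" and Y: "Y \<in> blocks n E" and ne: "X \<noteq> Y"
  obtain i where i: "X = {j \<in> {1..n}. (i, j) \<in> E\<^sup>* \<or> (j, i) \<in> E\<^sup>*}" using X by (auto simp: blocks_def)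
  obtain k where k: "Y = {j \<in> {1..n}. (k, j) \<in> E\<^sup>* \<or> (j, k) \<in> E\<^sup>*}" using Y by (auto simp: blocks_def)
  show "disjnt X Y"
  proof (rule ccontr)
    assume "\<not> disjnt X Y"
    then obtain x where x: "(i, x) \<in> E\<^sup>* \<or> (x, i) \<in> E\<^sup>*" "(k, x) \<in> E\<^sup>* \<or> (x, k) \<in> E\<^sup>*"
      using i k by (auto simp: disjnt_def)
    then have "(i, k) \<in> E\<^sup>* \<or> (k, i) \<in> E\<^sup>*" using comparable_trans[OF E] by meson
    then have "(i, j) \<in> E\<^sup>* \<or> (j, i) \<in> E\<^sup>* \<longleftrightarrow> (k, j) \<in> E\<^sup>* \<or> (j, k) \<in> E\<^sup>*" for j
      using comparable_trans[OF E] by meson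
    then show False using ne i k by simp
  qed
qed

text \<open>A point of the block to the right of \<open>i\<close> is reached by a path whose first
  step is the unique arc from \<open>i\<close>; as paths increase, the end of this arc is the next
  element of the block.\<close>

lemma Arc_blocks:
  assumes E: "E \<in> arc_sets n"
  shows "Arc (blocks n E) = E"
proof -
  have rng: "1 \<le> i" "i < j" "j \<le> n" if "(i, j) \<in> E" for i j using E that by (auto simp: arc_sets_def)
  have sv: "single_valued E" using E by (auto simp: arc_sets_def)
  have step: "\<exists>l. (i, l) \<in> E \<and> (l, j) \<in> E\<^sup>*" if "i < j" "(i, j) \<in> E\<^sup>* \<or> (j, i) \<in> E\<^sup>*" for i j
    using that rtrancl_arc_le[OF E, of j i] by (metis converse_rtranclE leD less_irrefl)
  have "(i, j) \<in> Arc (blocks n E)" if ij: "(i, j) \<in> E" for i j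
  proof -
    define B where "B = {j \<in> {1..n}. (i, j) \<in> E\<^sup>* \<or> (j, i) \<in> E\<^sup>*}"
    have "B \<in> blocks n E" using rng[OF ij] by (auto simp: B_def blocks_def)
    moreover have "i \<in> B" "j \<in> B" using rng[OF ij] ij by (auto simp: B_def)
    moreover have "j \<le> l" if l: "l \<in> B" "i < l" for l
    proof -
      obtain k where k: "(i, k) \<in> E" "(k, l) \<in> E\<^sup>*" using step[OF l(2)] l(1) by (auto simp: B_def)
      then have "k = j" using sv ij by (auto dest: single_valuedD)
      then show ?thesis using rtrancl_arc_le[OF E] k by blast
    qed
    ultimately show ?thesis using rng[OF ij] unfolding Arc_def by blast
  qed
  moreover have "(i, j) \<in> E" if ij: "(i, j) \<in> Arc (blocks n E)" for i j
  proof -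
    obtain a where a: "i < j" "i \<in> {1..n}" "(a, i) \<in> E\<^sup>* \<or> (i, a) \<in> E\<^sup>*" "(a, j) \<in> E\<^sup>* \<or> (j, a) \<in> E\<^sup>*"
      and min: "\<And>l. l \<in> {1..n} \<Longrightarrow> (a, l) \<in> E\<^sup>* \<or> (l, a) \<in> E\<^sup>* \<Longrightarrow> i < l \<Longrightarrow> j \<le> l"
    proof -
      obtain X where X: "X \<in> blocks n E" "i \<in> X" "j \<in> X" "i < j" "\<forall>l\<in>X. i < l \<longrightarrow> j \<le> l"
        using ij by (auto simp: Arc_def)
      then obtain a where "X = {j \<in> {1..n}. (a, j) \<in> E\<^sup>* \<or> (j, a) \<in> E\<^sup>*}"
        unfolding blocks_def by blast
      then show ?thesis using X(2-) by (intro that[of a]) blast+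
    qed
    have "(i, j) \<in> E\<^sup>* \<or> (j, i) \<in> E\<^sup>*" using comparable_trans[OF E, of i a j] a by blast
    then obtain l where l: "(i, l) \<in> E" "(l, j) \<in> E\<^sup>*" using step a(1) by blast
    have "(a, l) \<in> E\<^sup>* \<or> (l, a) \<in> E\<^sup>*" using comparable_trans[OF E, of a i l] a(3) l(1) by blast
    then have "j \<le> l" using min[of l] rng[OF l(1)] by auto
    moreover have "l \<le> j" using rtrancl_arc_le[OF E l(2)] .
    ultimately show ?thesis using l(1) by simp
  qed
  ultimately show ?thesis by auto
qed

section \<open>Matchings and complete matchings in terms of arcs\<close>

lemma mem_Range_Arc:
  assumes "B \<in> P" "i \<in> B" "j \<in> B" "i < j"
  shows "i \<in> Domain (Arc P)" "j \<in> Range (Arc P)"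
proof -
  have r: "(i, j) \<in> (Arc P)\<^sup>*" using Arc_reachable assms by (simp add: less_imp_le)
  show "i \<in> Domain (Arc P)" using r assms(4) by (metis Domain.DomainI converse_rtranclE less_irrefl)
  show "j \<in> Range (Arc P)" using r assms(4) by (metis Range.intros rtranclE less_irrefl)
qed

text \<open>An element of a block that is neither its minimum nor its maximum ends one arc and
  starts another; a block without such an element has at most two elements.\<close>

lemma matching_iff_Arc:
  assumes P: "partition_on {1..n} P"
  shows "(\<forall>B\<in>P. card B = 1 \<or> card B = 2) \<longleftrightarrow> Domain (Arc P) \<inter> Range (Arc P) = {}"
proof
  assume c: "\<forall>B\<in>P. card B = 1 \<or> card B = 2"
  show "Domain (Arc P) \<inter> Range (Arc P) = {}"
  proof (rule ccontr)
    assume "Domain (Arc P) \<inter> Range (Arc P) \<noteq> {}"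
    then obtain i j k where a: "(i, j) \<in> Arc P" "(j, k) \<in> Arc P" by auto
    then obtain B where B: "B \<in> P" "j \<in> B" by (auto simp: Arc_def)
    have "{i, j, k} \<subseteq> B" "i < j" "j < k" using ArcE[OF P a(1) B(1)] ArcE[OF P a(2) B(1)] B by auto
    moreover have "finite B" using c B(1) by (metis card.infinite zero_neq_one zero_neq_numeral)
    ultimately have "card {i, j, k} \<le> card B" "card {i, j, k} = 3" by (simp_all only: card_mono) auto
    then show False using c B(1) by auto
  qed
next
  assume d: "Domain (Arc P) \<inter> Range (Arc P) = {}"
  show "\<forall>B\<in>P. card B = 1 \<or> card B = 2"
  proof
    fix B assume B: "B \<in> P"
    have "B \<subseteq> {1..n}" using partition_onD1[OF P] B by blast
    then have fin: "finite B" by (rule finite_subset) simp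
    have ne: "B \<noteq> {}" using partition_onD3[OF P] B by blast
    have "B - {Min B, Max B} = {}"
    proof (rule ccontr)
      assume "B - {Min B, Max B} \<noteq> {}"
      then obtain j where j: "j \<in> B" "j \<noteq> Min B" "j \<noteq> Max B" by auto
      have "Min B < j" "j < Max B" using j fin by (simp_all add: le_neq_implies_less)
      then have "j \<in> Range (Arc P)" "j \<in> Domain (Arc P)"
        using mem_Range_Arc[OF B] j fin ne by (meson Min_in Max_in)+
      then show False using d by blast
    qed
    then have "B \<subseteq> {Min B, Max B}" by blast
    then have "card B \<le> card {Min B, Max B}" by (rule card_mono[rotated]) simp
    also have "\<dots> \<le> 2" by (simp add: card_insert_if)
    finally have "card B \<le> 2" .
    moreover have "card B \<noteq> 0" using fin ne by simp
    ultimately show "card B = 1 \<or> card B = 2" by linarith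
  qed
qed

lemma complete_matching_iff_Arc:
  assumes P: "partition_on {1..n} P" and c: "\<forall>B\<in>P. card B = 1 \<or> card B = 2"
  shows "(\<forall>B\<in>P. card B = 2) \<longleftrightarrow> {1..n} \<subseteq> Domain (Arc P) \<union> Range (Arc P)"
proof
  assume 2: "\<forall>B\<in>P. card B = 2"
  show "{1..n} \<subseteq> Domain (Arc P) \<union> Range (Arc P)"
  proof
    fix x assume "x \<in> {1..n}"
    then obtain B where B: "B \<in> P" "x \<in> B" using partition_onD1[OF P] by blast
    then obtain y where "y \<in> B" "y \<noteq> x" using 2 by (metis card_2_iff')
    then show "x \<in> Domain (Arc P) \<union> Range (Arc P)"
      using mem_Range_Arc[OF B(1)] B(2) by (metis UnCI linorder_neqE_nat)
  qed
next
  assume cov: "{1..n} \<subseteq> Domain (Arc P) \<union> Range (Arc P)"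
  show "\<forall>B\<in>P. card B = 2"
  proof (rule ccontr)
    assume "\<not> (\<forall>B\<in>P. card B = 2)"
    then obtain B where "B \<in> P" "card B = 1" using c by blast
    then obtain x where x: "{x} \<in> P" by (metis card_1_singletonE)
    then have "x \<in> {1..n}" using partition_onD1[OF P] by blast
    then obtain y where "(x, y) \<in> Arc P \<or> (y, x) \<in> Arc P" using cov by blast
    then show False using ArcE[OF P _ x, of x y] ArcE[OF P _ x, of y x] by auto
  qed
qed

section \<open>Placing arcs as matchings\<close>

text \<open>The arc \<open>(i, j)\<close> becomes the pair of opener \<open>u i\<close> and closer \<open>w j\<close>. Matchings use the identity for
  \<open>u\<close> and \<open>w\<close>; for partitions, \<open>u i = 2 * i\<close> and \<open>w j = 2 * j - 1\<close> separate the two roles of an element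
  that is both the end of an arc and the start of another one.\<close>

locale arc_placement =
  fixes u w :: "nat \<Rightarrow> nat" and n m r :: nat
  assumes mono_u: "strict_mono u" and mono_w: "strict_mono w"
    and u_less_w: "0 < i \<Longrightarrow> 0 < j \<Longrightarrow> u i < w j \<longleftrightarrow> i < j"
    and w_le: "j \<le> n \<Longrightarrow> w j \<le> m"
begin

lemma u_pos: "0 < i \<Longrightarrow> 0 < u i"
  using strict_monoD[OF mono_u, of 0 i] by simp

lemma u_eq: "u i = u j \<longleftrightarrow> i = j" and u_less: "u i < u j \<longleftrightarrow> i < j"
  using mono_u by (simp_all add: strict_mono_eq strict_mono_less)

lemma w_eq: "w i = w j \<longleftrightarrow> i = j" and w_less: "w i < w j \<longleftrightarrow> i < j"
  using mono_w by (simp_all add: strict_mono_eq strict_mono_less)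

context
  notes [simp] = u_eq u_less w_eq w_less
begin

text \<open>The disjointness keeps openers and closers apart after placement. When \<open>u\<close>
  and \<open>w\<close> are the identity it singles out the matchings; for the doubled positions it
  holds by parity.\<close>

definition colored_arc_sets :: "((nat \<times> nat) set \<times> (nat \<times> nat \<Rightarrow> nat)) set" where
  "colored_arc_sets = {(E, \<phi>). E \<in> arc_sets n \<and> u ` Domain E \<inter> w ` Range E = {} \<and> \<phi> \<in> E \<rightarrow>\<^sub>E {1..r}}"

definition placed_families :: "(nat \<Rightarrow> nat \<Rightarrow> nat) set" where
  "placed_families = {G \<in> matching_families r m. \<forall>c b. G c b \<noteq> 0 \<longrightarrow> b \<in> w ` {1..n} \<and> G c b \<in> u ` {1..n}}"

text \<open>Color \<open>c + 1\<close> is the component with index \<open>c\<close>.\<close>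

definition place :: "(nat \<times> nat) set \<times> (nat \<times> nat \<Rightarrow> nat) \<Rightarrow> nat \<Rightarrow> nat \<Rightarrow> nat" where
  "place X c b = (if \<exists>i j. (i, j) \<in> fst X \<and> w j = b \<and> snd X (i, j) = Suc c
     then u (THE i. \<exists>j. (i, j) \<in> fst X \<and> w j = b) else 0)"

lemma arc_bounds:
  assumes "E \<in> arc_sets n" "(i, j) \<in> E"
  shows "0 < i" "i < j" "0 < j" "j \<le> n" "i \<le> n"
  using assms by (auto simp: arc_sets_def)

lemma arc_unique:
  assumes "E \<in> arc_sets n" "(i, j) \<in> E"
  shows "(i, k) \<in> E \<longleftrightarrow> k = j" "(k, j) \<in> E \<longleftrightarrow> k = i"
  using assms by (auto simp: arc_sets_def single_valued_def)

text \<open>Replaces the description operator in \<open>place\<close> by a relation. The arc is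
  unique because \<open>w\<close> is injective and each number ends at most one arc; the value
  \<open>0\<close> is excluded since it marks positions that are not closers.\<close>

lemma place_iff:
  assumes E: "E \<in> arc_sets n" and a: "a \<noteq> 0"
  shows "place (E, \<phi>) c b = a \<longleftrightarrow> (\<exists>i j. (i, j) \<in> E \<and> \<phi> (i, j) = Suc c \<and> u i = a \<and> w j = b)"
proof (cases "\<exists>i j. (i, j) \<in> E \<and> w j = b \<and> \<phi> (i, j) = Suc c")
  case True
  then obtain i j where ij: "(i, j) \<in> E" "w j = b" "\<phi> (i, j) = Suc c" by blast
  have un: "i' = i \<and> j' = j" if "(i', j') \<in> E" "w j' = b" for i' j'
  proof -
    have "j' = j" using that(2) ij(2) w_eq by metis
    then show ?thesis using arc_unique[OF E ij(1)] that(1) by blast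
  qed
  then have "(THE i. \<exists>j. (i, j) \<in> E \<and> w j = b) = i" using ij by (intro the_equality) blast+
  then have pl: "place (E, \<phi>) c b = u i" using True by (simp add: place_def)
  show ?thesis
  proof
    assume "place (E, \<phi>) c b = a"
    then have "u i = a" using pl by simp
    then show "\<exists>i j. (i, j) \<in> E \<and> \<phi> (i, j) = Suc c \<and> u i = a \<and> w j = b" using ij by blast
  next
    assume "\<exists>i j. (i, j) \<in> E \<and> \<phi> (i, j) = Suc c \<and> u i = a \<and> w j = b"
    then obtain i' j' where "(i', j') \<in> E" "u i' = a" "w j' = b" by blast
    then show "place (E, \<phi>) c b = a" using pl un by simp
  qed
next
  case False
  then show ?thesis using a by (auto simp: place_def)
qed

lemma active_place:
  assumes E: "E \<in> arc_sets n" and s: "active (place (E, \<phi>) c) s"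
  shows "\<exists>i j. (i, j) \<in> E \<and> \<phi> (i, j) = Suc c \<and> (s = u i \<or> s = w j)"
proof -
  from s consider "place (E, \<phi>) c s \<noteq> 0" | b where "place (E, \<phi>) c b = s" "s \<noteq> 0" by (auto simp: active_def)
  then show ?thesis using place_iff[OF E] by cases metis+
qed

lemma place_in_placed_families:
  assumes X: "(E, \<phi>) \<in> colored_arc_sets"
  shows "place (E, \<phi>) \<in> placed_families"
proof -
  have E: "E \<in> arc_sets n" and dis: "u ` Domain E \<inter> w ` Range E = {}" and \<phi>: "\<phi> \<in> E \<rightarrow>\<^sub>E {1..r}"
    using X by (auto simp: colored_arc_sets_def)
  have uw: "u i \<noteq> w j'" if "(i, j) \<in> E" "(i', j') \<in> E" for i j i' j' using dis that by blast
  have ex: "\<exists>i j. (i, j) \<in> E \<and> \<phi> (i, j) = Suc c \<and> place (E, \<phi>) c b = u i \<and> b = w j"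
    if "place (E, \<phi>) c b \<noteq> 0" for c b using place_iff[OF E that] by metis
  have "matching m (place (E, \<phi>) c)" for c
    unfolding matching_def
  proof (intro conjI allI impI)
    fix b assume "place (E, \<phi>) c b \<noteq> 0"
    then obtain i j where ij: "(i, j) \<in> E" "\<phi> (i, j) = Suc c" "place (E, \<phi>) c b = u i" "b = w j" using ex by blast
    note bd = arc_bounds[OF E ij(1)]
    show "b \<le> m" using w_le bd ij by simp
    show "place (E, \<phi>) c b < b" using u_less_w bd ij by simp
    show "place (E, \<phi>) c (place (E, \<phi>) c b) = 0"
      using ex[of c "u i"] uw[OF ij(1)] ij(3) by metis
  next
    show "inj_on (place (E, \<phi>) c) {b. place (E, \<phi>) c b \<noteq> 0}"
    proof (rule inj_onI)
      fix b b' assume a: "b \<in> {b. place (E, \<phi>) c b \<noteq> 0}" "b' \<in> {b. place (E, \<phi>) c b \<noteq> 0}"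
        "place (E, \<phi>) c b = place (E, \<phi>) c b'"
      obtain i j where ij: "(i, j) \<in> E" "place (E, \<phi>) c b = u i" "b = w j" using ex[of c b] a(1) by auto
      obtain i' j' where ij': "(i', j') \<in> E" "place (E, \<phi>) c b' = u i'" "b' = w j'" using ex[of c b'] a(2) by auto
      have "i = i'" using ij ij' a(3) by simp
      then show "b = b'" using arc_unique[OF E ij(1)] ij ij' by auto
    qed
  qed
  moreover have "place (E, \<phi>) c = (\<lambda>_. 0)" if "r \<le> c" for c
  proof
    fix b
    show "place (E, \<phi>) c b = 0"
    proof (rule ccontr)
      assume "place (E, \<phi>) c b \<noteq> 0"
      then obtain i j where "(i, j) \<in> E" "\<phi> (i, j) = Suc c" using ex by blast
      then show False using \<phi> that by (auto simp: PiE_iff)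
    qed
  qed
  moreover have "c = d" if ac: "active (place (E, \<phi>) c) s" and ad: "active (place (E, \<phi>) d) s" for c d s
  proof -
    obtain i j where ij: "(i, j) \<in> E" "\<phi> (i, j) = Suc c" "s = u i \<or> s = w j" using active_place[OF E ac] by blast
    obtain i' j' where ij': "(i', j') \<in> E" "\<phi> (i', j') = Suc d" "s = u i' \<or> s = w j'" using active_place[OF E ad] by blast
    \<comment> \<open>A position cannot be an opener for one arc and a closer for the other, so the
      arcs share a start or an end and hence coincide; their color is then the same.\<close>
    have "i = i' \<or> j = j'" using ij(3) ij'(3) uw[OF ij(1) ij'(1)] uw[OF ij'(1) ij(1)] by auto
    then have "(i, j) = (i', j')" using arc_unique[OF E ij(1)] ij'(1) by auto
    then show "c = d" using ij(2) ij'(2) by simp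
  qed
  ultimately have "place (E, \<phi>) \<in> matching_families r m" unfolding matching_families_def by blast
  moreover have "b \<in> w ` {1..n} \<and> place (E, \<phi>) c b \<in> u ` {1..n}" if nz: "place (E, \<phi>) c b \<noteq> 0" for c b
  proof -
    obtain i j where "(i, j) \<in> E" "place (E, \<phi>) c b = u i" "b = w j" using ex[OF nz] by blast
    then show ?thesis using arc_bounds[OF E] by (auto simp: Suc_le_eq intro!: imageI)
  qed
  ultimately show ?thesis by (simp add: placed_families_def)
qed

lemma inj_on_place: "inj_on place colored_arc_sets"
proof (rule inj_onI)
  fix X Y assume X: "X \<in> colored_arc_sets" and Y: "Y \<in> colored_arc_sets" and eq: "place X = place Y"
  obtain E \<phi> F \<psi> where XY: "X = (E, \<phi>)" "Y = (F, \<psi>)" by (metis surj_pair)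
  have sub: "(i, j) \<in> F \<and> \<psi> (i, j) = \<phi> (i, j)"
    if "(E, \<phi>) \<in> colored_arc_sets" "(F, \<psi>) \<in> colored_arc_sets" "place (E, \<phi>) = place (F, \<psi>)" "(i, j) \<in> E" for E F \<phi> \<psi> i j
  proof -
    have E: "E \<in> arc_sets n" and F: "F \<in> arc_sets n" using that(1,2) by (auto simp: colored_arc_sets_def)
    have "\<phi> (i, j) \<in> {1..r}" using that(1,4) by (auto simp: colored_arc_sets_def)
    then obtain c where c: "\<phi> (i, j) = Suc c" by (cases "\<phi> (i, j)") auto
    have u0: "u i \<noteq> 0" using u_pos arc_bounds[OF E that(4)] by auto
    then have "place (E, \<phi>) c (w j) = u i" using place_iff[OF E u0] c that(4) by blast
    then have "place (F, \<psi>) c (w j) = u i" using that(3) by simp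
    then obtain i' j' where "(i', j') \<in> F" "\<psi> (i', j') = Suc c" "u i' = u i" "w j' = w j"
      using place_iff[OF F u0] by blast
    then show ?thesis using c by auto
  qed
  have EF: "E = F" using sub[of E \<phi> F \<psi>] sub[of F \<psi> E \<phi>] X Y eq XY by auto
  have "\<phi> = \<psi>"
  proof (rule PiE_ext)
    show "\<phi> \<in> E \<rightarrow>\<^sub>E {1..r}" "\<psi> \<in> E \<rightarrow>\<^sub>E {1..r}" using X Y XY EF by (auto simp: colored_arc_sets_def)
    show "\<phi> x = \<psi> x" if "x \<in> E" for x using sub[of E \<phi> F \<psi>] X Y eq XY that by (cases x) auto
  qed
  then show "X = Y" using EF XY by simp
qed

lemma placed_families_subset: "placed_families \<subseteq> place ` colored_arc_sets"
proof
  fix G assume "G \<in> placed_families"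
  then have G: "G \<in> matching_families r m"
    and img: "\<And>c b. G c b \<noteq> 0 \<Longrightarrow> b \<in> w ` {1..n} \<and> G c b \<in> u ` {1..n}"
    by (auto simp: placed_families_def)
  have match: "matching m (G c)" for c using G by (simp add: matching_families_def)
  have zero: "G c = (\<lambda>_. 0)" if "\<not> c < r" for c using G that by (simp add: matching_families_def)
  have act: "c = d" if "active (G c) s" "active (G d) s" for c d s
    using G that unfolding matching_families_def by blast
  define E where "E = {(i, j). 0 < i \<and> 0 < j \<and> (\<exists>c. G c (w j) = u i)}"
  have actE: "active (G c) (w j)" "active (G c) (u i)" "G c (w j) \<noteq> 0"
    if "0 < i" "G c (w j) = u i" for c i j
  proof -
    show nz: "G c (w j) \<noteq> 0" using that u_pos by simp
    then have "w j \<noteq> 0" using match[of c] by (metis matching_def not_less_zero)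
    then show "active (G c) (w j)" "active (G c) (u i)"
      using nz that by (auto simp: active_def) (metis rangeI)+
  qed
  have uni: "c = d" if "0 < i" "G c (w j) = u i" "G d (w j) = u i" for c d i j
    using act actE(1) that by blast
  \<comment> \<open>The color is well defined because the closer \<open>w j\<close> is active in one
    component only; \<open>restrict\<close> makes the coloring extensional.\<close>
  define \<phi> where "\<phi> = restrict (\<lambda>(i, j). Suc (THE c. G c (w j) = u i)) E"
  have \<phi>: "\<phi> (i, j) = Suc c" if "(i, j) \<in> E" "G c (w j) = u i" for i j c
  proof -
    have "0 < i" using that by (simp add: E_def)
    then have "(THE c. G c (w j) = u i) = c" using that(2) uni by (intro the_equality) auto
    then show ?thesis using that(1) by (simp add: \<phi>_def)
  qed
  have bds: "1 \<le> i \<and> i < j \<and> j \<le> n" if ij: "(i, j) \<in> E" for i j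
  proof -
    obtain c where c: "0 < i" "0 < j" "G c (w j) = u i" using ij by (auto simp: E_def)
    have "u i < w j" using match[of c] actE(3)[OF c(1,3)] c(3) by (metis matching_def)
    then have "i < j" using u_less_w c by blast
    moreover have "j \<le> n" using img[OF actE(3)[OF c(1,3)]] by auto
    ultimately show ?thesis using c by auto
  qed
  have Earc: "E \<in> arc_sets n"
    unfolding arc_sets_def
  proof (intro CollectI conjI)
    show "E \<subseteq> {(i, j). 1 \<le> i \<and> i < j \<and> j \<le> n}" using bds by auto
    show "single_valued E"
    proof (rule single_valuedI)
      fix i j k assume a: "(i, j) \<in> E" "(i, k) \<in> E"
      then obtain c d where cd: "0 < i" "G c (w j) = u i" "G d (w k) = u i" by (auto simp: E_def)
      then have "c = d" using act actE(2) by blast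
      then have "w j = w k" using match[of c] actE(3)[OF cd(1,2)] actE(3)[OF cd(1,3)] cd
        unfolding matching_def by (metis (mono_tags, lifting) inj_on_eq_iff mem_Collect_eq)
      then show "j = k" by simp
    qed
    show "single_valued (E\<inverse>)"
    proof (rule single_valuedI)
      fix j i k assume a: "(j, i) \<in> E\<inverse>" "(j, k) \<in> E\<inverse>"
      then obtain c d where cd: "0 < i" "0 < k" "G c (w j) = u i" "G d (w j) = u k" by (auto simp: E_def)
      then have "c = d" using act actE(1) by blast
      then show "i = k" using cd by simp
    qed
  qed
  have "u ` Domain E \<inter> w ` Range E = {}"
  proof (rule ccontr)
    assume "u ` Domain E \<inter> w ` Range E \<noteq> {}"
    then obtain i j i' j' where a: "(i, j) \<in> E" "(i', j') \<in> E" "u i = w j'" by auto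
    then obtain c d where cd: "0 < i" "0 < i'" "G c (w j) = u i" "G d (w j') = u i'" by (auto simp: E_def)
    have "c = d" using act[of c "u i" d] actE(2)[OF cd(1,3)] actE(1)[OF cd(2,4)] a(3) by simp
    then have "G c (G c (w j)) \<noteq> 0" using cd a(3) u_pos by simp
    then show False using match[of c] actE(3)[OF cd(1,3)] by (metis matching_def)
  qed
  moreover have "\<phi> \<in> E \<rightarrow>\<^sub>E {1..r}"
  proof (rule PiE_I)
    fix x assume x: "x \<in> E"
    obtain i j where ij: "x = (i, j)" by (cases x)
    obtain c where c: "0 < i" "G c (w j) = u i" using x ij by (auto simp: E_def)
    then have "c < r" using zero[of c] actE(3)[OF c] by metis
    then show "\<phi> x \<in> {1..r}" using \<phi>[of i j c] x ij c by simp
  qed (simp add: \<phi>_def)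
  ultimately have X: "(E, \<phi>) \<in> colored_arc_sets" using Earc by (simp add: colored_arc_sets_def)
  have "place (E, \<phi>) c b = a \<longleftrightarrow> G c b = a" if a: "a \<noteq> 0" for a b c
  proof
    assume "place (E, \<phi>) c b = a"
    then obtain i j where ij: "(i, j) \<in> E" "\<phi> (i, j) = Suc c" "u i = a" "w j = b"
      using place_iff[OF Earc a] by blast
    then obtain d where "G d (w j) = u i" by (auto simp: E_def)
    then show "G c b = a" using \<phi>[OF ij(1)] ij by auto
  next
    assume Ga: "G c b = a"
    then obtain i j where ij: "b = w j" "a = u i" "i \<in> {1..n}" "j \<in> {1..n}" using img[of c b] a by auto
    have mem: "(i, j) \<in> E" using Ga ij by (auto simp: E_def)
    have "\<phi> (i, j) = Suc c" using Ga ij by (intro \<phi>[OF mem]) simp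
    then show "place (E, \<phi>) c b = a"
      unfolding place_iff[OF Earc a] using mem ij by (intro exI[of _ i] exI[of _ j]) simp
  qed
  then have "place (E, \<phi>) = G" by (intro ext) metis
  then show "G \<in> place ` colored_arc_sets" using X by blast
qed

lemma bij_betw_place: "bij_betw place colored_arc_sets placed_families"
  using inj_on_place place_in_placed_families placed_families_subset
  by (intro bij_betw_imageI) auto

text \<open>Covers crossings with \<open>R\<close> as \<open><\<close> and nestings with
  \<open>R\<close> as \<open>>\<close>. The arcs of such a list pass over a common gap
  \<open>t\<close>, and \<open>u_less_w\<close> carries the separation of openers from closers over
  to the placed positions, including the case where one arc ends at the point where another
  starts.\<close>

lemma monochromatic_arcs_iff:
  assumes X: "(E, \<phi>) \<in> colored_arc_sets" and r: "0 < r"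
    and R: "\<And>i j. R (u i) (u j) \<longleftrightarrow> R i j"
  shows "(\<exists>as. length as = k \<and> set as \<subseteq> E \<and> sorted_wrt (<) (map snd as) \<and> sorted_wrt R (map fst as) \<and>
      (\<forall>x\<in>set as. \<forall>y\<in>set as. fst x < snd y) \<and> monochromatic \<phi> as) \<longleftrightarrow>
    (\<exists>c<r. \<exists>t\<le>m. \<exists>bs. sorted_wrt (<) bs \<and>
      (\<forall>b\<in>set bs. t < b \<and> b \<le> m \<and> 0 < place (E, \<phi>) c b \<and> place (E, \<phi>) c b \<le> t) \<and>
      sorted_wrt R (map (place (E, \<phi>) c) bs) \<and> length bs = k)"
proof
  have E: "E \<in> arc_sets n" and \<phi>: "\<phi> \<in> E \<rightarrow>\<^sub>E {1..r}" using X by (auto simp: colored_arc_sets_def)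
  assume "\<exists>as. length as = k \<and> set as \<subseteq> E \<and> sorted_wrt (<) (map snd as) \<and> sorted_wrt R (map fst as) \<and>
      (\<forall>x\<in>set as. \<forall>y\<in>set as. fst x < snd y) \<and> monochromatic \<phi> as"
  then obtain as where as: "length as = k" "set as \<subseteq> E" "sorted_wrt (<) (map snd as)" "sorted_wrt R (map fst as)"
    "\<And>x y. x \<in> set as \<Longrightarrow> y \<in> set as \<Longrightarrow> fst x < snd y" "monochromatic \<phi> as" by blast
  show "\<exists>c<r. \<exists>t\<le>m. \<exists>bs. sorted_wrt (<) bs \<and>
      (\<forall>b\<in>set bs. t < b \<and> b \<le> m \<and> 0 < place (E, \<phi>) c b \<and> place (E, \<phi>) c b \<le> t) \<and>
      sorted_wrt R (map (place (E, \<phi>) c) bs) \<and> length bs = k"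
  proof (cases "as = []")
    case True
    \<comment> \<open>The empty list has no color of its own, so component \<open>0\<close> is
      taken, which exists because \<open>r\<close> is positive.\<close>
    then show ?thesis using r as(1) by (intro exI[of _ 0] conjI exI[of _ "[]"]) auto
  next
    case False
    then have h: "hd as \<in> E" "hd as \<in> set as" using as(2) by auto
    then have "\<phi> (hd as) \<in> {1..r}" using \<phi> by auto
    then obtain c where c: "\<phi> (hd as) = Suc c" "c < r" by (cases "\<phi> (hd as)") auto
    have col: "\<phi> x = Suc c" if "x \<in> set as" for x using as(6) that h(2) c(1) unfolding monochromatic_def by metis
    \<comment> \<open>The gap right after the last opener lies under all arcs of the list.\<close>
    define t where "t = Max ((u \<circ> fst) ` set as)"
    have "t \<in> (u \<circ> fst) ` set as" unfolding t_def using False by (intro Max_in) auto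
    then obtain x0 where x0: "x0 \<in> set as" "t = u (fst x0)" by auto
    have tge: "u (fst x) \<le> t" if "x \<in> set as" for x unfolding t_def using that by (intro Max_ge) auto
    define bs where "bs = map (w \<circ> snd) as"
    have pl: "place (E, \<phi>) c (w (snd x)) = u (fst x)" and pos: "0 < u (fst x)" and lt: "t < w (snd x)"
      and wm: "w (snd x) \<le> m" if x: "x \<in> set as" for x
    proof -
      have xE: "(fst x, snd x) \<in> E" using x as(2) by auto
      have x0E: "(fst x0, snd x0) \<in> E" using x0 as(2) by auto
      show p: "0 < u (fst x)" using u_pos arc_bounds[OF E xE] by simp
      show "place (E, \<phi>) c (w (snd x)) = u (fst x)"
        using place_iff[OF E, of "u (fst x)"] p xE col[OF x] by (metis less_numeral_extra(3) prod.collapse)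
      show "t < w (snd x)"
        using u_less_w arc_bounds[OF E xE] arc_bounds[OF E x0E] as(5)[OF x0(1) x] x0(2) by simp
      show "w (snd x) \<le> m" using w_le arc_bounds[OF E xE] by simp
    qed
    have "sorted_wrt (<) bs" using as(3) by (simp add: bs_def sorted_wrt_map)
    moreover have "\<forall>b\<in>set bs. t < b \<and> b \<le> m \<and> 0 < place (E, \<phi>) c b \<and> place (E, \<phi>) c b \<le> t"
      using pl pos lt wm tge by (auto simp: bs_def)
    moreover have "map (place (E, \<phi>) c) bs = map u (map fst as)" using pl by (simp add: bs_def)
    then have "sorted_wrt R (map (place (E, \<phi>) c) bs)" using as(4) R by (simp only: sorted_wrt_map)
    moreover have "t \<le> m" using lt[OF h(2)] wm[OF h(2)] by simp
    ultimately show ?thesis using c(2) as(1) by (intro exI[of _ c] conjI exI[of _ t] exI[of _ bs]) (auto simp: bs_def)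
  qed
next
  have E: "E \<in> arc_sets n" using X by (auto simp: colored_arc_sets_def)
  assume "\<exists>c<r. \<exists>t\<le>m. \<exists>bs. sorted_wrt (<) bs \<and>
      (\<forall>b\<in>set bs. t < b \<and> b \<le> m \<and> 0 < place (E, \<phi>) c b \<and> place (E, \<phi>) c b \<le> t) \<and>
      sorted_wrt R (map (place (E, \<phi>) c) bs) \<and> length bs = k"
  then obtain c t bs where bs: "sorted_wrt (<) bs"
    "\<And>b. b \<in> set bs \<Longrightarrow> t < b \<and> b \<le> m \<and> 0 < place (E, \<phi>) c b \<and> place (E, \<phi>) c b \<le> t"
    "sorted_wrt R (map (place (E, \<phi>) c) bs)" "length bs = k" by blast
  have "\<exists>x. b \<in> set bs \<longrightarrow> x \<in> E \<and> \<phi> x = Suc c \<and> u (fst x) = place (E, \<phi>) c b \<and> w (snd x) = b" for b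
  proof (cases "b \<in> set bs")
    case True
    then show ?thesis using bs(2)[OF True] place_iff[OF E, of "place (E, \<phi>) c b" \<phi> c b] by fastforce
  qed simp
  then obtain f where f: "\<And>b. b \<in> set bs \<Longrightarrow> f b \<in> E \<and> \<phi> (f b) = Suc c \<and> u (fst (f b)) = place (E, \<phi>) c b \<and> w (snd (f b)) = b"
    by metis
  have "map w (map snd (map f bs)) = bs" using f by (simp add: map_idI)
  then have "sorted_wrt (<) (map w (map snd (map f bs)))" using bs(1) by simp
  then have "sorted_wrt (<) (map snd (map f bs))" by (simp add: sorted_wrt_map)
  moreover have "map (place (E, \<phi>) c) bs = map u (map fst (map f bs))" using f by simp
  then have "sorted_wrt R (map u (map fst (map f bs)))" using bs(3) by (simp only:)
  then have "sorted_wrt R (map fst (map f bs))" using R by (simp add: sorted_wrt_map)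
  moreover have "\<forall>x\<in>set (map f bs). \<forall>y\<in>set (map f bs). fst x < snd y"
  proof (intro ballI)
    fix x y assume "x \<in> set (map f bs)" "y \<in> set (map f bs)"
    then obtain a b where ab: "a \<in> set bs" "b \<in> set bs" "x = f a" "y = f b" by auto
    have xE: "(fst x, snd x) \<in> E" "(fst y, snd y) \<in> E" using f ab by auto
    have "u (fst x) < w (snd y)" using f[OF ab(1)] f[OF ab(2)] bs(2)[OF ab(1)] bs(2)[OF ab(2)] ab by simp
    then show "fst x < snd y" using u_less_w arc_bounds[OF E xE(1)] arc_bounds[OF E xE(2)] by simp
  qed
  moreover have "set (map f bs) \<subseteq> E" "monochromatic \<phi> (map f bs)" using f by (auto simp: monochromatic_def)
  ultimately show "\<exists>as. length as = k \<and> set as \<subseteq> E \<and> sorted_wrt (<) (map snd as) \<and> sorted_wrt R (map fst as) \<and>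
      (\<forall>x\<in>set as. \<forall>y\<in>set as. fst x < snd y) \<and> monochromatic \<phi> as"
    using bs(4) by (intro exI[of _ "map f bs"]) auto
qed

end

end

section \<open>The bijections\<close>

lemma crossing_iff:
  "crossing P k as \<longleftrightarrow> length as = k \<and> set as \<subseteq> Arc P \<and> sorted_wrt (<) (map snd as) \<and>
     sorted_wrt (<) (map fst as) \<and> (\<forall>x\<in>set as. \<forall>y\<in>set as. fst x < snd y)"
  unfolding crossing_def sorted_wrt_append set_map by blast

text \<open>A nesting lists its arcs by increasing opener, hence by decreasing closer; reversal
  sorts it by closer, as the words require.\<close>

lemma nesting_rev_iff:
  "nesting P k (rev as) \<longleftrightarrow> length as = k \<and> set as \<subseteq> Arc P \<and> sorted_wrt (<) (map snd as) \<and>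
     sorted_wrt (>) (map fst as) \<and> (\<forall>x\<in>set as. \<forall>y\<in>set as. fst x < snd y)"
  unfolding nesting_def sorted_wrt_append by (auto simp: rev_map[symmetric] sorted_wrt_rev)

context arc_placement
begin

lemma crossing_iff_columns:
  assumes X: "(Arc P, \<phi>) \<in> colored_arc_sets" and r: "0 < r"
  shows "(\<exists>as. crossing P k as \<and> monochromatic \<phi> as) \<longleftrightarrow>
    (\<exists>c<r. \<exists>t\<le>m. k \<le> columns (walk_of m (place (Arc P, \<phi>) c) t))"
proof -
  have match: "matching m (place (Arc P, \<phi>) c)" for c
    using place_in_placed_families[OF X] by (simp add: placed_families_def matching_families_def)
  show ?thesis
    unfolding crossing_iff columns_walk_of[OF match]
    using monochromatic_arcs_iff[OF X r, of "(<)" k] by (simp add: conj_ac u_less)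
qed

lemma nesting_iff_rows:
  assumes X: "(Arc P, \<phi>) \<in> colored_arc_sets" and r: "0 < r"
  shows "(\<exists>as. nesting P k as \<and> monochromatic \<phi> as) \<longleftrightarrow>
    (\<exists>c<r. \<exists>t\<le>m. k \<le> rows (walk_of m (place (Arc P, \<phi>) c) t))"
proof -
  have match: "matching m (place (Arc P, \<phi>) c)" for c
    using place_in_placed_families[OF X] by (simp add: placed_families_def matching_families_def)
  have "(\<exists>as. nesting P k as \<and> monochromatic \<phi> as) \<longleftrightarrow> (\<exists>as. nesting P k (rev as) \<and> monochromatic \<phi> as)"
    by (metis monochromatic_def rev_rev_ident set_rev)
  then show ?thesis
    unfolding nesting_rev_iff rows_walk_of[OF match]
    using monochromatic_arcs_iff[OF X r, of "(>)" k] by (simp add: conj_ac u_less)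
qed

lemma cr_ne_iff_fits:
  assumes P: "partition_on {1..n} P" and X: "(Arc P, \<phi>) \<in> colored_arc_sets" and r: "0 < r"
  shows "cr (P, \<phi>) < j \<and> ne (P, \<phi>) < k \<longleftrightarrow> fits j k (tableau_of r m (place (Arc P, \<phi>)))"
proof -
  have "crossing P 0 []" "nesting P 0 []" "monochromatic \<phi> []"
    by (simp_all add: crossing_def nesting_def monochromatic_def)
  then have ne: "{k. \<exists>as. crossing P k as \<and> monochromatic \<phi> as} \<noteq> {}"
    "{k. \<exists>as. nesting P k as \<and> monochromatic \<phi> as} \<noteq> {}" by blast+
  have "cr (P, \<phi>) < j \<longleftrightarrow> (\<forall>k. (\<exists>as. crossing P k as \<and> monochromatic \<phi> as) \<longrightarrow> k < j)"
    using Max_less_iff[OF finite_crossing_sizes[OF P] ne(1), of j] by (simp add: cr_def)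
  also have "\<dots> \<longleftrightarrow> (\<forall>c<r. \<forall>t\<le>m. columns (walk_of m (place (Arc P, \<phi>) c) t) < j)"
    \<comment> \<open>The bound on columns follows by taking \<open>k\<close> to be the number of
      columns itself.\<close>
    unfolding crossing_iff_columns[OF X r] by (meson le_less_trans order_refl)
  finally have 1: "cr (P, \<phi>) < j \<longleftrightarrow> \<dots>" .
  have "ne (P, \<phi>) < k \<longleftrightarrow> (\<forall>l. (\<exists>as. nesting P l as \<and> monochromatic \<phi> as) \<longrightarrow> l < k)"
    using Max_less_iff[OF finite_nesting_sizes[OF P] ne(2), of k] by (simp add: ne_def)
  also have "\<dots> \<longleftrightarrow> (\<forall>c<r. \<forall>t\<le>m. rows (walk_of m (place (Arc P, \<phi>) c) t) < k)"
    unfolding nesting_iff_rows[OF X r] by (meson le_less_trans order_refl)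
  finally have 2: "ne (P, \<phi>) < k \<longleftrightarrow> \<dots>" .
  show ?thesis unfolding 1 2 fits_tableau_of by blast
qed

definition placed_partitions :: "colored_partition set" where
  "placed_partitions = {(P, \<phi>) \<in> colored_partitions r n. u ` Domain (Arc P) \<inter> w ` Range (Arc P) = {}}"

definition tableau_map :: "colored_partition \<Rightarrow> nat list list list" where
  "tableau_map \<Lambda> = tableau_of r m (place (Arc (fst \<Lambda>), snd \<Lambda>))"

lemma placed_partitions_iff:
  "(P, \<phi>) \<in> placed_partitions \<longleftrightarrow> partition_on {1..n} P \<and> (Arc P, \<phi>) \<in> colored_arc_sets"
  using Arc_in_arc_sets[of n P]
  by (auto simp: placed_partitions_def colored_partitions_def colored_arc_sets_def)

lemma bij_betw_arcs: "bij_betw (\<lambda>\<Lambda>. (Arc (fst \<Lambda>), snd \<Lambda>)) placed_partitions colored_arc_sets"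
proof (rule bij_betw_imageI)
  show "inj_on (\<lambda>\<Lambda>. (Arc (fst \<Lambda>), snd \<Lambda>)) placed_partitions"
  proof (rule inj_onI)
    fix X Y :: colored_partition
    assume a: "X \<in> placed_partitions" "Y \<in> placed_partitions" "(Arc (fst X), snd X) = (Arc (fst Y), snd Y)"
    have "partition_on {1..n} (fst X)" "partition_on {1..n} (fst Y)"
      using a(1,2) placed_partitions_iff by (metis prod.collapse)+
    then have "fst X = fst Y" using a(3) blocks_Arc by (metis prod.inject)
    then show "X = Y" using a(3) by (simp add: prod_eq_iff)
  qed
  show "(\<lambda>\<Lambda>. (Arc (fst \<Lambda>), snd \<Lambda>)) ` placed_partitions = colored_arc_sets"
  proof (intro equalityI subsetI)
    fix Y assume "Y \<in> (\<lambda>\<Lambda>. (Arc (fst \<Lambda>), snd \<Lambda>)) ` placed_partitions"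
    then show "Y \<in> colored_arc_sets" using placed_partitions_iff by auto
  next
    fix Y assume Y: "Y \<in> colored_arc_sets"
    obtain E \<phi> where E: "Y = (E, \<phi>)" by (cases Y)
    then have "E \<in> arc_sets n" using Y by (simp add: colored_arc_sets_def)
    then have b: "partition_on {1..n} (blocks n E)" "Arc (blocks n E) = E"
      by (rule partition_on_blocks, rule Arc_blocks)
    then have "(blocks n E, \<phi>) \<in> placed_partitions" using placed_partitions_iff Y E by auto
    then show "Y \<in> (\<lambda>\<Lambda>. (Arc (fst \<Lambda>), snd \<Lambda>)) ` placed_partitions" using b(2) E by force
  qed
qed

lemma bij_betw_tableau_map:
  "bij_betw tableau_map placed_partitions (tableau_of r m ` placed_families)"
proof -
  have "bij_betw (tableau_of r m) placed_families (tableau_of r m ` placed_families)"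
    by (rule bij_betw_subset[OF bij_betw_tableau_of]) (auto simp: placed_families_def)
  from bij_betw_trans[OF bij_betw_trans[OF bij_betw_arcs bij_betw_place] this]
  show ?thesis by (simp add: comp_def tableau_map_def[abs_def])
qed

lemma tableau_map_fits:
  assumes "\<Lambda> \<in> placed_partitions" "0 < r"
  shows "cr \<Lambda> < j \<and> ne \<Lambda> < k \<longleftrightarrow> fits j k (tableau_map \<Lambda>)"
  using assms cr_ne_iff_fits[of "fst \<Lambda>" "snd \<Lambda>" j k] placed_partitions_iff[of "fst \<Lambda>" "snd \<Lambda>"]
  by (simp add: tableau_map_def)

end

lemma colored_matchings_iff:
  "(P, \<phi>) \<in> colored_matchings r n \<longleftrightarrow>
     (P, \<phi>) \<in> colored_partitions r n \<and> Domain (Arc P) \<inter> Range (Arc P) = {}"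
  using matching_iff_Arc[of n P] by (auto simp: colored_matchings_def colored_partitions_def)

lemma colored_partitions_bijection:
  assumes "r > 0"
  shows "\<exists>f. bij_betw f (colored_partitions r n) (vacillating r (2 * n)) \<and>
    (\<forall>\<Lambda>\<in>colored_partitions r n. \<forall>j k. cr \<Lambda> < j \<and> ne \<Lambda> < k \<longleftrightarrow> fits j k (f \<Lambda>))"
proof -
  \<comment> \<open>The closer of a point precedes its opener, so arcs that merely meet at a point
    do not overlap, and boxes are deleted at odd and added at even steps.\<close>
  interpret arc_placement "\<lambda>i. 2 * i" "\<lambda>j. 2 * j - 1" n "2 * n" r
    by unfold_locales (auto simp: strict_mono_def)
  have "placed_partitions = colored_partitions r n"
  proof -
    have "(\<lambda>i. 2 * i) ` Domain (Arc P) \<inter> (\<lambda>j. 2 * j - 1) ` Range (Arc P) = {}"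
      if "partition_on {1..n} P" for P
    proof (rule ccontr)
      assume "(\<lambda>i. 2 * i) ` Domain (Arc P) \<inter> (\<lambda>j. 2 * j - 1) ` Range (Arc P) \<noteq> {}"
      then obtain i j i' where ij: "(i', j) \<in> Arc P" "2 * i = 2 * j - 1" by auto
      then have "0 < j" using arc_bounds[OF Arc_in_arc_sets[OF that]] by blast
      then show False using ij(2) by presburger
    qed
    then show ?thesis unfolding placed_partitions_def colored_partitions_def by blast
  qed
  moreover have "tableau_of r (2 * n) ` placed_families = vacillating r (2 * n)"
  proof -
    have pf: "placed_families = {G \<in> matching_families r (2 * n). tableau_of r (2 * n) G \<in> vacillating r (2 * n)}"
    proof -
      have "(G c b \<noteq> 0 \<longrightarrow> b \<in> (\<lambda>j. 2 * j - 1) ` {1..n} \<and> G c b \<in> (\<lambda>i. 2 * i) ` {1..n}) \<longleftrightarrow>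
          (G c b \<noteq> 0 \<longrightarrow> odd b \<and> even (G c b))" if G: "G \<in> matching_families r (2 * n)" for G c b
      proof (intro imp_cong refl iffI)
        assume "b \<in> (\<lambda>j. 2 * j - 1) ` {1..n} \<and> G c b \<in> (\<lambda>i. 2 * i) ` {1..n}"
        then show "odd b \<and> even (G c b)" by auto
      next
        assume nz: "G c b \<noteq> 0" and par: "odd b \<and> even (G c b)"
        have "matching (2 * n) (G c)" using G by (simp add: matching_families_def)
        then have le: "b \<le> 2 * n" "G c b < b" using nz by (auto simp: matching_def)
        obtain j where j: "b = 2 * j + 1" using par by (auto elim: oddE)
        obtain i where i: "G c b = 2 * i" using par by (auto elim: evenE)
        \<comment> \<open>Within the bounds of a matching, parity alone characterizes the admissible
          positions.\<close>
        have "b = 2 * (j + 1) - 1" "j + 1 \<in> {1..n}" "i \<in> {1..n}" using i j le nz by auto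
        then show "b \<in> (\<lambda>j. 2 * j - 1) ` {1..n} \<and> G c b \<in> (\<lambda>i. 2 * i) ` {1..n}" using i by blast
      qed
      then show ?thesis unfolding placed_families_def using tableau_of_vacillating_iff by blast
    qed
    have "vacillating r (2 * n) \<subseteq> tableau_of r (2 * n) ` matching_families r (2 * n)"
      using bij_betw_imp_surj_on[OF bij_betw_tableau_of[of r "2 * n"]] by (auto simp: vacillating_def)
    then show ?thesis unfolding pf by blast
  qed
  ultimately show ?thesis using bij_betw_tableau_map tableau_map_fits assms by (intro exI[of _ tableau_map]) auto
qed

lemma colored_matchings_bijection:
  assumes "r > 0"
  shows "\<exists>f. bij_betw f (colored_matchings r n) (semi_oscillating r n) \<and>
    bij_betw f (colored_complete_matchings r n) (oscillating r n) \<and>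
    (\<forall>\<Lambda>\<in>colored_matchings r n. \<forall>j k. cr \<Lambda> < j \<and> ne \<Lambda> < k \<longleftrightarrow> fits j k (f \<Lambda>))"
proof -
  interpret arc_placement "\<lambda>i. i" "\<lambda>j. j" n n r
    by unfold_locales (auto simp: strict_mono_def)
  have A: "placed_partitions = colored_matchings r n"
    unfolding placed_partitions_def image_ident
  proof (rule set_eqI)
    fix \<Lambda> :: colored_partition
    show "\<Lambda> \<in> {(P, \<phi>) \<in> colored_partitions r n. Domain (Arc P) \<inter> Range (Arc P) = {}} \<longleftrightarrow>
        \<Lambda> \<in> colored_matchings r n"
      using colored_matchings_iff[of "fst \<Lambda>" "snd \<Lambda>" r n] by (simp add: case_prod_beta)
  qed
  have "placed_families = matching_families r n"
  proof -
    have "b \<in> (\<lambda>j. j) ` {1..n} \<and> G c b \<in> (\<lambda>i. i) ` {1..n}"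
      if "G \<in> matching_families r n" "G c b \<noteq> 0" for G c b
    proof -
      have "matching n (G c)" using that(1) by (simp add: matching_families_def)
      then have "b \<le> n" "G c b < b" using that(2) by (auto simp: matching_def)
      then show ?thesis using that(2) by auto
    qed
    then show ?thesis unfolding placed_families_def by blast
  qed
  then have B: "tableau_of r n ` placed_families = semi_oscillating r n"
    using bij_betw_imp_surj_on[OF bij_betw_tableau_of] by simp
  have bij: "bij_betw tableau_map (colored_matchings r n) (semi_oscillating r n)"
    using bij_betw_tableau_map unfolding A B .
  have osc: "tableau_map (P, \<phi>) \<in> oscillating r n \<longleftrightarrow> (P, \<phi>) \<in> colored_complete_matchings r n"
    if L: "(P, \<phi>) \<in> colored_matchings r n" for P \<phi>
  proof -
    have P: "partition_on {1..n} P" and X: "(Arc P, \<phi>) \<in> colored_arc_sets"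
      using L placed_partitions_iff unfolding A by blast+
    have c: "\<forall>B\<in>P. card B = 1 \<or> card B = 2" using L by (simp add: colored_matchings_def)
    have E: "Arc P \<in> arc_sets n" using Arc_in_arc_sets[OF P] .
    have "place (Arc P, \<phi>) \<in> matching_families r n"
      using place_in_placed_families[OF X] by (simp add: placed_families_def)
    then have "tableau_map (P, \<phi>) \<in> oscillating r n \<longleftrightarrow> (\<forall>s\<in>{1..n}. \<exists>c. active (place (Arc P, \<phi>) c) s)"
      by (simp add: tableau_map_def tableau_of_oscillating_iff)
    also have "\<dots> \<longleftrightarrow> {1..n} \<subseteq> Domain (Arc P) \<union> Range (Arc P)"
    proof -
      \<comment> \<open>Colors start at \<open>1\<close> and components at \<open>0\<close>, hence
        the shift.\<close>
      have "active (place (Arc P, \<phi>) (\<phi> (i, j) - 1)) i \<and> active (place (Arc P, \<phi>) (\<phi> (i, j) - 1)) j"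
        if ij: "(i, j) \<in> Arc P" for i j
      proof -
        have "\<phi> (i, j) \<in> {1..r}" using X ij by (auto simp: colored_arc_sets_def)
        then obtain d where d: "\<phi> (i, j) = Suc d" by (cases "\<phi> (i, j)") auto
        have i0: "i \<noteq> 0" "j \<noteq> 0" using arc_bounds[OF E ij] by auto
        have "place (Arc P, \<phi>) d j = i" using place_iff[OF E i0(1)] ij d by blast
        then show ?thesis using d i0 by (auto simp: active_def)
      qed
      moreover have "s \<in> Domain (Arc P) \<union> Range (Arc P)" if "active (place (Arc P, \<phi>) d) s" for s d
        using active_place[OF E that] by auto
      ultimately show ?thesis by blast
    qed
    also have "\<dots> \<longleftrightarrow> (P, \<phi>) \<in> colored_complete_matchings r n"
      using complete_matching_iff_Arc[OF P c] L by (simp add: colored_complete_matchings_def)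
    finally show ?thesis .
  qed
  \<comment> \<open>The bijection for complete matchings is the restriction of the one for
    matchings: no step is idle iff every position is an endpoint of an arc.\<close>
  have "bij_betw tableau_map {\<Lambda> \<in> colored_matchings r n. \<Lambda> \<in> colored_complete_matchings r n}
      {T \<in> semi_oscillating r n. T \<in> oscillating r n}"
    using bij osc by (intro bij_betw_Collect) auto
  moreover have "{\<Lambda> \<in> colored_matchings r n. \<Lambda> \<in> colored_complete_matchings r n} = colored_complete_matchings r n"
    by (auto simp: colored_complete_matchings_def)
  moreover have "{T \<in> semi_oscillating r n. T \<in> oscillating r n} = oscillating r n"
    by (auto simp: oscillating_def)
  ultimately have "bij_betw tableau_map (colored_complete_matchings r n) (oscillating r n)" by simp
  then show ?thesis using bij tableau_map_fits[unfolded A] assms by (intro exI[of _ tableau_map]) blast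
qed

theorem theorem3p3:
  fixes n r :: nat
  assumes "n > 0" and "r > 0"
  shows "(\<exists>f. bij_betw f (colored_partitions r n) (vacillating r (2 * n)) \<and>
           (\<forall>\<Lambda>\<in>colored_partitions r n. \<forall>j>0. \<forall>k>0.
              (cr \<Lambda> < j \<and> ne \<Lambda> < k) \<longleftrightarrow> fits j k (f \<Lambda>))) \<and>
         (\<exists>f. bij_betw f (colored_matchings r n) (semi_oscillating r n) \<and>
           (\<forall>\<Lambda>\<in>colored_matchings r n. \<forall>j>0. \<forall>k>0.
              (cr \<Lambda> < j \<and> ne \<Lambda> < k) \<longleftrightarrow> fits j k (f \<Lambda>))) \<and>
         (\<exists>f. bij_betw f (colored_complete_matchings r (2 * n)) (oscillating r (2 * n)) \<and>
           (\<forall>\<Lambda>\<in>colored_complete_matchings r (2 * n). \<forall>j>0. \<forall>k>0.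
              (cr \<Lambda> < j \<and> ne \<Lambda> < k) \<longleftrightarrow> fits j k (f \<Lambda>)))"
proof -
  have "\<exists>f. bij_betw f (colored_complete_matchings r (2 * n)) (oscillating r (2 * n)) \<and>
      (\<forall>\<Lambda>\<in>colored_complete_matchings r (2 * n). \<forall>j k. cr \<Lambda> < j \<and> ne \<Lambda> < k \<longleftrightarrow> fits j k (f \<Lambda>))"
  proof -
    have "colored_complete_matchings r (2 * n) \<subseteq> colored_matchings r (2 * n)"
      by (auto simp: colored_complete_matchings_def)
    then show ?thesis using colored_matchings_bijection[OF assms(2), of "2 * n"] by blast
  qed
  moreover note colored_partitions_bijection[OF assms(2), of n] colored_matchings_bijection[OF assms(2), of n]
  ultimately show ?thesis by meson
qed

end
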